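(* Let $b,c>0$, let $n\ge 0$ be an integer, let $\nu=n$ (case $d=2$) or $\nu=n+1/2$ (case $d=3$), and let $\{z_j^\nu\}_{j=1}^{M_\nu}$ be the zeros of the modified Bessel function of the second kind $K_\nu(z)$. Let $$\sigma_\nu(t)=\mathcal L^{-1}\left[\frac sc+\frac1{2b}+\frac sc\,\frac{K_\nu'(sb/c)}{K_\nu(sb/c)}\right](t),\qquad t>0.$$ Then: (a) for $d=2$ (that is, $\nu=n$), $$\sigma_n(t)=\frac{c}{b^2}\bigg\{\sum_{j=1}^{M_n} z_j^n e^{ct z_j^n/b}+(-1)^n\int_0^\infty \frac{e^{-ctr/b}}{K_n^2(r)+\pi^2 I_n^2(r)}\,dr\bigg\};$$ (b) for $d=3$ (that is, $\nu=n+1/2$), $$\sigma_\nu(t)=\frac{c}{b^2}\sum_{j=1}^{M_\nu} z_j^\nu e^{ct z_j^\nu/b},\qquad \nu=n+1/2.$$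
   Context: $I_\nu$ and $K_\nu$ are the modified Bessel functions of the first and second kind. $\mathcal L[h](s)=\int_0^\infty e^{-st}h(t)\,dt$ is the Laplace transform and $\mathcal L^{-1}$ its inverse, given by the Bromwich integral $\mathcal L^{-1}[H](t)=\frac1{2\pi \mathrm i}\int_{\gamma-\mathrm i\infty}^{\gamma+\mathrm i\infty}H(s)e^{ts}\,ds$, with $\gamma$ greater than the real part of every singularity of $H$. For integer $\nu=n$, $K_n$ is taken on its principal branch (branch cut along the negative real axis). $M_\nu$ denotes the total number of zeros of $K_\nu$: for $\nu=n$ it is the even integer nearest to $n-1/2$; for $\nu=n+1/2$ it equals $n$. All these zeros are known to be simple and to have negative real part. *)

theory Defs
  imports "HOL-Complex_Analysis.Complex_Analysis"
begin

text \<open>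
  Principal branches: \<open>powr\<close> on the complex numbers uses \<^const>\<open>Ln\<close>, whose cut is the negative
  real axis. Using the entire function \<^const>\<open>rGamma\<close> makes the series meaningful for every order.
\<close>

definition bessel_I :: "complex \<Rightarrow> complex \<Rightarrow> complex" where
  "bessel_I \<nu> z =
     (z / 2) powr \<nu> * (\<Sum>k. rGamma (\<nu> + of_nat k + 1) / fact k * (z / 2) ^ (2 * k))"

text \<open>For integer order the defining quotient is 0/0 and is replaced by its limit in the order.\<close>

definition bessel_K :: "complex \<Rightarrow> complex \<Rightarrow> complex" where
  "bessel_K \<nu> z =
     (let Q = (\<lambda>\<mu>. of_real pi / 2 * (bessel_I (- \<mu>) z - bessel_I \<mu> z) / sin (\<mu> * of_real pi))
      in if \<nu> \<in> \<int> then Lim (at \<nu>) Q else Q \<nu>)"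

text \<open>
  The origin is a branch point; the value HOL assigns to \<^const>\<open>bessel_K\<close> there is meaningless, so
  it must not be counted as a zero. For half-integer order a zero may lie on the negative real axis,
  where the principal branch is defined by \<open>arg z = \<pi>\<close>.
\<close>

definition bessel_K_zeros :: "complex \<Rightarrow> complex set" where
  "bessel_K_zeros \<nu> = {z. z \<noteq> 0 \<and> bessel_K \<nu> z = 0}"

text \<open>
  The line \<open>Re s = \<gamma>\<close> lies strictly to the right of all singularities of \<open>H\<close>.
\<close>

definition right_of_singularities :: "(complex \<Rightarrow> complex) \<Rightarrow> real \<Rightarrow> bool" where
  "right_of_singularities H \<gamma> \<longleftrightarrow> (\<exists>\<gamma>\<^sub>0<\<gamma>. H holomorphic_on {s. Re s > \<gamma>\<^sub>0})"

text \<open>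
  The Bromwich integral is the limit of integrals over the segments from \<open>\<gamma> - iT\<close> to
  \<open>\<gamma> + iT\<close>; it need not converge absolutely. The value must be the same for every
  admissible \<open>\<gamma>\<close>, and there must be an admissible one.
\<close>

definition has_inverse_laplace :: "(complex \<Rightarrow> complex) \<Rightarrow> real \<Rightarrow> complex \<Rightarrow> bool" where
  "has_inverse_laplace H t v \<longleftrightarrow>
     (\<exists>\<gamma>. right_of_singularities H \<gamma>) \<and>
     (\<forall>\<gamma>. right_of_singularities H \<gamma> \<longrightarrow>
        ((\<lambda>T. 1 / (2 * of_real pi * \<i>) *
              contour_integral (linepath (Complex \<gamma> (- T)) (Complex \<gamma> T))
                (\<lambda>s. H s * exp (of_real t * s))) \<longlongrightarrow> v) at_top)"

definition inverse_laplace :: "(complex \<Rightarrow> complex) \<Rightarrow> real \<Rightarrow> complex" where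
  "inverse_laplace H t = (THE v. has_inverse_laplace H t v)"

lemma has_inverse_laplace_unique:
  assumes "has_inverse_laplace H t v" "has_inverse_laplace H t w"
  shows "v = w"
  using assms unfolding has_inverse_laplace_def
  by (meson tendsto_unique trivial_limit_at_top_linorder)

lemma inverse_laplace_eqI: "has_inverse_laplace H t v \<Longrightarrow> inverse_laplace H t = v"
  unfolding inverse_laplace_def using has_inverse_laplace_unique by blast

definition sigma_transform :: "real \<Rightarrow> real \<Rightarrow> complex \<Rightarrow> complex \<Rightarrow> complex" where
  "sigma_transform b c \<nu> s =
     s / of_real c + 1 / (2 * of_real b) +
     s / of_real c * (deriv (bessel_K \<nu>) (s * of_real b / of_real c) /
                      bessel_K \<nu> (s * of_real b / of_real c))"

definition sigma_nu :: "real \<Rightarrow> real \<Rightarrow> complex \<Rightarrow> real \<Rightarrow> complex" where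
  "sigma_nu b c \<nu> t = inverse_laplace (sigma_transform b c \<nu>) t"

end

theory Submission
  imports Defs "HOL-Real_Asymp.Real_Asymp" "HOL-Computational_Algebra.Fundamental_Theorem_Algebra"
begin

text \<open>
  With \<open>z = b s / c\<close> the transform becomes \<open>1 / b\<close> times \<open>z + 1 / 2 + z K' / K\<close>. This function has simple
  poles at the zeros \<open>a\<close> of \<open>K\<close>, with principal parts \<open>a / (z - a)\<close>, and what remains is holomorphic in the plane
  slit along the negative axis (\<open>zero_factorization_log_deriv\<close>). Inverting a principal part gives
  \<open>a exp (\<tau> a)\<close> with \<open>\<tau> = c t / b\<close> (\<open>bromwich_simple_pole\<close>), and these are the sums in both formulas. Everything else
  concerns the regular part and the lines on which the transform may be inverted.

  At half-integer order \<open>K\<close> is an elementary factor times a reverse Bessel polynomial, and the regular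
  part vanishes identically (\<open>half_integer_factorization\<close>). At integer order it has a jump across the cut. It is
  continuous on the closed upper half-plane including the edge of the cut and the origin, commutes with conjugation, and is
  of order \<open>1 / z\<close> at infinity. Closing the contour separately in the two half-planes therefore leaves the integral of the
  jump (\<open>bromwich_cut\<close>). The continuation formula \<open>K\<^sub>n (- r) = (-1)\<^sup>n K\<^sub>n r - \<i> \<pi> I\<^sub>n r\<close> and the cross product of
  \<open>I\<close> and \<open>K\<close> turn the jump into the density with denominator \<open>K\<^sub>n\<^sup>2 + \<pi>\<^sup>2 I\<^sub>n\<^sup>2\<close>
  (\<open>dirichlet_to_neumann_edge\<close>, \<open>integer_bromwich\<close>).

  The decay has to be uniform up to the cut, and it also yields that there are finitely many zeros. It rests on
  integral representations: \<open>K\<^sub>0\<close> and \<open>K\<^sub>1\<close>, defined by limits in the order, satisfy the same first-order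
  system as two Laplace integrals over \<open>v > 1\<close>, and the behaviour at the origin shows that they agree
  (\<open>integer_K_laplace\<close>; the constant terms match because both are the derivative of the Gamma function at one). Substituting
  \<open>v = 1 + u / z\<close> continues the integrals to the slit plane, where the principal square root has non-negative real part;
  this makes their expansions in \<open>1 / z\<close> uniform (\<open>root_moment_asymptotics\<close>). The three-term recurrence carries the first two
  terms to all orders (\<open>scaled_K_asymptotics\<close>), and in \<open>z + 1 / 2 + z K' / K\<close> they cancel.

  Finally, the value must be the same on all lines to the right of the singularities. Such a line cannot have
  a zero of \<open>K\<close> on its right or on it, that being a pole of the transform, and its abscissa cannot be zero or negative: at integer
  order the jump prevents holomorphy across the cut, and at half-integer order the value of the transform at the origin differs from its limit there
  (\<open>sigma_transform_zero_not_right\<close>, \<open>integer_not_holomorphic_across_cut\<close>, \<open>half_integer_not_holomorphic_at_0\<close>). So every admissible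
  line passes to the right of the origin and of all zeros, where the computation above applies.
\<close>

section \<open>The Bessel--Clifford function and its derivative in the order\<close>

text \<open>
  The Bessel--Clifford function, normalised by the reciprocal Gamma function. Together with the power
  \<open>(z / 2) powr \<mu>\<close> it makes up \<^const>\<open>bessel_I\<close>; being entire in the argument and in the order, it
  confines the branch point to that power.
\<close>
definition bessel_clifford :: "complex \<Rightarrow> complex \<Rightarrow> complex" where
  "bessel_clifford \<mu> y = (\<Sum>k. rGamma (\<mu> + of_nat k + 1) / fact k * y ^ k)"

text \<open>
  The derivative of the Bessel--Clifford function in the order. It carries the part of \<open>K\<close> that
  accompanies the logarithm at integer order.
\<close>
definition bessel_clifford_dorder :: "complex \<Rightarrow> complex \<Rightarrow> complex" where
  "bessel_clifford_dorder \<mu> y = (\<Sum>k. deriv rGamma (\<mu> + of_nat k + 1) / fact k * y ^ k)"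

text \<open>
  From some index on, the functional equation only divides by numbers of modulus at least one. So the
  bound is decided by finitely many indices, and there compactness gives it.
\<close>
lemma rGamma_shift_bounded:
  fixes R :: real
  obtains C where "C \<ge> 0" "\<And>\<mu> k. norm \<mu> \<le> R \<Longrightarrow> norm (rGamma (\<mu> + of_nat k + 1) :: complex) \<le> C"
proof -
  obtain m :: nat where m: "real m > R + 1" using reals_Archimedean2 by blast
  have "compact (rGamma ` cball (0::complex) (R + real m + 2))"
    by (intro compact_continuous_image continuous_on_rGamma) auto
  then obtain C where C: "\<And>z. z \<in> cball (0::complex) (R + real m + 2) \<Longrightarrow> norm (rGamma z) \<le> C"
    by (metis bounded_iff compact_imp_bounded imageI)
  have C0: "norm (rGamma (\<mu> + of_nat k + 1)) \<le> C" if "k \<le> m" "norm \<mu> \<le> R" for k and \<mu> :: complex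
  proof (rule C)
    have "norm (\<mu> + of_nat k + 1) \<le> norm \<mu> + norm (of_nat k :: complex) + norm (1::complex)"
      by (intro order.trans[OF norm_triangle_ineq] add_mono norm_triangle_ineq order.refl)
    also have "\<dots> \<le> R + real m + 2" using that by simp
    finally show "\<mu> + of_nat k + 1 \<in> cball 0 (R + real m + 2)" by simp
  qed
  have "norm (rGamma (\<mu> + of_nat k + 1)) \<le> C" if "norm \<mu> \<le> R" for k and \<mu> :: complex
  proof (cases "k \<le> m")
    case False
    then have "k \<ge> m" by simp
    then show ?thesis
    proof (induction k rule: dec_induct)
      case base then show ?case using C0 that by simp
    next
      case (step k)
      let ?w = "\<mu> + of_nat k + 1"
      have "1 \<le> real k + 1 - norm \<mu>" using step that m by linarith
      also have "\<dots> = norm (of_nat k + 1 :: complex) - norm (-\<mu>)"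
        by (simp add: norm_of_nat[where 'a=complex, of "Suc k", simplified] del: of_nat_Suc norm_of_nat)
           (metis norm_of_nat of_nat_Suc add.commute)
      also have "\<dots> \<le> norm ?w"
        using norm_triangle_ineq2[of "of_nat k + 1" "-\<mu>"] by (simp add: algebra_simps)
      finally have w: "norm ?w \<ge> 1" .
      have "norm ?w * norm (rGamma (?w + 1)) = norm (rGamma ?w)"
        using rGamma_plus1[of ?w] by (metis norm_mult)
      moreover have "norm (rGamma (?w + 1)) \<le> norm ?w * norm (rGamma (?w + 1))"
        using w by (simp add: mult_le_cancel_right1)
      ultimately show ?case using step by (simp add: algebra_simps)
    qed
  qed (use C0 that in auto)
  then show ?thesis using that[of "max C 0"] by (simp add: le_max_iff_disj)
qed

lemma rGamma_has_deriv: "(rGamma has_field_derivative deriv rGamma z) (at (z::complex))"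
  by (simp add: DERIV_deriv_iff_field_differentiable field_differentiable_rGamma)

text \<open>
  The uniform bound on the reciprocal Gamma function dominates the series, locally uniformly in the
  order, by the exponential series; hence it may be differentiated termwise in the order.
\<close>
lemma bessel_clifford_series:
  shows bessel_clifford_sums: "(\<lambda>k. rGamma (\<mu> + of_nat k + 1) / fact k * y ^ k) sums bessel_clifford \<mu> y"
    and bessel_clifford_dorder_sums:
      "(\<lambda>k. deriv rGamma (\<mu> + of_nat k + 1) / fact k * y ^ k) sums bessel_clifford_dorder \<mu> y"
    and bessel_clifford_has_derivative_order:
      "((\<lambda>\<mu>. bessel_clifford \<mu> y) has_field_derivative bessel_clifford_dorder \<mu> y) (at \<mu>)"
proof -
  obtain C where C: "C \<ge> 0" "\<And>\<nu> k. norm \<nu> \<le> norm \<mu> + 1 \<Longrightarrow> norm (rGamma (\<nu> + of_nat k + 1) :: complex) \<le> C"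
    using rGamma_shift_bounded[of "norm \<mu> + 1"] by blast
  let ?S = "ball \<mu> 1"
  have S: "norm \<nu> \<le> norm \<mu> + 1" if "\<nu> \<in> ?S" for \<nu>
    using that norm_triangle_ineq2[of \<nu> \<mu>] by (auto simp: dist_norm norm_minus_commute)
  have summ: "summable (\<lambda>k. C * (norm y ^ k / fact k))"
    using summable_exp[of "norm y"] by (intro summable_mult) (simp add: divide_inverse mult.commute)
  have der: "((\<lambda>\<nu>. rGamma (\<nu> + of_nat k + 1) / fact k * y ^ k) has_field_derivative
      deriv rGamma (\<nu> + of_nat k + 1) / fact k * y ^ k) (at \<nu>)" for \<nu> k
  proof -
    have "((\<lambda>\<nu>. rGamma (\<nu> + of_nat k + 1)) has_field_derivative deriv rGamma (\<nu> + of_nat k + 1)) (at \<nu>)"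
      using DERIV_shift[of rGamma _ \<nu> "of_nat k + 1"] rGamma_has_deriv[of "\<nu> + (of_nat k + 1)"]
      by (simp add: add.assoc)
    from DERIV_cmult[OF this, of "y ^ k / fact k"] show ?thesis by (simp add: mult_ac)
  qed
  have bd: "\<forall>\<^sub>F k in sequentially. \<forall>\<nu>\<in>?S. norm (rGamma (\<nu> + of_nat k + 1) / fact k * y ^ k) \<le> C * (norm y ^ k / fact k)"
  proof (intro always_eventually allI ballI)
    fix k \<nu> assume "\<nu> \<in> ?S"
    then have "norm (rGamma (\<nu> + of_nat k + 1)) * (norm y ^ k / fact k) \<le> C * (norm y ^ k / fact k)"
      by (intro mult_right_mono C S) auto
    moreover have "norm (a / fact k * y ^ k) = norm a * (norm y ^ k / fact k)" for a :: complex
      by (simp add: norm_mult norm_divide norm_power)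
    ultimately show "norm (rGamma (\<nu> + of_nat k + 1) / fact k * y ^ k) \<le> C * (norm y ^ k / fact k)"
      by (simp only:)
  qed
  obtain g g' where g: "\<And>\<nu>. \<nu> \<in> ?S \<Longrightarrow> ((\<lambda>k. rGamma (\<nu> + of_nat k + 1) / fact k * y ^ k) sums g \<nu>) \<and>
     ((\<lambda>k. deriv rGamma (\<nu> + of_nat k + 1) / fact k * y ^ k) sums g' \<nu>) \<and> (g has_field_derivative g' \<nu>) (at \<nu>)"
    by (rule series_and_derivative_comparison[OF open_ball summ der bd]) blast
  have mu: "\<mu> \<in> ?S" by simp
  show "(\<lambda>k. rGamma (\<mu> + of_nat k + 1) / fact k * y ^ k) sums bessel_clifford \<mu> y"
    using g[OF mu] unfolding bessel_clifford_def by (blast intro: summable_sums sums_summable)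
  show d: "(\<lambda>k. deriv rGamma (\<mu> + of_nat k + 1) / fact k * y ^ k) sums bessel_clifford_dorder \<mu> y"
    using g[OF mu] unfolding bessel_clifford_dorder_def by (blast intro: summable_sums sums_summable)
  have "g' \<mu> = bessel_clifford_dorder \<mu> y" using d g[OF mu] sums_unique2 by blast
  moreover have "bessel_clifford \<nu> y = g \<nu>" if "\<nu> \<in> ?S" for \<nu>
    using sums_unique[OF conjunct1[OF g[OF that]]] unfolding bessel_clifford_def by (rule sym)
  ultimately show "((\<lambda>\<mu>. bessel_clifford \<mu> y) has_field_derivative bessel_clifford_dorder \<mu> y) (at \<mu>)"
    using has_field_derivative_transform_within_open[OF conjunct2[OF conjunct2[OF g[OF mu]]] open_ball mu] by simp
qed

lemma bessel_I_eq: "bessel_I \<mu> z = (z / 2) powr \<mu> * bessel_clifford \<mu> ((z / 2)\<^sup>2)"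
  by (simp add: bessel_I_def bessel_clifford_def power_mult)

lemma bessel_clifford_has_derivative:
  "(bessel_clifford \<mu> has_field_derivative bessel_clifford (\<mu> + 1) y) (at y)"
proof -
  let ?c = "\<lambda>k. rGamma (\<mu> + of_nat k + 1) / fact k"
  have "((\<lambda>y. \<Sum>k. ?c k * y ^ k) has_field_derivative (\<Sum>k. diffs ?c k * y ^ k)) (at y)"
    using bessel_clifford_sums[of \<mu>] by (intro termdiffs_strong_converges_everywhere) (auto simp: sums_iff)
  moreover have "diffs ?c k = rGamma (\<mu> + 1 + of_nat k + 1) / fact k" for k
    by (simp add: diffs_def field_simps del: of_nat_Suc) (simp add: algebra_simps)
  ultimately show ?thesis
    by (simp add: bessel_clifford_def[abs_def])
qed

lemma bessel_clifford_dorder_has_derivative: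
  "(bessel_clifford_dorder \<mu> has_field_derivative bessel_clifford_dorder (\<mu> + 1) y) (at y)"
proof -
  let ?c = "\<lambda>k. deriv rGamma (\<mu> + of_nat k + 1) / fact k"
  have "((\<lambda>y. \<Sum>k. ?c k * y ^ k) has_field_derivative (\<Sum>k. diffs ?c k * y ^ k)) (at y)"
    using bessel_clifford_dorder_sums[of \<mu>] by (intro termdiffs_strong_converges_everywhere) (auto simp: sums_iff)
  moreover have "diffs ?c k = deriv rGamma (\<mu> + 1 + of_nat k + 1) / fact k" for k
    by (simp add: diffs_def field_simps del: of_nat_Suc) (simp add: algebra_simps)
  ultimately show ?thesis
    by (simp add: bessel_clifford_dorder_def[abs_def])
qed

text \<open>Coefficientwise this is the functional equation of the reciprocal Gamma function.\<close>
lemma bessel_clifford_recurrence: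
  "bessel_clifford (\<mu> - 1) y = \<mu> * bessel_clifford \<mu> y + y * bessel_clifford (\<mu> + 1) y"
proof -
  let ?f = "\<lambda>k. of_nat k * (rGamma (\<mu> + of_nat k + 1) / fact k) * y ^ k"
  have "(\<lambda>k. y * (rGamma (\<mu> + 1 + of_nat k + 1) / fact k * y ^ k)) sums (y * bessel_clifford (\<mu> + 1) y)"
    by (intro sums_mult bessel_clifford_sums)
  also have "(\<lambda>k. y * (rGamma (\<mu> + 1 + of_nat k + 1) / fact k * y ^ k)) = (\<lambda>k. ?f (Suc k))"
    by (intro ext) (simp add: field_simps del: of_nat_Suc, simp add: algebra_simps)
  finally have "?f sums (y * bessel_clifford (\<mu> + 1) y)"
    by (subst (asm) sums_Suc_iff) simp
  from sums_add[OF sums_mult[OF bessel_clifford_sums[of \<mu> y], of \<mu>] this]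
  have "(\<lambda>k. rGamma (\<mu> - 1 + of_nat k + 1) / fact k * y ^ k) sums
     (\<mu> * bessel_clifford \<mu> y + y * bessel_clifford (\<mu> + 1) y)"
  proof (rule sums_cong[THEN iffD1, rotated])
    fix k
    have "rGamma (\<mu> - 1 + of_nat k + 1) = (\<mu> + of_nat k) * rGamma (\<mu> + of_nat k + 1)"
      using rGamma_plus1[of "\<mu> + of_nat k"] by (simp add: algebra_simps)
    then show "\<mu> * (rGamma (\<mu> + of_nat k + 1) / fact k * y ^ k) + ?f k = rGamma (\<mu> - 1 + of_nat k + 1) / fact k * y ^ k"
      by (simp add: field_simps)
  qed
  then show ?thesis using bessel_clifford_sums sums_unique2 by blast
qed

lemma bessel_clifford_dorder_recurrence:
  "bessel_clifford_dorder (\<mu> - 1) y =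
     bessel_clifford \<mu> y + \<mu> * bessel_clifford_dorder \<mu> y + y * bessel_clifford_dorder (\<mu> + 1) y"
proof -
  have "((\<lambda>\<mu>. \<mu> * bessel_clifford \<mu> y + y * bessel_clifford (\<mu> + 1) y) has_field_derivative
      bessel_clifford \<mu> y + \<mu> * bessel_clifford_dorder \<mu> y + y * bessel_clifford_dorder (\<mu> + 1) y) (at \<mu>)"
    using DERIV_add[OF DERIV_mult[OF DERIV_ident bessel_clifford_has_derivative_order]
        DERIV_cmult[OF iffD1[OF DERIV_shift bessel_clifford_has_derivative_order[of y "\<mu> + 1"]]]]
    by (simp add: add_ac mult_ac)
  moreover have "((\<lambda>\<mu>. bessel_clifford (\<mu> - 1) y) has_field_derivative bessel_clifford_dorder (\<mu> - 1) y) (at \<mu>)"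
    using iffD1[OF DERIV_shift, of "\<lambda>\<mu>. bessel_clifford \<mu> y" _ \<mu> "-1"]
      bessel_clifford_has_derivative_order[of y "\<mu> - 1"] by simp
  ultimately show ?thesis
    unfolding bessel_clifford_recurrence by (metis DERIV_unique)
qed

text \<open>
  The symmetry of \<open>I\<close> between the orders \<open>n\<close> and \<open>- n\<close>, freed from the power factors.
\<close>
lemma bessel_clifford_minus_of_nat:
  "bessel_clifford (- of_nat n) y = y ^ n * bessel_clifford (of_nat n) y"
proof (induction n rule: less_induct)
  case (less n)
  consider "n = 0" | "n = 1" | m where "n = m + 2"
    by (metis One_nat_def add_2_eq_Suc' not0_implies_Suc)
  then show ?case
  proof cases
    case 2
    then show ?thesis using bessel_clifford_recurrence[of 0 y] by simp
  next
    case 3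
    have 1: "bessel_clifford (- of_nat m) y = y ^ m * bessel_clifford (of_nat m) y"
        "bessel_clifford (- of_nat (m+1)) y = y ^ (m+1) * bessel_clifford (of_nat (m+1)) y"
      using less.IH[of m] less.IH[of "m + 1"] 3 by linarith+
    have "bessel_clifford (- of_nat n) y = - (of_nat m + 1) * bessel_clifford (- of_nat (m+1)) y + y * bessel_clifford (- of_nat m) y"
      using bessel_clifford_recurrence[of "- of_nat (m+1)" y] 3 by (simp add: algebra_simps)
    also have "\<dots> = y ^ (m+1) * (bessel_clifford (of_nat m) y - (of_nat m + 1) * bessel_clifford (of_nat (m+1)) y)"
      unfolding 1 by (simp add: algebra_simps)
    also have "bessel_clifford (of_nat m) y = (of_nat m + 1) * bessel_clifford (of_nat (m+1)) y + y * bessel_clifford (of_nat n) y"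
      using bessel_clifford_recurrence[of "of_nat (m+1)" y] 3 by (simp add: algebra_simps)
    finally show ?thesis using 3 by (simp add: algebra_simps)
  qed simp
qed

lemma bessel_I_of_nat: "z \<noteq> 0 \<Longrightarrow> bessel_I (of_nat n) z = (z / 2) ^ n * bessel_clifford (of_nat n) ((z/2)\<^sup>2)"
  by (simp add: bessel_I_eq powr_nat')

text \<open>
  At an integer order the numerator of the defining quotient of \<^const>\<open>bessel_K\<close> vanishes, so the
  limit is the quotient of the derivatives of numerator and denominator in the order.
\<close>
lemma bessel_K_of_nat:
  assumes "z \<noteq> 0"
  shows "bessel_K (of_nat n) z = (-1) ^ (n + 1) *
    (Ln (z / 2) * bessel_I (of_nat n) z + 1 / 2 * (bessel_clifford_dorder (- of_nat n) ((z/2)\<^sup>2) / (z/2)^n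
       + (z/2)^n * bessel_clifford_dorder (of_nat n) ((z/2)\<^sup>2)))"
proof -
  let ?y = "(z/2)\<^sup>2" and ?n = "of_nat n :: complex"
  define N where "N = (\<lambda>\<mu>. bessel_I (- \<mu>) z - bessel_I \<mu> z)"
  define N' where "N' = - (2 * Ln (z/2) * bessel_I ?n z) -
      (bessel_clifford_dorder (- of_nat n) ?y / (z/2)^n + (z/2)^n * bessel_clifford_dorder (of_nat n) ?y)"
  have z2: "z / 2 \<noteq> 0" using assms by simp
  have powr_n: "w powr (-?n) = 1 / w^n" "w powr ?n = w^n" if "w \<noteq> 0" for w
    using that by (simp_all add: powr_minus powr_nat' inverse_eq_divide)
  note pw = powr_n[OF z2]
  have "1 / w ^ n * ((w\<^sup>2) ^ n * x) = w ^ n * x" if "w \<noteq> 0" for w x :: complex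
    using that by (simp add: power2_eq_square power_mult_distrib)
  from this[OF z2] have In: "bessel_I (-?n) z = bessel_I ?n z"
    unfolding bessel_I_eq pw bessel_clifford_minus_of_nat by simp
  have dpos: "((\<lambda>\<mu>. bessel_I \<mu> z) has_field_derivative
      Ln (z/2) * bessel_I ?n z + (z/2)^n * bessel_clifford_dorder ?n ?y) (at ?n)"
    unfolding bessel_I_eq
    using DERIV_mult[OF has_field_derivative_powr_right[OF z2] bessel_clifford_has_derivative_order[of ?y ?n]]
    by (simp add: pw mult_ac add_ac)
  have dneg: "((\<lambda>\<mu>. bessel_I \<mu> z) has_field_derivative
      Ln (z/2) * bessel_I (-?n) z + bessel_clifford_dorder (-?n) ?y / (z/2)^n) (at (-?n))"
    unfolding bessel_I_eq
    using DERIV_mult[OF has_field_derivative_powr_right[OF z2] bessel_clifford_has_derivative_order[of ?y "-?n"]]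
    by (simp add: pw mult_ac add_ac)
  have "(N has_field_derivative - (Ln (z/2) * bessel_I (-?n) z + bessel_clifford_dorder (-?n) ?y / (z/2)^n)
      - (Ln (z/2) * bessel_I ?n z + (z/2)^n * bessel_clifford_dorder ?n ?y)) (at ?n)"
    unfolding N_def
    using DERIV_diff[OF DERIV_chain2[OF dneg DERIV_minus[OF DERIV_ident]] dpos] by simp
  then have dN: "(N has_field_derivative N') (at ?n)"
    unfolding N'_def In by (simp add: algebra_simps)
  have "((\<lambda>\<mu>::complex. sin (\<mu> * of_real pi)) has_field_derivative cos (?n * of_real pi) * of_real pi) (at ?n)"
    by (rule derivative_eq_intros refl | simp)+
  moreover have "cos (?n * of_real pi) = (-1) ^ n"
    using cos_npi[of n] by (metis cos_of_real of_real_mult of_real_of_nat_eq of_real_minus of_real_1 of_real_power)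
  ultimately have dS: "((\<lambda>\<mu>::complex. sin (\<mu> * of_real pi)) has_field_derivative (-1)^n * of_real pi) (at ?n)"
    by simp
  have N0: "N ?n = 0" by (simp add: N_def In)
  have S0: "sin (?n * of_real pi) = 0"
    using sin_npi[of n] by (metis sin_of_real of_real_mult of_real_of_nat_eq of_real_0)
  have "((\<lambda>\<mu>. ((N \<mu> - N ?n) / (\<mu> - ?n)) / ((sin (\<mu> * of_real pi) - sin (?n * of_real pi)) / (\<mu> - ?n)))
      \<longlongrightarrow> N' / ((-1)^n * of_real pi)) (at ?n)"
    by (intro tendsto_divide dN[unfolded has_field_derivative_iff] dS[unfolded has_field_derivative_iff]) simp
  then have "((\<lambda>\<mu>. of_real pi / 2 * (((N \<mu> - N ?n) / (\<mu> - ?n)) / ((sin (\<mu> * of_real pi) - sin (?n * of_real pi)) / (\<mu> - ?n))))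
      \<longlongrightarrow> of_real pi / 2 * (N' / ((-1)^n * of_real pi))) (at ?n)"
    by (intro tendsto_mult tendsto_const)
  then have "((\<lambda>\<mu>. of_real pi / 2 * N \<mu> / sin (\<mu> * of_real pi)) \<longlongrightarrow> of_real pi / 2 * (N' / ((-1)^n * of_real pi))) (at ?n)"
    by (rule Lim_transform_eventually) (auto simp: eventually_at_filter N0 S0)
  then have "Lim (at ?n) (\<lambda>\<mu>. of_real pi / 2 * N \<mu> / sin (\<mu> * of_real pi)) = of_real pi / 2 * (N' / ((-1)^n * of_real pi))"
    by (intro tendsto_Lim) auto
  moreover have "of_real pi / 2 * (N' / ((-1)^n * of_real pi)) = (-1)^n * (N' / 2)"
    by (cases "even n") (auto simp: field_simps)
  ultimately have "bessel_K ?n z = (-1)^n * (N' / 2)"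
    unfolding bessel_K_def Let_def N_def by simp
  moreover have "(- (2 * a) - b) / 2 = - (a + 1 / 2 * b)" for a b :: complex
    by (simp add: field_simps)
  ultimately show ?thesis unfolding N'_def by (simp only: mult.assoc power_add power_one_right) simp
qed

section \<open>Bessel functions of integer order\<close>

text \<open>
  The order is kept as a natural number under a separate name. As a complex number,
  \<open>of_nat (n + 1)\<close> would be split into a sum by simplification, and facts about
  consecutive orders would no longer match.
\<close>
definition integer_I :: "nat \<Rightarrow> complex \<Rightarrow> complex" where "integer_I n = bessel_I (of_nat n)"

definition integer_K :: "nat \<Rightarrow> complex \<Rightarrow> complex" where "integer_K n = bessel_K (of_nat n)"

lemma integer_I_eq: "z \<noteq> 0 \<Longrightarrow> integer_I n z = (z / 2) ^ n * bessel_clifford (of_nat n) ((z/2)\<^sup>2)"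
  unfolding integer_I_def by (rule bessel_I_of_nat)

lemma integer_K_eq:
  assumes "z \<noteq> 0"
  shows "integer_K n z = (-1) ^ (n + 1) *
    (Ln (z / 2) * integer_I n z + 1 / 2 * (bessel_clifford_dorder (- of_nat n) ((z/2)\<^sup>2) / (z/2)^n
       + (z/2)^n * bessel_clifford_dorder (of_nat n) ((z/2)\<^sup>2)))"
  unfolding integer_I_def integer_K_def by (rule bessel_K_of_nat[OF assms])

lemma half_square_deriv: "((\<lambda>z::complex. (z/2)\<^sup>2) has_field_derivative z / 2) (at z)"
  by (rule derivative_eq_intros refl | simp)+

lemma half_power_deriv:
  assumes "z \<noteq> (0::complex)"
  shows "((\<lambda>z. (z/2)^n) has_field_derivative of_nat n / z * (z/2)^n) (at z)"
proof -
  have "((\<lambda>z. (z/2)^n) has_field_derivative of_nat n * (z/2)^(n-1) * (1/2)) (at z)"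
    by (rule derivative_eq_intros refl | simp)+
  also have "of_nat n * (z/2)^(n-1) * (1/2) = of_nat n / z * (z/2)^n"
    using assms by (cases n) (auto simp: field_simps)
  finally show ?thesis .
qed

lemma integer_I_has_derivative:
  assumes z: "z \<noteq> 0"
  shows "(integer_I n has_field_derivative of_nat n / z * integer_I n z + integer_I (n + 1) z) (at z)"
proof -
  have "((\<lambda>z. (z / 2) ^ n * bessel_clifford (of_nat n) ((z/2)\<^sup>2)) has_field_derivative
     of_nat n / z * (z/2)^n * bessel_clifford (of_nat n) ((z/2)\<^sup>2) +
       bessel_clifford (of_nat n + 1) ((z/2)\<^sup>2) * (z / 2) * (z/2)^n) (at z)"
    by (intro DERIV_mult half_power_deriv[OF z] DERIV_chain2[OF bessel_clifford_has_derivative half_square_deriv])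
  moreover have "of_nat n / z * (z/2)^n * bessel_clifford (of_nat n) ((z/2)\<^sup>2) +
       bessel_clifford (of_nat n + 1) ((z/2)\<^sup>2) * (z / 2) * (z/2)^n =
       of_nat n / z * integer_I n z + integer_I (n + 1) z"
    using z by (simp add: integer_I_eq add.commute mult_ac)
  ultimately show ?thesis
    using has_field_derivative_transform_within_open[of _ _ z "-{0}" "integer_I n"] z by (auto simp: integer_I_eq)
qed

lemma integer_I_recurrence:
  assumes z: "z \<noteq> 0"
  shows "integer_I n z = 2 * of_nat (n + 1) / z * integer_I (n + 1) z + integer_I (n + 2) z"
proof -
  have *: "bessel_clifford (of_nat n) y = of_nat (n+1) * bessel_clifford (of_nat (n+1)) y + y * bessel_clifford (of_nat (n+2)) y" for y
    using bessel_clifford_recurrence[of "of_nat (n+1)" y] by (simp add: algebra_simps)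
  show ?thesis
    unfolding integer_I_eq[OF z] *[of "(z/2)\<^sup>2"] using z
    by (simp add: field_simps power2_eq_square power_add del: of_nat_add of_nat_Suc)
qed

text \<open>
  The product rule produces order derivatives at \<open>1 - n\<close>; the recurrence of the
  order derivatives exchanges them for those at \<open>- n - 1\<close>, which belong to the next order.
\<close>
lemma integer_K_has_derivative:
  assumes z: "z \<notin> \<real>\<^sub>\<le>\<^sub>0"
  shows "(integer_K n has_field_derivative of_nat n / z * integer_K n z - integer_K (n + 1) z) (at z)"
proof -
  have z0: "z \<noteq> 0" using z by auto
  let ?y = "(z/2)\<^sup>2" and ?D = bessel_clifford_dorder
  have dL: "((\<lambda>z. Ln (z/2)) has_field_derivative 1 / z) (at z)"
  proof -
    have "z / 2 \<notin> \<real>\<^sub>\<le>\<^sub>0" using z by (auto simp: complex_nonpos_Reals_iff)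
    from DERIV_chain2[OF has_field_derivative_Ln[OF this] DERIV_cdivide[OF DERIV_ident]] z0
    show ?thesis by (simp add: field_simps)
  qed
  have dA: "((\<lambda>z. ?D (- of_nat n) ((z/2)\<^sup>2) / (z/2)^n) has_field_derivative
     (?D (- of_nat n + 1) ?y * (z/2) * (z/2)^n - ?D (- of_nat n) ?y * (of_nat n / z * (z/2)^n)) / ((z/2)^n * (z/2)^n)) (at z)"
    using z0 by (intro DERIV_divide half_power_deriv DERIV_chain2[OF bessel_clifford_dorder_has_derivative half_square_deriv]) auto
  have dB: "((\<lambda>z. (z/2)^n * ?D (of_nat n) ((z/2)\<^sup>2)) has_field_derivative
     of_nat n / z * (z/2)^n * ?D (of_nat n) ?y + ?D (of_nat n + 1) ?y * (z / 2) * (z/2)^n) (at z)"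
    by (intro DERIV_mult half_power_deriv[OF z0] DERIV_chain2[OF bessel_clifford_dorder_has_derivative half_square_deriv])
  define d where "d = (-1) ^ (n + 1) * (1 / z * integer_I n z + (of_nat n / z * integer_I n z + integer_I (n + 1) z) * Ln (z/2) +
      1 / 2 * ((?D (- of_nat n + 1) ?y * (z/2) * (z/2)^n - ?D (- of_nat n) ?y * (of_nat n / z * (z/2)^n)) / ((z/2)^n * (z/2)^n)
      + (of_nat n / z * (z/2)^n * ?D (of_nat n) ?y + ?D (of_nat n + 1) ?y * (z / 2) * (z/2)^n)))"
  have "((\<lambda>z. (-1) ^ (n + 1) *
    (Ln (z / 2) * integer_I n z + 1 / 2 * (bessel_clifford_dorder (- of_nat n) ((z/2)\<^sup>2) / (z/2)^n
       + (z/2)^n * bessel_clifford_dorder (of_nat n) ((z/2)\<^sup>2)))) has_field_derivative d) (at z)"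
    unfolding d_def
    by (intro DERIV_cmult DERIV_add DERIV_mult dL integer_I_has_derivative[OF z0] dA dB)
  then have der: "(integer_K n has_field_derivative d) (at z)"
    using has_field_derivative_transform_within_open[of _ _ z "-{0}" "integer_K n"] z0 by (auto simp: integer_K_eq)
  have e: "- of_nat (n+1) = - of_nat n - (1::complex)" by simp
  have A: "?D (- of_nat (n+1)) ?y = ((z/2)^n)\<^sup>2 * bessel_clifford (of_nat n) ?y - of_nat n * ?D (- of_nat n) ?y + ?y * ?D (- of_nat n + 1) ?y"
    unfolding e using bessel_clifford_dorder_recurrence[of "- of_nat n" ?y]
    by (simp add: bessel_clifford_minus_of_nat power_mult[symmetric] mult.commute add.commute del: power_divide)
  \<comment> \<open>Here w = z / 2, p = w ^ n, L is the logarithm and J the function I of order n + 1; c is the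
    Bessel--Clifford function of order n, and D1, A0, B0, B1 are the order derivatives at 1 - n, - n, n, n + 1.\<close>
  have alg: "s * (1 / (2 * w) * (p * c) + (m / (2 * w) * (p * c) + J) * L +
       1 / 2 * ((D1 * w * p - A0 * (m / (2 * w) * p)) / (p * p) + (m / (2 * w) * p * B0 + B1 * w * p))) =
     m / (2 * w) * (s * (L * (p * c) + 1/2 * (A0 / p + p * B0))) -
     (- s) * (L * J + 1/2 * ((p\<^sup>2 * c - m * A0 + w\<^sup>2 * D1) / (p * w) + p * w * B1))"
    if "w \<noteq> 0" "p \<noteq> 0" for w p m c J L D1 A0 B0 B1 s :: complex
    using that by (simp add: field_simps power2_eq_square)
  have "d = of_nat n / z * integer_K n z - integer_K (n + 1) z"
    using alg[of "z/2" "(z/2)^n" "(-1)^(n+1)" "bessel_clifford (of_nat n) ?y" "of_nat n" "integer_I (n+1) z"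
      "Ln (z/2)" "?D (- of_nat n + 1) ?y" "?D (- of_nat n) ?y" "?D (of_nat n) ?y" "?D (of_nat n + 1) ?y"] z0
    unfolding integer_K_eq[OF z0] A d_def integer_I_eq[OF z0, of n]
    by (simp add: add.commute)
  with der show ?thesis by simp
qed

lemma integer_K_recurrence:
  assumes z: "z \<noteq> 0"
  shows "integer_K (n + 2) z = integer_K n z + 2 * of_nat (n + 1) / z * integer_K (n + 1) z"
proof -
  let ?y = "(z/2)\<^sup>2" and ?D = bessel_clifford_dorder
  have A: "?D (- of_nat (n+2)) ?y = ((z/2)^(n+1))\<^sup>2 * bessel_clifford (of_nat (n+1)) ?y - of_nat (n+1) * ?D (- of_nat (n+1)) ?y + ?y * ?D (- of_nat n) ?y"
    using bessel_clifford_dorder_recurrence[of "- of_nat (n+1)" ?y] bessel_clifford_minus_of_nat[of "n+1" ?y]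
    by (simp add: power_mult[symmetric] algebra_simps power_add del: power_divide) (simp add: power2_eq_square power_mult)
  have B: "?D (of_nat n) ?y = bessel_clifford (of_nat (n+1)) ?y + of_nat (n+1) * ?D (of_nat (n+1)) ?y + ?y * ?D (of_nat (n+2)) ?y"
    using bessel_clifford_dorder_recurrence[of "of_nat (n+1)" ?y] by (simp add: algebra_simps)
  \<comment> \<open>Again w = z / 2 and p = w ^ n; J1, J2 are I of orders n + 1, n + 2, c is the Bessel--Clifford function
    of order n + 1, and A0, A1, B1, B2 are the order derivatives at - n, - n - 1, n + 1, n + 2.\<close>
  have alg: "(- s) * (L * J2 + 1/2 * (((p * w)\<^sup>2 * c - m * A1 + w\<^sup>2 * A0) / (p * w * w) + p * w * w * B2)) =
    (- s) * (L * (2 * m / (2 * w) * J1 + J2) + 1/2 * (A0 / p + p * (c + m * B1 + w\<^sup>2 * B2))) +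
     2 * m / (2 * w) * (s * (L * J1 + 1/2 * (A1 / (p * w) + p * w * B1)))"
    if "w \<noteq> 0" "p \<noteq> 0" for w p m c J1 J2 L A0 A1 B1 B2 s :: complex
    using that by (simp add: field_simps power2_eq_square)
  show ?thesis
    using alg[of "z/2" "(z/2)^n" "(-1)^n" "Ln (z/2)" "integer_I (n+2) z" "bessel_clifford (of_nat (n+1)) ?y" "of_nat (n+1)"
       "?D (- of_nat (n+1)) ?y" "?D (- of_nat n) ?y" "?D (of_nat (n+2)) ?y" "integer_I (n+1) z" "?D (of_nat (n+1)) ?y"] z
    unfolding integer_K_eq[OF z] A B integer_I_recurrence[OF z, of n]
    by (simp add: power_add power2_eq_square mult_ac del: of_nat_add of_nat_Suc)
qed

lemma integer_K_holomorphic: "integer_K n holomorphic_on (- \<real>\<^sub>\<le>\<^sub>0)"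
  using integer_K_has_derivative by (auto simp: holomorphic_on_open open_Compl)

lemma integer_I_holomorphic: "integer_I n holomorphic_on (- {0})"
  using integer_I_has_derivative by (auto simp: holomorphic_on_open open_Compl)

text \<open>
  The principal logarithm takes the value with argument \<open>\<pi>\<close> on the negative axis, so it is
  continuous there from above; the rotation moves the cut to the negative imaginary axis.
\<close>
lemma Ln_upper_half_plane:
  assumes "Im z \<ge> 0" "z \<noteq> 0"
  shows "Ln z = Ln (- \<i> * z) + \<i> * of_real (pi / 2)"
proof (rule Ln_unique)
  have e: "exp (\<i> * of_real (pi / 2)) = \<i>"
    by (metis cis_conv_exp cis_pi_half mult.commute)
  have l: "exp (Ln (- \<i> * z)) = - \<i> * z" using assms by (intro exp_Ln) auto
  show "exp (Ln (- \<i> * z) + \<i> * of_real (pi / 2)) = z"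
    unfolding exp_add e l by (simp add: complex_eq_iff)
  have "Re (- \<i> * z) \<ge> 0" using assms by simp
  then have "\<bar>Im (Ln (- \<i> * z))\<bar> \<le> pi / 2"
    using Re_Ln_pos_le[of "- \<i> * z"] assms by simp
  moreover have "Im (\<i> * of_real (pi / 2)) = pi / 2" by simp
  ultimately show "- pi < Im (Ln (- \<i> * z) + \<i> * of_real (pi / 2))" "Im (Ln (- \<i> * z) + \<i> * of_real (pi / 2)) \<le> pi"
    using pi_gt_zero unfolding plus_complex.sel abs_le_iff by linarith+
qed

lemma continuous_on_Ln_upper: "continuous_on ({z. Im z \<ge> 0} - {0}) Ln"
proof -
  have "continuous_on ({z. Im z \<ge> 0} - {0}) (\<lambda>z. Ln (- \<i> * z) + \<i> * of_real (pi / 2))"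
    by (intro continuous_intros) (auto simp: complex_nonpos_Reals_iff complex_eq_iff)
  then show ?thesis
    by (rule continuous_on_eq) (use Ln_upper_half_plane in auto)
qed

lemma integer_K_continuous_upper: "continuous_on ({z. Im z \<ge> 0} - {0}) (integer_K n)"
proof -
  let ?S = "{z. Im z \<ge> 0} - {0}"
  have c: "continuous_on A (bessel_clifford_dorder \<mu>)" for A \<mu>
    using bessel_clifford_dorder_has_derivative by (rule DERIV_continuous_on[OF has_field_derivative_at_within])
  have L: "continuous_on ?S (\<lambda>z. Ln (z/2))"
    by (rule continuous_on_compose2[OF continuous_on_Ln_upper]) (auto intro!: continuous_intros)
  have I: "continuous_on ?S (integer_I n)"
    by (rule holomorphic_on_imp_continuous_on[OF holomorphic_on_subset[OF integer_I_holomorphic]]) auto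
  have "continuous_on ?S (\<lambda>z. (-1) ^ (n + 1) *
    (Ln (z / 2) * integer_I n z + 1 / 2 * (bessel_clifford_dorder (- of_nat n) ((z/2)\<^sup>2) / (z/2)^n
       + (z/2)^n * bessel_clifford_dorder (of_nat n) ((z/2)\<^sup>2))))"
    by (intro continuous_intros L I continuous_on_compose2[OF c[of UNIV]]) auto
  then show ?thesis
    by (rule continuous_on_eq) (use integer_K_eq in auto)
qed

text \<open>
  The logarithm on the negative axis is \<open>ln r + \<i> \<pi>\<close>; all other parts of the formula are even in the
  argument up to the sign \<open>(-1) ^ n\<close>.
\<close>
lemma integer_K_neg:
  assumes "r > 0"
  shows "integer_K n (- of_real r) = (-1) ^ n * integer_K n (of_real r) - \<i> * of_real pi * integer_I n (of_real r)"
    and "integer_I n (- of_real r) = (-1) ^ n * integer_I n (of_real r)"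
proof -
  have L: "Ln (- of_real r / 2) = Ln (of_real r / 2) + \<i> * of_real pi"
  proof -
    have "Ln (- of_real x) = of_real (ln x) + \<i> * of_real pi" if "x > 0" for x
      using that by (subst Ln_minus) (auto simp: Ln_of_real)
    from this[of "r / 2"] show ?thesis using assms by (simp flip: Ln_of_real)
  qed
  have p: "(- of_real r / 2) ^ n = (-1) ^ n * (of_real r / 2 :: complex) ^ n"
    by (metis minus_divide_left power_minus)
  have q: "(- of_real r / 2)\<^sup>2 = (of_real r / 2 :: complex)\<^sup>2" by simp
  have r: "of_real r \<noteq> (0::complex)" "- of_real r \<noteq> (0::complex)" using assms by auto
  show I: "integer_I n (- of_real r) = (-1) ^ n * integer_I n (of_real r)"
    unfolding integer_I_eq[OF r(1)] integer_I_eq[OF r(2)] p q by (simp only: mult.assoc)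
  have alg: "- s * ((L + e) * (s * J) + 1/2 * (A / (s * p) + s * p * B)) = s * (- s * (L * J + 1/2 * (A / p + p * B))) - e * J"
    if "s = 1 \<or> s = -1" "p \<noteq> 0" for s L e J A p B :: complex
    using that by (auto simp: field_simps)
  have s: "(-1::complex)^n = 1 \<or> (-1::complex)^n = -1" by (cases "even n") auto
  have "(of_real r / 2)^n \<noteq> (0::complex)" using assms by auto
  then show "integer_K n (- of_real r) = (-1) ^ n * integer_K n (of_real r) - \<i> * of_real pi * integer_I n (of_real r)"
    using alg[OF s, of "(of_real r / 2)^n" "Ln (of_real r / 2)" "\<i> * of_real pi" "integer_I n (of_real r)"
       "bessel_clifford_dorder (- of_nat n) ((of_real r/2)\<^sup>2)" "bessel_clifford_dorder (of_nat n) ((of_real r/2)\<^sup>2)"]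
    unfolding integer_K_eq[OF r(1)] integer_K_eq[OF r(2)] I L p q by (simp del: power_divide)
qed

lemma half_power_Ln_tendsto_0: "((\<lambda>z. (z/2) ^ Suc k * Ln (z/2)) \<longlongrightarrow> 0) (at 0)"
proof (rule Lim_null_comparison)
  have "((\<lambda>x::real. x ^ Suc k * (pi - ln x)) \<longlongrightarrow> 0) (at_right 0)" by real_asymp
  moreover have "filterlim (\<lambda>z::complex. norm (z/2)) (at_right 0) (at 0)"
    unfolding filterlim_at by (auto intro!: tendsto_eq_intros simp: eventually_at_filter)
  ultimately show "((\<lambda>z::complex. norm (z/2) ^ Suc k * (pi - ln (norm (z/2)))) \<longlongrightarrow> 0) (at 0)"
    by (rule filterlim_compose)
  have "norm ((z/2) ^ Suc k * Ln (z/2)) \<le> norm (z/2) ^ Suc k * (pi - ln (norm (z/2)))" if "dist z 0 < 1" "z \<noteq> 0" for z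
  proof -
    have "norm (Ln (z/2)) \<le> \<bar>Re (Ln (z/2))\<bar> + \<bar>Im (Ln (z/2))\<bar>" by (rule cmod_le)
    also have "\<bar>Im (Ln (z/2))\<bar> \<le> pi" using that Im_Ln_le_pi[of "z/2"] mpi_less_Im_Ln[of "z/2"] by auto
    also have "\<bar>Re (Ln (z/2))\<bar> = - ln (norm (z/2))" using that by (simp add: ln_le_zero_iff abs_if)
    finally have "norm (Ln (z/2)) \<le> pi - ln (norm (z/2))" by simp
    then show ?thesis unfolding norm_mult norm_power by (intro mult_left_mono) auto
  qed
  then show "\<forall>\<^sub>F z in at 0. norm ((z/2) ^ Suc k * Ln (z/2)) \<le> norm (z/2) ^ Suc k * (pi - ln (norm (z/2)))"
    by (auto simp: eventually_at intro!: exI[of _ 1])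
qed

lemma half_square_tendsto:
  assumes "isCont f (0::complex)"
  shows "((\<lambda>z. f ((z/2)\<^sup>2)) \<longlongrightarrow> f 0) (at 0)"
  by (rule isCont_tendsto_compose[OF assms]) (auto intro!: tendsto_eq_intros)

lemma bessel_clifford_isCont: "isCont (bessel_clifford \<mu>) y" "isCont (bessel_clifford_dorder \<mu>) y"
  using bessel_clifford_has_derivative bessel_clifford_dorder_has_derivative DERIV_isCont by blast+

lemma half_power_tendsto_0: "((\<lambda>z::complex. (z/2) ^ Suc k) \<longlongrightarrow> 0) (at 0)"
  by (auto intro!: tendsto_eq_intros)

lemma power_series_at_0: "bessel_clifford \<mu> 0 = rGamma (\<mu> + 1)" "bessel_clifford_dorder \<mu> 0 = deriv rGamma (\<mu> + 1)"
  unfolding bessel_clifford_def bessel_clifford_dorder_def by (subst powser_zero; simp)+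

text \<open>
  Only the order derivative at \<open>- n - 1\<close> survives. At the origin it is the derivative of the reciprocal Gamma
  function at its zero \<open>- n\<close>.
\<close>
lemma integer_K_Suc_tendsto: "((\<lambda>z. (z/2) ^ Suc n * integer_K (Suc n) z) \<longlongrightarrow> fact n / 2) (at 0)"
proof -
  let ?D = bessel_clifford_dorder
  have "((\<lambda>z. (-1) ^ n * ((z/2)^Suc n * Ln (z / 2) * ((z/2)^Suc n * bessel_clifford (of_nat (Suc n)) ((z/2)\<^sup>2)) +
      1 / 2 * (?D (- of_nat (Suc n)) ((z/2)\<^sup>2) + (z/2)^Suc n * (z/2)^Suc n * ?D (of_nat (Suc n)) ((z/2)\<^sup>2)))) \<longlongrightarrow>
     (-1) ^ n * (0 * (0 * bessel_clifford (of_nat (Suc n)) 0) + 1 / 2 * (?D (- of_nat (Suc n)) 0 + 0 * 0 * ?D (of_nat (Suc n)) 0))) (at 0)"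
    by (intro tendsto_intros half_power_Ln_tendsto_0 half_power_tendsto_0 half_square_tendsto bessel_clifford_isCont)
  moreover have "?D (- of_nat (Suc n)) 0 = (-1)^n * fact n"
    using DERIV_imp_deriv[OF has_field_derivative_rGamma_nonpos_int[of n UNIV]] by (simp add: power_series_at_0)
  ultimately have "((\<lambda>z. (-1) ^ n * ((z/2)^Suc n * Ln (z / 2) * ((z/2)^Suc n * bessel_clifford (of_nat (Suc n)) ((z/2)\<^sup>2)) +
      1 / 2 * (?D (- of_nat (Suc n)) ((z/2)\<^sup>2) + (z/2)^Suc n * (z/2)^Suc n * ?D (of_nat (Suc n)) ((z/2)\<^sup>2)))) \<longlongrightarrow> fact n / 2) (at 0)"
    by (simp del: of_nat_Suc power_Suc)
  note lim = this
  have alg: "p * (s * (L * (p * c) + 1/2 * (A / p + p * B))) = s * (p * L * (p * c) + 1/2 * (A + p * p * B))"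
    if "p \<noteq> 0" for s p L c A B :: complex using that by (simp add: field_simps)
  have eq: "(z/2) ^ Suc n * integer_K (Suc n) z = (-1) ^ n * ((z/2)^Suc n * Ln (z / 2) * ((z/2)^Suc n * bessel_clifford (of_nat (Suc n)) ((z/2)\<^sup>2)) +
      1 / 2 * (?D (- of_nat (Suc n)) ((z/2)\<^sup>2) + (z/2)^Suc n * (z/2)^Suc n * ?D (of_nat (Suc n)) ((z/2)\<^sup>2)))" if "z \<noteq> 0" for z
  proof -
    have "(-1::complex) ^ (Suc n + 1) = (-1) ^ n" by simp
    moreover have "(z/2) ^ Suc n \<noteq> 0" using that by simp
    ultimately show ?thesis unfolding integer_K_eq[OF that] integer_I_eq[OF that] by (metis (no_types, lifting) alg)
  qed
  show ?thesis
    by (rule Lim_transform_eventually[OF lim], unfold eventually_at_filter)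
       (intro always_eventually allI impI, rule eq[symmetric])
qed

text \<open>
  The order-zero function \<open>I\<close> differs from one by a multiple of the square of the argument, which
  outweighs the logarithm; \<open>g\<close> is the difference quotient that expresses this.
\<close>
lemma integer_K_0_tendsto: "((\<lambda>z. integer_K 0 z + Ln (z/2)) \<longlongrightarrow> - deriv rGamma 1) (at 0)"
proof -
  let ?D = bessel_clifford_dorder and ?C = "bessel_clifford 0"
  define g where "g = (\<lambda>y. if y = 0 then bessel_clifford 1 0 else (?C y - ?C 0) / y)"
  have "(?C has_field_derivative bessel_clifford 1 0) (at 0)"
    using bessel_clifford_has_derivative[of 0 0] by simp
  then have "((\<lambda>y. (?C y - ?C 0) / y) \<longlongrightarrow> bessel_clifford 1 0) (at 0)"
    by (simp add: has_field_derivative_iff)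
  then have "(g \<longlongrightarrow> bessel_clifford 1 0) (at 0)"
    by (rule Lim_transform_eventually) (auto simp: eventually_at_filter g_def)
  then have g: "isCont g 0" by (simp add: isCont_def g_def)
  have "((\<lambda>z. - ((z/2) ^ Suc 1 * Ln (z/2) * g ((z/2)\<^sup>2)) - ?D 0 ((z/2)\<^sup>2)) \<longlongrightarrow> - (0 * g 0) - ?D 0 0) (at 0)"
    by (intro tendsto_intros half_power_Ln_tendsto_0 half_square_tendsto g bessel_clifford_isCont)
  then have "((\<lambda>z. - ((z/2) ^ Suc 1 * Ln (z/2) * g ((z/2)\<^sup>2)) - ?D 0 ((z/2)\<^sup>2)) \<longlongrightarrow> - deriv rGamma 1) (at 0)"
    by (simp add: power_series_at_0)
  then show ?thesis
  proof (rule Lim_transform_eventually)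
    have "integer_K 0 z + Ln (z/2) = - ((z/2) ^ Suc 1 * Ln (z/2) * g ((z/2)\<^sup>2)) - ?D 0 ((z/2)\<^sup>2)" if "z \<noteq> 0" for z
      using that by (simp add: integer_K_eq integer_I_eq g_def power_series_at_0 power2_eq_square) (simp add: field_simps)
    then show "\<forall>\<^sub>F z in at 0. - ((z/2) ^ Suc 1 * Ln (z/2) * g ((z/2)\<^sup>2)) - ?D 0 ((z/2)\<^sup>2) = integer_K 0 z + Ln (z/2)"
      by (auto simp: eventually_at_filter)
  qed
qed

lemma integer_I_tendsto_0: "(integer_I 0 \<longlongrightarrow> 1) (at 0)" "(integer_I (Suc n) \<longlongrightarrow> 0) (at 0)"
proof -
  have "((\<lambda>z. (z/2)^m * bessel_clifford (of_nat m) ((z/2)\<^sup>2)) \<longlongrightarrow> (if m = 0 then 1 else 0)) (at 0)" for m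
  proof (cases m)
    case 0
    then show ?thesis using half_square_tendsto[OF bessel_clifford_isCont(1)[where \<mu>=0]] by (simp add: power_series_at_0)
  next
    case (Suc k)
    then show ?thesis
      using tendsto_mult[OF half_power_tendsto_0[of k] half_square_tendsto[OF bessel_clifford_isCont(1)[where \<mu>="of_nat m"]]] by simp
  qed
  then have "(integer_I m \<longlongrightarrow> (if m = 0 then 1 else 0)) (at 0)" for m
    by (rule Lim_transform_eventually) (auto simp: eventually_at_filter integer_I_eq)
  from this[of 0] this[of "Suc n"] show "(integer_I 0 \<longlongrightarrow> 1) (at 0)" "(integer_I (Suc n) \<longlongrightarrow> 0) (at 0)" by simp_all
qed

lemma nonpos_Reals_eq_image: "(\<real>\<^sub>\<le>\<^sub>0 :: complex set) = of_real ` {..0}"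
  by (auto simp: nonpos_Reals_def)

lemma slit_plane_facts: "open (- \<real>\<^sub>\<le>\<^sub>0 :: complex set)" "connected (- \<real>\<^sub>\<le>\<^sub>0 :: complex set)"
  using starlike_imp_connected[OF starlike_slotted_complex_plane_left[of 0]]
  by (auto simp: nonpos_Reals_eq_image[symmetric] open_Compl)

text \<open>
  For the orders zero and one the left-hand side has vanishing derivative, and its value is the limit at
  the origin. The three-term recurrences show that it is the same for every pair of consecutive orders.
\<close>
lemma integer_I_K_cross_product:
  assumes "z \<notin> \<real>\<^sub>\<le>\<^sub>0"
  shows "z * (integer_I n z * integer_K (n + 1) z + integer_I (n + 1) z * integer_K n z) = 1"
proof (induction n)
  case 0
  define W where "W = (\<lambda>z. z * (integer_I 0 z * integer_K 1 z + integer_I 1 z * integer_K 0 z))"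
  have dW: "(W has_field_derivative 0) (at z)" if z: "z \<notin> \<real>\<^sub>\<le>\<^sub>0" for z
  proof -
    have z0: "z \<noteq> 0" using z by auto
    have dI0: "(integer_I 0 has_field_derivative integer_I 1 z) (at z)"
      and dI1: "(integer_I 1 has_field_derivative integer_I 0 z - integer_I 1 z / z) (at z)"
      and dK0: "(integer_K 0 has_field_derivative - integer_K 1 z) (at z)"
      and dK1: "(integer_K 1 has_field_derivative - integer_K 0 z - integer_K 1 z / z) (at z)"
      using integer_I_has_derivative[OF z0, of 0] integer_I_has_derivative[OF z0, of 1] integer_I_recurrence[OF z0, of 0]
         integer_K_has_derivative[OF z, of 0] integer_K_has_derivative[OF z, of 1] integer_K_recurrence[OF z0, of 0]
      by (simp_all add: numeral_2_eq_2 algebra_simps)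
    have "(W has_field_derivative 1 * (integer_I 0 z * integer_K 1 z + integer_I 1 z * integer_K 0 z) +
       (integer_I 1 z * integer_K 1 z + (- integer_K 0 z - integer_K 1 z / z) * integer_I 0 z +
       ((integer_I 0 z - integer_I 1 z / z) * integer_K 0 z + (- integer_K 1 z) * integer_I 1 z)) * z) (at z)"
      unfolding W_def by (intro DERIV_mult DERIV_add DERIV_ident dI0 dI1 dK0 dK1)
    moreover have "1 * (integer_I 0 z * integer_K 1 z + integer_I 1 z * integer_K 0 z) +
       (integer_I 1 z * integer_K 1 z + (- integer_K 0 z - integer_K 1 z / z) * integer_I 0 z +
       ((integer_I 0 z - integer_I 1 z / z) * integer_K 0 z + (- integer_K 1 z) * integer_I 1 z)) * z = 0"
      using z0 by (simp add: field_simps)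
    ultimately show ?thesis by simp
  qed
  have "continuous_on (- \<real>\<^sub>\<le>\<^sub>0) W"
    by (rule DERIV_continuous_on[OF has_field_derivative_at_within]) (use dW in auto)
  then obtain c where c: "\<And>z. z \<in> - \<real>\<^sub>\<le>\<^sub>0 \<Longrightarrow> W z = c"
    using DERIV_zero_connected_constant[of "- \<real>\<^sub>\<le>\<^sub>0" "{}" W] slit_plane_facts dW by auto
  \<comment> \<open>Of the two products the first tends to one; in the second, the factor z tames the logarithm of K.\<close>
  have "((\<lambda>z. integer_I 0 z * (2 * ((z/2) ^ Suc 0 * integer_K (Suc 0) z)) +
      integer_I (Suc 0) z * (z * (integer_K 0 z + Ln (z/2)) - 2 * ((z/2)^Suc 0 * Ln (z/2)))) \<longlongrightarrow>
     1 * (2 * (fact 0 / 2)) + 0 * (0 * (- deriv rGamma 1) - 2 * 0)) (at 0)"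
    by (intro tendsto_intros integer_I_tendsto_0 integer_K_Suc_tendsto half_power_Ln_tendsto_0 integer_K_0_tendsto)
  then have "(W \<longlongrightarrow> 1) (at 0)"
    unfolding W_def by (simp add: algebra_simps)
  then have "(W \<longlongrightarrow> 1) (at 0 within (- \<real>\<^sub>\<le>\<^sub>0))" by (rule tendsto_within_subset) auto
  then have "((\<lambda>_. c) \<longlongrightarrow> 1) (at 0 within (- \<real>\<^sub>\<le>\<^sub>0 :: complex set))"
    by (rule Lim_transform_eventually) (use c in \<open>auto simp: eventually_at_filter\<close>)
  moreover have "at 0 within (- \<real>\<^sub>\<le>\<^sub>0 :: complex set) \<noteq> bot"
  proof -
    have "\<exists>x\<in>- \<real>\<^sub>\<le>\<^sub>0. x \<noteq> (0::complex) \<and> dist x 0 < e" if "e > 0" for e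
      using that by (intro bexI[of _ "of_real (e / 2)"]) (auto simp: complex_nonpos_Reals_iff)
    then show ?thesis by (auto simp: trivial_limit_within islimpt_approachable)
  qed
  ultimately have "c = 1" using tendsto_unique tendsto_const by blast
  then show ?case using c[of z] assms by (simp add: W_def)
next
  case (Suc n)
  have z0: "z \<noteq> 0" using assms by auto
  show ?case
    using Suc z0 integer_I_recurrence[OF z0, of n] integer_K_recurrence[OF z0, of n]
    by (simp add: algebra_simps)
qed

section \<open>Laplace integrals for the orders zero and one\<close>

text \<open>
  Cauchy's inequality turns the domination of the integrand into a domination of its difference quotients,
  and the derivative is their limit by dominated convergence.
\<close>
lemma has_field_derivative_integral_dominated:
  fixes f :: "complex \<Rightarrow> 'a \<Rightarrow> complex"
  assumes r: "r > 0"
    and meas: "\<And>z. z \<in> ball z0 r \<Longrightarrow> f z \<in> borel_measurable M"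
    and hol: "\<And>u. u \<in> space M \<Longrightarrow> (\<lambda>z. f z u) holomorphic_on ball z0 r"
    and bd: "\<And>z u. z \<in> ball z0 r \<Longrightarrow> u \<in> space M \<Longrightarrow> norm (f z u) \<le> g u"
    and g: "integrable M g"
  shows "((\<lambda>z. \<integral>u. f z u \<partial>M) has_field_derivative (\<integral>u. deriv (\<lambda>z. f z u) z0 \<partial>M)) (at z0)"
  unfolding has_field_derivative_iff tendsto_at_iff_sequentially comp_def
proof (intro allI impI)
  fix X :: "nat \<Rightarrow> complex" assume X0: "\<forall>i. X i \<in> UNIV - {z0}" and X: "X \<longlonglongrightarrow> z0"
  have int: "integrable M (f z)" if "z \<in> ball z0 r" for z
    by (rule Bochner_Integration.integrable_bound[OF g meas[OF that]])
       (auto intro!: AE_I2 order.trans[OF bd[OF that]])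
  have "eventually (\<lambda>n. X n \<in> ball z0 (r/2)) sequentially"
    using X r by (auto dest!: tendstoD[of _ _ _ "r/2"] simp: dist_commute elim!: eventually_mono)
  then obtain N where N: "\<And>n. n \<ge> N \<Longrightarrow> X n \<in> ball z0 (r/2)" by (auto simp: eventually_sequentially)
  define Y where "Y = (\<lambda>n. X (n + N))"
  have Y: "Y n \<in> ball z0 (r/2)" "Y n \<noteq> z0" "Y n \<in> ball z0 r" for n
    using N[of "n + N"] X0 r by (auto simp: Y_def)
  have Ylim: "Y \<longlonglongrightarrow> z0" unfolding Y_def by (rule LIMSEQ_ignore_initial_segment[OF X])
  have lim: "(\<lambda>n. (f (Y n) u - f z0 u) / (Y n - z0)) \<longlonglongrightarrow> deriv (\<lambda>z. f z u) z0" if u: "u \<in> space M" for u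
  proof -
    have "((\<lambda>z. f z u) has_field_derivative deriv (\<lambda>z. f z u) z0) (at z0)"
      by (rule holomorphic_derivI[OF hol[OF u]]) (use r in auto)
    then have "((\<lambda>z. (f z u - f z0 u) / (z - z0)) \<longlongrightarrow> deriv (\<lambda>z. f z u) z0) (at z0)"
      by (simp add: has_field_derivative_iff)
    moreover have "filterlim Y (at z0) sequentially"
      using Ylim Y by (auto simp: filterlim_at)
    ultimately show ?thesis by (rule filterlim_compose)
  qed
  have dbd: "norm ((f (Y n) u - f z0 u) / (Y n - z0)) \<le> 4 / r * g u" if u: "u \<in> space M" for n u
  proof -
    have "norm (deriv (\<lambda>z. f z u) w) \<le> 4 / r * g u" if w: "w \<in> ball z0 (r/2)" for w
    proof -
      have sub: "cball w (r/4) \<subseteq> ball z0 r"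
      proof
        fix x assume "x \<in> cball w (r/4)"
        then show "x \<in> ball z0 r" using w r dist_triangle[of z0 x w] by (simp add: dist_commute)
      qed
      have "norm ((deriv ^^ 1) (\<lambda>z. f z u) w) \<le> fact 1 * g u / (r/4) ^ 1"
      proof (rule Cauchy_inequality)
        show "(\<lambda>z. f z u) holomorphic_on ball w (r/4)"
          using holomorphic_on_subset[OF hol[OF u]] order.trans[OF ball_subset_cball sub] by blast
        show "continuous_on (cball w (r/4)) (\<lambda>z. f z u)"
          by (rule holomorphic_on_imp_continuous_on[OF holomorphic_on_subset[OF hol[OF u] sub]])
        show "0 < r / 4" using r by simp
        show "norm (f x u) \<le> g u" if "norm (w - x) = r / 4" for x
        proof (rule bd[OF _ u])
          have "x \<in> cball w (r/4)" using that by (simp add: dist_norm)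
          then show "x \<in> ball z0 r" using sub by blast
        qed
      qed
      moreover have "fact 1 * g u / (r/4) ^ 1 = 4 / r * g u" by simp
      ultimately show ?thesis by (simp only: One_nat_def funpow.simps comp_id)
    qed
    note der_bd = this
    have "norm (f (Y n) u - f z0 u) \<le> 4 / r * g u * norm (Y n - z0)"
    proof (rule field_differentiable_bound[where f="\<lambda>z. f z u" and S="ball z0 (r/2)" and f'="deriv (\<lambda>z. f z u)"])
      show "((\<lambda>z. f z u) has_field_derivative deriv (\<lambda>z. f z u) w) (at w within ball z0 (r/2))" if "w \<in> ball z0 (r/2)" for w
      proof -
        have "w \<in> ball z0 r" using that r by simp
        then show ?thesis by (rule holomorphic_derivI[OF hol[OF u] open_ball, THEN has_field_derivative_at_within])
      qed
    qed (use r Y(1)[of n] der_bd in auto)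
    then show ?thesis using Y(2)[of n] by (simp add: norm_divide divide_le_eq)
  qed
  have "(\<lambda>n. \<integral>u. (f (Y n) u - f z0 u) / (Y n - z0) \<partial>M) \<longlonglongrightarrow> (\<integral>u. deriv (\<lambda>z. f z u) z0 \<partial>M)"
  proof (rule integral_dominated_convergence[where w="\<lambda>u. 4 / r * g u"])
    show ms: "(\<lambda>u. (f (Y n) u - f z0 u) / (Y n - z0)) \<in> borel_measurable M" for n
      using meas[OF Y(3)[of n]] meas[of z0] r by auto
    show "(\<lambda>u. deriv (\<lambda>z. f z u) z0) \<in> borel_measurable M"
      by (rule borel_measurable_LIMSEQ_metric[OF ms lim])
  qed (use g lim dbd in \<open>auto intro!: AE_I2\<close>)
  also have "(\<lambda>n. \<integral>u. (f (Y n) u - f z0 u) / (Y n - z0) \<partial>M) =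
     (\<lambda>n. ((\<integral>u. f (Y n) u \<partial>M) - (\<integral>u. f z0 u \<partial>M)) / (Y n - z0))"
    using int[OF Y(3)] int[of z0] r by (simp add: Bochner_Integration.integral_diff)
  finally show "(\<lambda>n. ((\<integral>u. f (X n) u \<partial>M) - (\<integral>u. f z0 u \<partial>M)) / (X n - z0)) \<longlonglongrightarrow> (\<integral>u. deriv (\<lambda>z. f z u) z0 \<partial>M)"
    unfolding Y_def by (rule LIMSEQ_offset)
qed

lemma gamma_weight_complex:
  assumes z: "Re z > 0"
  shows "set_integrable lborel {0<..} (\<lambda>t. of_real t powr (z - 1) * of_real (exp (- t)))"
    and "(LBINT t:{0<..}. of_real t powr (z - 1) * of_real (exp (- t))) = Gamma z"
proof -
  have e: "of_real t powr (z - 1) / of_real (exp t) = of_real t powr (z - 1) * of_real (exp (- t))" for t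
    by (simp add: exp_minus divide_inverse)
  have "set_integrable lebesgue {0<..} (\<lambda>t. of_real t powr (z - 1) * of_real (exp (- t)))"
    using absolutely_integrable_Gamma_integral'[OF z] unfolding e .
  then show 1: "set_integrable lborel {0<..} (\<lambda>t. of_real t powr (z - 1) * of_real (exp (- t)))"
    unfolding set_integrable_def by (subst (asm) integrable_completion) auto
  show "(LBINT t:{0<..}. of_real t powr (z - 1) * of_real (exp (- t))) = Gamma z"
    unfolding set_borel_integral_eq_integral(2)[OF 1]
    using Gamma_integral_complex'[OF z] unfolding e by (rule integral_unique)
qed

lemma gamma_weight_integrable:
  fixes a p :: real
  assumes "p > -1" "a > 0"
  shows "set_integrable lborel {0<..} (\<lambda>t. t powr p * exp (- a * t))"
proof -
  have "set_integrable lebesgue {0<..} (\<lambda>t. norm (of_real t powr (of_real (p + 1) - 1 :: complex) / of_real (exp (a * t))))"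
    by (intro set_integrable_norm absolutely_integrable_Gamma_integral) (use assms in auto)
  also have "?this \<longleftrightarrow> set_integrable lebesgue {0<..} (\<lambda>t. t powr p * exp (- a * t))"
    by (intro set_integrable_cong)
       (auto simp: norm_divide powr_of_real exp_minus divide_inverse norm_mult norm_inverse)
  finally show ?thesis
    unfolding set_integrable_def by (subst (asm) integrable_completion) auto
qed

definition laplace_from_1 :: "(real \<Rightarrow> real) \<Rightarrow> complex \<Rightarrow> complex" where
  "laplace_from_1 \<phi> z = (LBINT v:{1<..}. exp (- (z * of_real v)) * of_real (\<phi> v))"

text \<open>
  A class that is integrable against decaying exponentials and wide enough for the two kernels of interest, for
  their products with \<open>v\<close> and \<open>v\<^sup>2\<close> that differentiation in the parameter brings down, and for the
  functions met when integrating by parts.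
\<close>
definition cubically_bounded :: "(real \<Rightarrow> real) \<Rightarrow> bool" where
  "cubically_bounded \<phi> \<longleftrightarrow> \<phi> \<in> borel_measurable borel \<and> (\<forall>v\<ge>1. \<bar>\<phi> v\<bar> \<le> 2 * v ^ 3)"

lemma laplace_from_1_dominated:
  assumes "cubically_bounded \<phi>" "v > 1" "Re z \<ge> a" "a > 0"
  shows "norm (exp (- (z * of_real v)) * of_real (\<phi> v)) \<le> 2 * (v powr 3 * exp (- a * v))"
proof -
  have "norm (exp (- (z * of_real v)) * of_real (\<phi> v)) = exp (- (Re z * v)) * \<bar>\<phi> v\<bar>"
    by (simp add: norm_mult norm_exp_eq_Re)
  also have "\<dots> \<le> exp (- a * v) * (2 * v ^ 3)"
    using assms by (intro mult_mono) (auto simp: cubically_bounded_def)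
  also have "v ^ 3 = v powr 3" using assms by (simp add: powr_numeral)
  finally show ?thesis by (simp add: mult_ac)
qed

lemma laplace_weight_integrable: "a > 0 \<Longrightarrow> integrable lborel (\<lambda>v. indicator {1<..} v *\<^sub>R (2 * (v powr 3 * exp (- a * v))) :: real)"
  using set_integrable_mult_right[OF set_integrable_subset[OF gamma_weight_integrable[of 3 a], of "{1<..}"], of 2]
  unfolding set_integrable_def by auto

lemma laplace_from_1_integrable:
  assumes "cubically_bounded \<phi>" "Re z > 0"
  shows "set_integrable lborel {1<..} (\<lambda>v. exp (- (z * of_real v)) * of_real (\<phi> v))"
  unfolding set_integrable_def
proof (rule Bochner_Integration.integrable_bound[OF laplace_weight_integrable[OF assms(2)]])
  show "(\<lambda>v. indicator {1<..} v *\<^sub>R (exp (- (z * of_real v)) * of_real (\<phi> v))) \<in> borel_measurable lborel"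
    using assms(1) unfolding cubically_bounded_def by auto
  show "AE v in lborel. norm (indicator {1<..} v *\<^sub>R (exp (- (z * of_real v)) * of_real (\<phi> v))) \<le>
      norm (indicator {1<..} v *\<^sub>R (2 * (v powr 3 * exp (- Re z * v))))"
    using laplace_from_1_dominated[OF assms(1) _ order.refl assms(2)]
    by (intro AE_I2) (auto split: split_indicator simp: abs_mult)
qed

lemma laplace_from_1_has_derivative:
  assumes \<phi>: "cubically_bounded \<phi>" and z: "Re z > 0"
  shows "(laplace_from_1 \<phi> has_field_derivative - laplace_from_1 (\<lambda>v. v * \<phi> v) z) (at z)"
proof -
  let ?f = "\<lambda>z v. indicator {1<..} v *\<^sub>R (exp (- (z * of_real v)) * of_real (\<phi> v) :: complex)"
  have "((\<lambda>z. \<integral>v. ?f z v \<partial>lborel) has_field_derivative (\<integral>v. deriv (\<lambda>z. ?f z v) z \<partial>lborel)) (at z)"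
  proof (rule has_field_derivative_integral_dominated[where r="Re z / 2" and g="\<lambda>v. indicator {1<..} v *\<^sub>R (2 * (v powr 3 * exp (- (Re z / 2) * v)))"])
    show "norm (?f w v) \<le> indicator {1<..} v *\<^sub>R (2 * (v powr 3 * exp (- (Re z / 2) * v)))" if "w \<in> ball z (Re z / 2)" for w v
    proof -
      have "Re w \<ge> Re z / 2"
        using abs_Re_le_cmod[of "z - w"] that by (auto simp: dist_norm)
      then show ?thesis
        using laplace_from_1_dominated[OF \<phi>, of v "Re z / 2" w] z by (auto split: split_indicator)
    qed
    show "?f w \<in> borel_measurable lborel" for w
      using \<phi> unfolding cubically_bounded_def by auto
    show "integrable lborel (\<lambda>v. indicator {1<..} v *\<^sub>R (2 * (v powr 3 * exp (- (Re z / 2) * v))))"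
      using laplace_weight_integrable[of "Re z / 2"] z by simp
  qed (use z in \<open>auto intro!: holomorphic_intros\<close>)
  also have "(\<lambda>v. deriv (\<lambda>z. ?f z v) z) = (\<lambda>v. - (indicator {1<..} v *\<^sub>R (exp (- (z * of_real v)) * of_real (v * \<phi> v))))"
  proof
    fix v
    have "((\<lambda>z. ?f z v) has_field_derivative - (indicator {1<..} v *\<^sub>R (exp (- (z * of_real v)) * of_real (v * \<phi> v)))) (at z)"
      by (cases "v > 1") (auto intro!: derivative_eq_intros)
    then show "deriv (\<lambda>z. ?f z v) z = - (indicator {1<..} v *\<^sub>R (exp (- (z * of_real v)) * of_real (v * \<phi> v)))"
      by (rule DERIV_imp_deriv)
  qed
  finally show ?thesis
    unfolding laplace_from_1_def[abs_def] set_lebesgue_integral_def by simp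
qed

lemma laplace_from_1_lin:
  assumes "cubically_bounded \<phi>" "cubically_bounded \<psi>" "Re z > 0"
  shows "laplace_from_1 (\<lambda>v. \<phi> v - \<psi> v) z = laplace_from_1 \<phi> z - laplace_from_1 \<psi> z"
    and "laplace_from_1 (\<lambda>v. a * \<phi> v) z = of_real a * laplace_from_1 \<phi> z"
  using set_integral_diff(2)[OF laplace_from_1_integrable[OF assms(1,3)] laplace_from_1_integrable[OF assms(2,3)]]
  by (simp_all add: laplace_from_1_def algebra_simps flip: set_integral_mult_right)

lemma laplace_from_1_by_parts:
  assumes \<phi>: "cubically_bounded \<phi>" and \<psi>: "cubically_bounded \<psi>" and z: "Re z > 0"
    and der: "\<And>v. v > 1 \<Longrightarrow> (\<psi> has_real_derivative \<phi> v) (at v)"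
    and cont: "\<And>v. v > 1 \<Longrightarrow> isCont \<phi> v"
    and at1: "(\<psi> \<longlongrightarrow> 0) (at_right 1)"
  shows "z * laplace_from_1 \<psi> z = laplace_from_1 \<phi> z"
proof -
  let ?e = "\<lambda>v. exp (- (z * of_real v))"
  let ?F = "\<lambda>v::real. ?e v * of_real (\<psi> v)"
  let ?f = "\<lambda>v. ?e v * of_real (\<phi> v) - z * (?e v * of_real (\<psi> v))"
  have int: "set_integrable lborel {1<..} ?f"
    by (intro set_integral_diff(1) set_integrable_mult_right impI laplace_from_1_integrable \<phi> \<psi> z)
  have "(LBINT v=ereal 1..\<infinity>. ?f v) = 0 - 0"
  proof (rule interval_integral_FTC_integrable)
    show "(?F has_vector_derivative ?f v) (at v)" if "ereal 1 < ereal v" for v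
    proof -
      have "((\<lambda>v. complex_of_real (\<psi> v)) has_vector_derivative of_real (\<phi> v)) (at v)"
        using der[of v] that by (auto intro!: has_vector_derivative_of_real simp: has_real_derivative_iff_has_vector_derivative)
      moreover have "(?e has_vector_derivative - z * ?e v) (at v)"
        by (rule has_vector_derivative_real_field) (auto intro!: derivative_eq_intros)
      ultimately have "(?F has_vector_derivative ?e v * of_real (\<phi> v) + (- z * ?e v) * of_real (\<psi> v)) (at v)"
        by (intro has_vector_derivative_mult)
      then show ?thesis by (simp add: mult.assoc)
    qed
    show "isCont ?f v" if "ereal 1 < ereal v" for v
      using cont[of v] DERIV_isCont[OF der[of v]] that by (auto intro!: continuous_intros)
    show "set_integrable lborel (einterval (ereal 1) \<infinity>) ?f" using int by (simp add: einterval_eq)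
    have "((\<lambda>v. ?F v) \<longlongrightarrow> ?e 1 * of_real 0) (at_right 1)"
      by (intro tendsto_mult tendsto_of_real at1) (auto intro!: tendsto_eq_intros)
    then show "((?F \<circ> real_of_ereal) \<longlongrightarrow> 0) (at_right (ereal 1))"
      unfolding ereal_tendsto_simps1 by simp
    have "(?F \<longlongrightarrow> 0) at_top"
    proof (rule Lim_null_comparison)
      show "((\<lambda>v. 2 * (v powr 3 * exp (- Re z * v))) \<longlongrightarrow> 0) at_top"
        using z by real_asymp
      show "\<forall>\<^sub>F v in at_top. norm (?F v) \<le> 2 * (v powr 3 * exp (- Re z * v))"
        using eventually_gt_at_top[of 1] by eventually_elim (use laplace_from_1_dominated[OF \<psi> _ order.refl z] in auto)
    qed
    then show "((?F \<circ> real_of_ereal) \<longlongrightarrow> 0) (at_left \<infinity>)"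
      unfolding ereal_tendsto_simps1 .
  qed auto
  then have "(LBINT v:{1<..}. ?f v) = 0" by (simp add: interval_integral_to_infinity_eq)
  moreover have "(LBINT v:{1<..}. ?f v) = laplace_from_1 \<phi> z - z * laplace_from_1 \<psi> z"
    unfolding laplace_from_1_def
    by (subst set_integral_diff(2)) (auto intro!: set_integrable_mult_right laplace_from_1_integrable \<phi> \<psi> z)
  ultimately show ?thesis by simp
qed

text \<open>
  The substitution \<open>s = x v\<close> moves the parameter out of the exponential, which opens the way to dominated
  convergence as \<open>x\<close> tends to zero.
\<close>
lemma laplace_from_1_rescale:
  assumes "x > 0"
  shows "of_real x * laplace_from_1 \<phi> (of_real x) = (LBINT s:{x<..}. of_real (exp (- s) * \<phi> (s / x)))"
proof -
  have "(LBINT s:{x<..}. complex_of_real (exp (- s) * \<phi> (s / x))) =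
      x *\<^sub>R (\<integral>v. indicator {x<..} (0 + x * v) *\<^sub>R complex_of_real (exp (- (0 + x * v)) * \<phi> ((0 + x * v) / x)) \<partial>lborel)"
    unfolding set_lebesgue_integral_def using assms
    by (subst lborel_integral_real_affine[of x _ 0]) auto
  also have "(\<lambda>v. indicator {x<..} (0 + x * v) *\<^sub>R complex_of_real (exp (- (0 + x * v)) * \<phi> ((0 + x * v) / x))) =
     (\<lambda>v. indicator {1<..} v *\<^sub>R (exp (- (of_real x * of_real v)) * of_real (\<phi> v)))"
    using assms by (intro ext) (auto split: split_indicator simp flip: exp_of_real)
  finally show ?thesis unfolding laplace_from_1_def set_lebesgue_integral_def
    by (simp add: scaleR_conv_of_real)
qed

text \<open>
  The inverse hyperbolic cosine. Its derivative \<open>1 / sqrt (v\<^sup>2 - 1)\<close> is the familiar density of \<open>K\<^sub>0\<close>;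
  the primitive has no singularity at one and makes the two integrals alike.
\<close>
definition log_kernel :: "real \<Rightarrow> real" where "log_kernel v = ln (v + sqrt (v\<^sup>2 - 1))"

abbreviation root_kernel :: "real \<Rightarrow> real" where "root_kernel v \<equiv> sqrt (v\<^sup>2 - 1)"

lemma kernel_bounds:
  assumes "v \<ge> 1"
  shows "0 \<le> root_kernel v" "root_kernel v \<le> v" "0 \<le> log_kernel v" "log_kernel v \<le> 2 * v"
proof -
  show 1: "0 \<le> root_kernel v" using assms by simp
  show 2: "root_kernel v \<le> v" using assms by (intro real_le_lsqrt) auto
  show "0 \<le> log_kernel v" using assms 1 unfolding log_kernel_def by (intro ln_ge_zero) linarith
  have "log_kernel v \<le> v + root_kernel v - 1" unfolding log_kernel_def using assms 1 by (intro ln_le_minus_one) linarith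
  also have "\<dots> \<le> 2 * v" using 2 by linarith
  finally show "log_kernel v \<le> 2 * v" .
qed

lemma cubically_bounded_kernels:
  "cubically_bounded root_kernel" "cubically_bounded (\<lambda>v. v * root_kernel v)"
  "cubically_bounded (\<lambda>v. v * (v * root_kernel v))" "cubically_bounded log_kernel"
  "cubically_bounded (\<lambda>v. (v\<^sup>2 - 1) * root_kernel v)"
  "cubically_bounded (\<lambda>v. v * root_kernel v - log_kernel v)"
proof -
  have p: "v \<le> v ^ 3" "v\<^sup>2 \<le> v ^ 3" if "v \<ge> 1" for v :: real
    using that power_increasing[of 1 3 v] power_increasing[of 2 3 v] by auto
  note k = kernel_bounds
  show "cubically_bounded root_kernel" unfolding cubically_bounded_def
    using k p by (fastforce intro: order.trans)
  show "cubically_bounded log_kernel" unfolding cubically_bounded_def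
  proof (intro conjI allI impI)
    show "log_kernel \<in> borel_measurable borel" unfolding log_kernel_def by measurable
    show "\<bar>log_kernel v\<bar> \<le> 2 * v ^ 3" if "v \<ge> 1" for v using k[OF that] p[OF that] by linarith
  qed
  have q: "0 \<le> v * root_kernel v" "v * root_kernel v \<le> v\<^sup>2" "0 \<le> v * (v * root_kernel v)" "v * (v * root_kernel v) \<le> v ^ 3" if "v \<ge> 1" for v
  proof -
    show 1: "0 \<le> v * root_kernel v" using k[OF that] that by simp
    show "v * root_kernel v \<le> v\<^sup>2" using mult_left_mono[OF k(2)[OF that], of v] that by (simp add: power2_eq_square)
    then show "v * (v * root_kernel v) \<le> v ^ 3" using mult_left_mono[of "v * root_kernel v" "v\<^sup>2" v] that by (simp add: power2_eq_square power3_eq_cube)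
    show "0 \<le> v * (v * root_kernel v)" using 1 that by simp
  qed
  show "cubically_bounded (\<lambda>v. v * root_kernel v)" unfolding cubically_bounded_def
  proof (intro conjI allI impI)
    show "\<bar>v * root_kernel v\<bar> \<le> 2 * v ^ 3" if "v \<ge> 1" for v using q[OF that] p[OF that] that by linarith
  qed measurable
  show "cubically_bounded (\<lambda>v. v * (v * root_kernel v))" unfolding cubically_bounded_def
  proof (intro conjI allI impI)
    show "\<bar>v * (v * root_kernel v)\<bar> \<le> 2 * v ^ 3" if "v \<ge> 1" for v using q[OF that] p[OF that] that by linarith
  qed measurable
  show "cubically_bounded (\<lambda>v. (v\<^sup>2 - 1) * root_kernel v)" unfolding cubically_bounded_def
  proof (intro conjI allI impI)
    show "\<bar>(v\<^sup>2 - 1) * root_kernel v\<bar> \<le> 2 * v ^ 3" if "v \<ge> 1" for v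
    proof -
      have "(v\<^sup>2 - 1) * root_kernel v = v * (v * root_kernel v) - root_kernel v" by (simp add: algebra_simps power2_eq_square)
      then show ?thesis using q[OF that] k[OF that] p[OF that] that by linarith
    qed
  qed measurable
  show "cubically_bounded (\<lambda>v. v * root_kernel v - log_kernel v)" unfolding cubically_bounded_def
  proof (intro conjI allI impI)
    show "\<bar>v * root_kernel v - log_kernel v\<bar> \<le> 2 * v ^ 3" if "v \<ge> 1" for v
      using q[OF that] k[OF that] p[OF that] that by linarith
    show "(\<lambda>v. v * root_kernel v - log_kernel v) \<in> borel_measurable borel" unfolding log_kernel_def by measurable
  qed
qed

lemma root_kernel_deriv: "v > 1 \<Longrightarrow> (root_kernel has_real_derivative v / root_kernel v) (at v)"
proof -
  assume v: "v > 1"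
  then have "1 < v\<^sup>2" by (simp add: one_less_power)
  then show ?thesis by (auto intro!: derivative_eq_intros simp: field_simps)
qed

lemma log_kernel_deriv: "v > 1 \<Longrightarrow> (log_kernel has_real_derivative 1 / root_kernel v) (at v)"
proof -
  assume v: "v > 1"
  then have pos: "root_kernel v > 0" by simp
  then have pos': "v + root_kernel v > 0" using v by linarith
  have "(log_kernel has_real_derivative (1 + v / root_kernel v) / (v + root_kernel v)) (at v)"
    unfolding log_kernel_def
    using DERIV_chain2[OF DERIV_ln_divide[OF pos'] DERIV_add[OF DERIV_ident root_kernel_deriv[OF v]]] by simp
  also have "(1 + v / root_kernel v) / (v + root_kernel v) = 1 / root_kernel v"
  proof -
    have "(1 + v / r) / (v + r) = 1 / r" if "r > 0" "v + r > 0" for r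
    proof -
      have "1 + v / r = (v + r) / r" using that by (simp add: field_simps)
      then show ?thesis using that by simp
    qed
    from this[OF pos pos'] show ?thesis .
  qed
  finally show ?thesis .
qed

text \<open>
  Multiplying the kernel by \<open>v\<close> is minus differentiation of the transform, so the first relation is the
  differential equation \<open>z F'' + 3 F' = z F\<close>. The second one ties the logarithmic kernel to the root kernel. Both come
  from integration by parts.
\<close>
lemma laplace_kernel_relations:
  assumes z: "Re z > 0"
  defines "F \<equiv> laplace_from_1 root_kernel z"
    and "A \<equiv> laplace_from_1 (\<lambda>v. v * root_kernel v) z"
    and "B \<equiv> laplace_from_1 (\<lambda>v. v * (v * root_kernel v)) z"
    and "M \<equiv> laplace_from_1 log_kernel z"
  shows "z * (B - F) = 3 * A" "z * (A - M) = 2 * F"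
proof -
  note k = cubically_bounded_kernels
  have sq: "root_kernel v * root_kernel v = v\<^sup>2 - 1" if "v > 1" for v
    using that by simp
  have "z * laplace_from_1 (\<lambda>v. (v\<^sup>2 - 1) * root_kernel v) z = laplace_from_1 (\<lambda>v. 3 * (v * root_kernel v)) z"
  proof (rule laplace_from_1_by_parts[OF _ k(5) z])
    show "cubically_bounded (\<lambda>v. 3 * (v * root_kernel v))"
      unfolding cubically_bounded_def
    proof (intro conjI allI impI)
      fix v :: real assume v: "v \<ge> 1"
      have "root_kernel v * 3 \<le> 2 * v\<^sup>2"
      proof -
        have "(root_kernel v * 3)\<^sup>2 \<le> (2 * v\<^sup>2)\<^sup>2"
        proof -
          \<comment> \<open>Completing the square in 4 v^4 - 9 v^2 + 9, whose remainder 9 - 81/16 is positive.\<close>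
          have "0 \<le> (2 * v\<^sup>2 - 9/4)\<^sup>2" by simp
          also have "(2 * v\<^sup>2 - 9/4)\<^sup>2 = 4 * v ^ 4 - 9 * (v * v) + 81 / 16"
            by (simp add: power2_eq_square power4_eq_xxxx algebra_simps)
          finally show ?thesis using v by (simp add: power_mult_distrib) (simp add: power2_eq_square)
        qed
        then show ?thesis by (rule power2_le_imp_le) simp
      qed
      then have "v * (root_kernel v * 3) \<le> v * (2 * v\<^sup>2)" using v by (intro mult_left_mono) auto
      moreover have "0 \<le> v * (root_kernel v * 3)" using kernel_bounds[OF v] v by simp
      ultimately show "\<bar>3 * (v * root_kernel v)\<bar> \<le> 2 * v ^ 3"
        by (simp add: power2_eq_square power3_eq_cube mult_ac)
    qed measurable
    show "((\<lambda>v. (v\<^sup>2 - 1) * root_kernel v) has_real_derivative 3 * (v * root_kernel v)) (at v)" if v: "v > 1" for v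
    proof -
      have pos: "root_kernel v > 0" using v by simp
      have "((\<lambda>v. (v\<^sup>2 - 1) * root_kernel v) has_real_derivative (2 * v) * root_kernel v + v / root_kernel v * (v\<^sup>2 - 1)) (at v)"
        by (rule DERIV_mult[OF _ root_kernel_deriv[OF v]]) (auto intro!: derivative_eq_intros)
      also have "v / root_kernel v * (v\<^sup>2 - 1) = v * root_kernel v"
        using sq[OF v] pos by (simp add: field_simps)
      finally show ?thesis by simp
    qed
    show "isCont (\<lambda>v. 3 * (v * root_kernel v)) v" for v by (intro continuous_intros)
    show "((\<lambda>v. (v\<^sup>2 - 1) * root_kernel v) \<longlongrightarrow> 0) (at_right 1)" by (auto intro!: tendsto_eq_intros)
  qed
  moreover have "(\<lambda>v. (v\<^sup>2 - 1) * root_kernel v) = (\<lambda>v. v * (v * root_kernel v) - root_kernel v)"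
    by (simp add: algebra_simps power2_eq_square)
  ultimately show "z * (B - F) = 3 * A"
    using laplace_from_1_lin(1)[OF k(3,1) z] laplace_from_1_lin(2)[OF k(2,2) z, of 3] by (simp add: A_def B_def F_def)
  have "z * laplace_from_1 (\<lambda>v. v * root_kernel v - log_kernel v) z = laplace_from_1 (\<lambda>v. 2 * root_kernel v) z"
  proof (rule laplace_from_1_by_parts[OF _ k(6) z])
    show "cubically_bounded (\<lambda>v. 2 * root_kernel v)"
      unfolding cubically_bounded_def
    proof (intro conjI allI impI)
      fix v :: real assume v: "v \<ge> 1"
      show "\<bar>2 * root_kernel v\<bar> \<le> 2 * v ^ 3"
        using kernel_bounds[OF v] power_increasing[of 1 3 v] v by (simp add: abs_mult)
    qed measurable
    show "((\<lambda>v. v * root_kernel v - log_kernel v) has_real_derivative 2 * root_kernel v) (at v)" if v: "v > 1" for v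
    proof -
      have pos: "root_kernel v > 0" using v by simp
      have "((\<lambda>v. v * root_kernel v - log_kernel v) has_real_derivative 1 * root_kernel v + v / root_kernel v * v - 1 / root_kernel v) (at v)"
        by (intro DERIV_diff DERIV_mult DERIV_ident root_kernel_deriv[OF v] log_kernel_deriv[OF v])
      also have "1 * root_kernel v + v / root_kernel v * v - 1 / root_kernel v = 2 * root_kernel v"
        using sq[OF v] pos by (simp add: field_simps power2_eq_square)
      finally show ?thesis .
    qed
    show "isCont (\<lambda>v. 2 * root_kernel v) v" for v by (intro continuous_intros)
    show "((\<lambda>v. v * root_kernel v - log_kernel v) \<longlongrightarrow> 0) (at_right 1)" unfolding log_kernel_def by (auto intro!: tendsto_eq_intros)
  qed
  then show "z * (A - M) = 2 * F"
    using laplace_from_1_lin(1)[OF k(2,4) z] laplace_from_1_lin(2)[OF k(1,1) z, of 2] by (simp add: A_def M_def F_def)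
qed

text \<open>
  Euler's integral may be differentiated at one because \<open>ln s\<close> is dominated by an integrable power on either side
  of \<open>s = 1\<close>. The derivative links the constant term of \<open>K\<^sub>0\<close> at the origin, which stems from the Gamma
  function, with the constant term of the Laplace integral.
\<close>
lemma deriv_Gamma_1: "deriv Gamma 1 = (LBINT s:{0<..}. of_real (ln s * exp (- s)) :: complex)"
  and log_weight_integrable: "set_integrable lborel {0<..} (\<lambda>s::real. ln s * exp (- s))"
proof -
  let ?w = "\<lambda>p s. indicator {0<..} s *\<^sub>R (s powr p * exp (- 1 * s)) :: real"
  have wi: "integrable lborel (?w p)" if "p > -1" for p
    using gamma_weight_integrable[of p 1] that by (simp add: set_integrable_def)
  have w2: "integrable lborel (\<lambda>s. 2 * ?w (-1/2) s + ?w 1 s)"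
    using wi[of "-1/2"] wi[of 1] by (intro Bochner_Integration.integrable_add integrable_mult_right) auto
  show "set_integrable lborel {0<..} (\<lambda>s::real. ln s * exp (- s))"
    unfolding set_integrable_def
  proof (rule Bochner_Integration.integrable_bound[OF w2])
    show "AE s in lborel. norm (indicator {0<..} s *\<^sub>R (ln s * exp (- s))) \<le> norm (2 * ?w (-1/2) s + ?w 1 s)"
    proof (rule AE_I2)
      fix s :: real
      show "norm (indicator {0<..} s *\<^sub>R (ln s * exp (- s))) \<le> norm (2 * ?w (-1/2) s + ?w 1 s)"
      proof (cases "s > 0")
        case True
        have "ln s \<le> s - 1" using True by (rule ln_le_minus_one)
        moreover have "- ln s \<le> 2 * s powr (-1/2)"
          using ln_le_minus_one[of "s powr (-1/2)"] True by (simp add: ln_powr)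
        moreover have "s powr 1 = s" "s powr (-1/2) \<ge> 0" using True by simp_all
        ultimately have "\<bar>ln s\<bar> \<le> 2 * s powr (-1/2) + s powr 1" using True by linarith
        then have "\<bar>ln s\<bar> * exp (- s) \<le> (2 * s powr (-1/2) + s powr 1) * exp (- s)"
          by (intro mult_right_mono) auto
        then show ?thesis using True by (simp add: abs_mult algebra_simps)
      qed simp
    qed
  qed measurable
  let ?f = "\<lambda>z s. indicator {0<..} s *\<^sub>R (of_real s powr (z - 1) * of_real (exp (- s)) :: complex)"
  have "((\<lambda>z. \<integral>s. ?f z s \<partial>lborel) has_field_derivative (\<integral>s. deriv (\<lambda>z. ?f z s) 1 \<partial>lborel)) (at 1)"
  proof (rule has_field_derivative_integral_dominated[where r="1/2" and g="\<lambda>s. ?w (-1/2) s + ?w (1/2) s"])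
    show "?f z \<in> borel_measurable lborel" if "z \<in> ball 1 (1/2)" for z
    proof -
      have "Re z > 0" using abs_Re_le_cmod[of "1 - z"] that by (auto simp: dist_norm)
      then show ?thesis using gamma_weight_complex(1)[of z] by (auto simp: set_integrable_def)
    qed
    show "(\<lambda>z. ?f z s) holomorphic_on ball 1 (1/2)" for s
      by (cases "s > 0") (auto intro!: holomorphic_intros)
    show "norm (?f z s) \<le> ?w (-1/2) s + ?w (1/2) s" if "z \<in> ball 1 (1/2)" for z s
    proof (cases "s > 0")
      case True
      have "cmod (1 - z) < 1/2" using that by (simp add: dist_norm)
      moreover have "\<bar>1 - Re z\<bar> \<le> cmod (1 - z)" using abs_Re_le_cmod[of "1 - z"] by simp
      ultimately have z: "\<bar>Re z - 1\<bar> < 1/2" by linarith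
      have z': "Re z - 1 \<le> 1/2" "-1/2 \<le> Re z - 1" using z by linarith+
      have "s powr (Re z - 1) \<le> s powr (-1/2) + s powr (1/2)"
      proof (cases "s \<ge> 1")
        case True
        then have "s powr (Re z - 1) \<le> s powr (1/2)" using z' by (intro powr_mono) auto
        then show ?thesis by (simp add: add_increasing)
      next
        case False
        then have "s powr (Re z - 1) \<le> s powr (-1/2)" using z' \<open>s > 0\<close> by (intro powr_mono') auto
        then show ?thesis by (simp add: add_increasing2)
      qed
      then have "s powr (Re z - 1) * exp (- s) \<le> (s powr (-1/2) + s powr (1/2)) * exp (- s)"
        by (intro mult_right_mono) auto
      then show ?thesis using True by (simp add: norm_mult norm_powr_real_powr algebra_simps)
    qed simp
    show "integrable lborel (\<lambda>s. ?w (-1/2) s + ?w (1/2) s)"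
      using wi[of "-1/2"] wi[of "1/2"] by auto
  qed simp
  also have "(\<lambda>s. deriv (\<lambda>z. ?f z s) 1) = (\<lambda>s. indicator {0<..} s *\<^sub>R of_real (ln s * exp (- s)))"
  proof
    fix s :: real
    have "((\<lambda>z. ?f z s) has_field_derivative indicator {0<..} s *\<^sub>R of_real (ln s * exp (- s))) (at 1)"
    proof (cases "s > 0")
      case True
      have "((\<lambda>z. of_real s powr (z - 1)) has_field_derivative (Ln (of_real s) * of_real s powr (1 - 1)) * (1 - 0)) (at (1::complex))"
        using True by (intro DERIV_chain2[OF has_field_derivative_powr_right DERIV_diff[OF DERIV_ident DERIV_const]]) auto
      from DERIV_cmult_right[OF this, of "of_real (exp (- s))"] show ?thesis
        using True by (simp add: Ln_of_real)
    qed simp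
    then show "deriv (\<lambda>z. ?f z s) 1 = indicator {0<..} s *\<^sub>R of_real (ln s * exp (- s))"
      by (rule DERIV_imp_deriv)
  qed
  finally have "((\<lambda>z. \<integral>s. ?f z s \<partial>lborel) has_field_derivative (\<integral>s. indicator {0<..} s *\<^sub>R of_real (ln s * exp (- s)) \<partial>lborel)) (at 1)" .
  moreover have "(\<integral>s. ?f z s \<partial>lborel) = Gamma z" if "z \<in> ball 1 (1/2)" for z
  proof -
    have "Re z > 0" using abs_Re_le_cmod[of "1 - z"] that by (auto simp: dist_norm)
    then show ?thesis using gamma_weight_complex(2)[of z] by (simp add: set_lebesgue_integral_def)
  qed
  ultimately have "(Gamma has_field_derivative (\<integral>s. indicator {0<..} s *\<^sub>R of_real (ln s * exp (- s)) \<partial>lborel)) (at (1::complex))"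
    using has_field_derivative_transform_within_open[of "\<lambda>z. \<integral>s. ?f z s \<partial>lborel" _ 1 "ball 1 (1/2)" Gamma] by auto
  then show "deriv Gamma 1 = (LBINT s:{0<..}. of_real (ln s * exp (- s)) :: complex)"
    unfolding set_lebesgue_integral_def by (rule DERIV_imp_deriv)
qed

lemma deriv_rGamma_1: "deriv rGamma 1 = - deriv Gamma (1::complex)"
proof -
  have "((\<lambda>z. inverse (Gamma z)) has_field_derivative - (deriv Gamma 1 / (Gamma 1)\<^sup>2)) (at (1::complex))"
    using DERIV_inverse_fun[of Gamma "deriv Gamma 1" 1 UNIV] field_differentiable_Gamma[of 1 UNIV]
    by (simp add: DERIV_deriv_iff_field_differentiable)
  moreover have "(\<lambda>z. inverse (Gamma z)) = (rGamma :: complex \<Rightarrow> complex)"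
    by (simp add: rGamma_inverse_Gamma fun_eq_iff)
  ultimately show ?thesis by (simp add: DERIV_imp_deriv)
qed

text \<open>
  After rescaling, both transforms are integrals against \<open>exp (- s)\<close> over \<open>s > x\<close>, and their integrands converge
  under an integrable bound as \<open>x\<close> tends to zero along the reciprocals of the integers.
\<close>
lemma laplace_kernels_at_0:
  defines "X \<equiv> \<lambda>n::nat. inverse (real (Suc n))"
  shows "(\<lambda>n. (of_real (X n))\<^sup>2 * laplace_from_1 root_kernel (of_real (X n))) \<longlonglongrightarrow> 1"
    and "(\<lambda>n. of_real (X n) * laplace_from_1 log_kernel (of_real (X n)) + Ln (of_real (X n) / 2)) \<longlonglongrightarrow> deriv Gamma 1"
proof -
  have X: "X n > 0" for n by (simp add: X_def)
  have X0: "X \<longlonglongrightarrow> 0" unfolding X_def by (rule LIMSEQ_inverse_real_of_nat)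
  have ev: "eventually (\<lambda>n. X n < s) sequentially" if "s > 0" for s
    using order_tendstoD(2)[OF X0 that] .
  have rk: "of_real x * (of_real x * laplace_from_1 root_kernel (of_real x)) =
     (\<integral>s. indicator {x<..} s *\<^sub>R complex_of_real (exp (- s) * sqrt (s\<^sup>2 - x\<^sup>2)) \<partial>lborel)" if x: "x > 0" for x
  proof -
    have "x * root_kernel (s / x) = sqrt (s\<^sup>2 - x\<^sup>2)" for s
    proof -
      have "x * root_kernel (s / x) = sqrt (x\<^sup>2 * ((s/x)\<^sup>2 - 1))" using x by (simp add: real_sqrt_mult)
      also have "x\<^sup>2 * ((s/x)\<^sup>2 - 1) = s\<^sup>2 - x\<^sup>2" using x by (simp add: field_simps power_divide)
      finally show ?thesis .
    qed
    then have "complex_of_real x * of_real (exp (- s) * root_kernel (s / x)) = of_real (exp (- s) * sqrt (s\<^sup>2 - x\<^sup>2))" for s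
      by (metis mult.left_commute of_real_mult)
    then show ?thesis
      unfolding laplace_from_1_rescale[OF x] set_lebesgue_integral_def
      by (subst integral_mult_right_zero[symmetric]) (simp only: mult_scaleR_right)
  qed
  have "(\<lambda>n. \<integral>s. indicator {X n<..} s *\<^sub>R complex_of_real (exp (- s) * sqrt (s\<^sup>2 - (X n)\<^sup>2)) \<partial>lborel) \<longlonglongrightarrow>
      (\<integral>s. indicator {0<..} s *\<^sub>R complex_of_real (exp (- s) * s) \<partial>lborel)"
  proof (rule integral_dominated_convergence[where w="\<lambda>s. indicator {0<..} s *\<^sub>R (s powr 1 * exp (- 1 * s))"])
    show "integrable lborel (\<lambda>s. indicator {0<..} s *\<^sub>R (s powr 1 * exp (- 1 * s)) :: real)"
      using gamma_weight_integrable[of 1 1] by (simp add: set_integrable_def)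
    show "AE s in lborel. (\<lambda>n. indicator {X n<..} s *\<^sub>R complex_of_real (exp (- s) * sqrt (s\<^sup>2 - (X n)\<^sup>2)))
        \<longlonglongrightarrow> indicator {0<..} s *\<^sub>R complex_of_real (exp (- s) * s)"
    proof (rule AE_I2)
      fix s :: real
      show "(\<lambda>n. indicator {X n<..} s *\<^sub>R complex_of_real (exp (- s) * sqrt (s\<^sup>2 - (X n)\<^sup>2)))
        \<longlonglongrightarrow> indicator {0<..} s *\<^sub>R complex_of_real (exp (- s) * s)"
      proof (cases "s > 0")
        case True
        have "(\<lambda>n. complex_of_real (exp (- s) * sqrt (s\<^sup>2 - (X n)\<^sup>2))) \<longlonglongrightarrow> complex_of_real (exp (- s) * sqrt (s\<^sup>2 - 0\<^sup>2))"
          by (intro tendsto_intros X0)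
        then have "(\<lambda>n. complex_of_real (exp (- s) * sqrt (s\<^sup>2 - (X n)\<^sup>2))) \<longlonglongrightarrow> complex_of_real (exp (- s) * s)"
          using True by simp
        then have "(\<lambda>n. indicator {X n<..} s *\<^sub>R complex_of_real (exp (- s) * sqrt (s\<^sup>2 - (X n)\<^sup>2)))
          \<longlonglongrightarrow> complex_of_real (exp (- s) * s)"
          by (rule Lim_transform_eventually) (use ev[OF True] in eventually_elim, simp)
        then show ?thesis using True by simp
      next
        case False
        then have "indicator {X n<..} s = (0::real)" for n using X[of n] by auto
        then show ?thesis using False by simp
      qed
    qed
    show "AE s in lborel. norm (indicator {X n<..} s *\<^sub>R complex_of_real (exp (- s) * sqrt (s\<^sup>2 - (X n)\<^sup>2)))
      \<le> indicator {0<..} s *\<^sub>R (s powr 1 * exp (- 1 * s))" for n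
    proof (rule AE_I2)
      fix s :: real
      show "norm (indicator {X n<..} s *\<^sub>R complex_of_real (exp (- s) * sqrt (s\<^sup>2 - (X n)\<^sup>2)))
      \<le> indicator {0<..} s *\<^sub>R (s powr 1 * exp (- 1 * s))"
      proof (cases "s > X n")
        case True
        then have "s > 0" using X[of n] by linarith
        have "sqrt (s\<^sup>2 - (X n)\<^sup>2) \<le> s" "0 \<le> sqrt (s\<^sup>2 - (X n)\<^sup>2)"
          using True X[of n] \<open>s > 0\<close> by (auto intro!: real_le_lsqrt power_mono)
        then show ?thesis using True \<open>s > 0\<close> by (simp add: norm_mult abs_mult mult.commute)
      qed (auto split: split_indicator)
    qed
  qed measurable
  also have "(\<integral>s. indicator {0<..} s *\<^sub>R complex_of_real (exp (- s) * s) \<partial>lborel) = Gamma 2"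
    using gamma_weight_complex(2)[of 2] unfolding set_lebesgue_integral_def
    by (auto simp: mult.commute intro!: Bochner_Integration.integral_cong split: split_indicator)
  also have "Gamma 2 = (1::complex)" by (simp add: Gamma_numeral)
  finally show "(\<lambda>n. (of_real (X n))\<^sup>2 * laplace_from_1 root_kernel (of_real (X n))) \<longlonglongrightarrow> 1"
    by (simp only: power2_eq_square[where 'a=complex] mult.assoc rk[OF X])
  \<comment> \<open>At s / x the logarithmic kernel is the logarithm of (s + sqrt (s^2 - x^2)) / 2 minus ln (x / 2). The first
    part tends to ln s, the second one is the logarithmic singularity of the order-zero function.\<close>
  let ?l = "\<lambda>x s. exp (- s) * ln ((s + sqrt (s\<^sup>2 - x\<^sup>2)) / 2)"
  have li: "set_integrable lborel {x<..} (\<lambda>s. exp (- s))" if "x \<ge> 0" for x :: real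
    using set_integrable_subset[OF gamma_weight_integrable[of 0 1], of "{x<..}"] that
    by (auto elim!: set_integrable_cong[THEN iffD1, rotated -1])
  have lx: "\<bar>ln ((s + sqrt (s\<^sup>2 - x\<^sup>2)) / 2)\<bar> \<le> \<bar>ln s\<bar> + ln 2" if "x > 0" "s > x" for x s :: real
  proof -
    have s: "s > 0" using that by linarith
    have q: "0 \<le> sqrt (s\<^sup>2 - x\<^sup>2)" "sqrt (s\<^sup>2 - x\<^sup>2) \<le> s" using that s by (auto intro!: real_le_lsqrt power_mono)
    have "ln ((s + sqrt (s\<^sup>2 - x\<^sup>2)) / 2) \<le> ln s" using q s by (intro ln_mono) (auto intro: add_pos_nonneg)
    moreover have "ln (s / 2) \<le> ln ((s + sqrt (s\<^sup>2 - x\<^sup>2)) / 2)" using q s by (intro ln_mono) auto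
    moreover have "ln (s / 2) = ln s - ln 2" using s by (simp add: ln_div)
    moreover have "ln 2 > (0::real)" by simp
    ultimately show ?thesis by linarith
  qed
  have wint: "integrable lborel (\<lambda>s. indicator {0<..} s *\<^sub>R (\<bar>ln s\<bar> * exp (- s)) + ln 2 * (indicator {0<..} s *\<^sub>R exp (- s)) :: real)"
  proof (intro Bochner_Integration.integrable_add integrable_mult_right)
    have "set_integrable lborel {0<..} (\<lambda>s::real. \<bar>ln s * exp (- s)\<bar>)"
      by (rule set_integrable_abs[OF log_weight_integrable])
    then show "integrable lborel (\<lambda>s. indicator {0<..} s *\<^sub>R (\<bar>ln s\<bar> * exp (- s)) :: real)"
      unfolding set_integrable_def by (simp add: abs_mult)
    show "integrable lborel (\<lambda>s. indicator {0<..} s *\<^sub>R exp (- s) :: real)"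
      using li[of 0] by (simp add: set_integrable_def)
  qed
  have bd: "norm (indicator {x<..} s *\<^sub>R complex_of_real (?l x s)) \<le>
     indicator {0<..} s *\<^sub>R (\<bar>ln s\<bar> * exp (- s)) + ln 2 * (indicator {0<..} s *\<^sub>R exp (- s))" if x: "x > 0" for x s
  proof (cases "s > x")
    case True
    have "\<bar>ln ((s + sqrt (s\<^sup>2 - x\<^sup>2)) / 2)\<bar> * exp (- s) \<le> (\<bar>ln s\<bar> + ln 2) * exp (- s)"
      by (intro mult_right_mono lx x True) auto
    then show ?thesis using True x by (simp add: norm_mult algebra_simps)
  qed (auto split: split_indicator)
  have lk: "of_real x * laplace_from_1 log_kernel (of_real x) + of_real (exp (- x) * ln (x / 2)) =
     (\<integral>s. indicator {x<..} s *\<^sub>R complex_of_real (?l x s) \<partial>lborel)" if x: "x > 0" for x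
  proof -
    have lkx: "log_kernel (s / x) = ln ((s + sqrt (s\<^sup>2 - x\<^sup>2)) / 2) - ln (x / 2)" if s: "s > x" for s
    proof -
      have "x * root_kernel (s / x) = sqrt (x\<^sup>2 * ((s/x)\<^sup>2 - 1))" using x by (simp add: real_sqrt_mult)
      also have "x\<^sup>2 * ((s/x)\<^sup>2 - 1) = s\<^sup>2 - x\<^sup>2" using x by (simp add: field_simps power_divide)
      finally have "s / x + root_kernel (s / x) = (s + sqrt (s\<^sup>2 - x\<^sup>2)) / x"
        using x by (simp add: field_simps)
      moreover have "0 \<le> sqrt (s\<^sup>2 - x\<^sup>2)" using s x by (auto intro!: power_mono)
      then have "s + sqrt (s\<^sup>2 - x\<^sup>2) > 0" using s x by linarith
      ultimately show ?thesis using x unfolding log_kernel_def by (simp add: ln_div)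
    qed
    have lint: "set_integrable lborel {x<..} (\<lambda>s. complex_of_real (?l x s))"
      unfolding set_integrable_def
    proof (rule Bochner_Integration.integrable_bound[OF wint])
      show "(\<lambda>s. indicator {x<..} s *\<^sub>R complex_of_real (?l x s)) \<in> borel_measurable lborel" by measurable
      show "AE s in lborel. norm (indicator {x<..} s *\<^sub>R complex_of_real (?l x s)) \<le>
        norm (indicator {0<..} s *\<^sub>R (\<bar>ln s\<bar> * exp (- s)) + ln 2 * (indicator {0<..} s *\<^sub>R exp (- s)))"
        by (rule AE_I2, rule order.trans[OF bd[OF x]]) (simp only: real_norm_def abs_ge_self)
    qed
    have eint: "set_integrable lborel {x<..} (\<lambda>s. complex_of_real (exp (- s)))"
    proof -
      have "integrable lborel (\<lambda>s. complex_of_real (indicator {x<..} s *\<^sub>R exp (- s)))"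
        using li[of x] x unfolding set_integrable_def by (intro integrable_of_real) simp
      then show ?thesis by (simp add: set_integrable_def scaleR_conv_of_real)
    qed
    have "(LBINT s:{x<..}. exp (- s)) = exp (- x)"
    proof -
      have "(LBINT s=ereal x..\<infinity>. exp (- s)) = 0 - (- exp (- x))"
      proof (rule interval_integral_FTC_integrable[where F="\<lambda>s. - exp (- s)"])
        show "((\<lambda>s. - exp (- s)) has_vector_derivative exp (- s)) (at s)" for s :: real
          unfolding has_real_derivative_iff_has_vector_derivative[symmetric] by (auto intro!: derivative_eq_intros)
        show "set_integrable lborel (einterval (ereal x) \<infinity>) (\<lambda>s. exp (- s))" using li[of x] x by (simp add: einterval_eq)
        show "(((\<lambda>s. - exp (- s)) \<circ> real_of_ereal) \<longlongrightarrow> - exp (- x)) (at_right (ereal x))"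
          unfolding ereal_tendsto_simps1 by (auto intro!: tendsto_eq_intros)
        show "(((\<lambda>s. - exp (- s)) \<circ> real_of_ereal) \<longlongrightarrow> (0::real)) (at_left \<infinity>)"
          unfolding ereal_tendsto_simps1 by real_asymp
      qed auto
      then show ?thesis by (simp add: interval_integral_to_infinity_eq)
    qed
    then have e: "(LBINT s:{x<..}. complex_of_real (exp (- s))) = of_real (exp (- x))"
      using set_integral_complex_of_real[of lborel "{x<..}" "\<lambda>s. exp (- s)"] by simp
    have "of_real x * laplace_from_1 log_kernel (of_real x) =
       (LBINT s:{x<..}. complex_of_real (?l x s) - of_real (ln (x / 2)) * of_real (exp (- s)))"
      unfolding laplace_from_1_rescale[OF x]
      by (intro set_lebesgue_integral_cong) (auto simp: lkx algebra_simps)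
    also have "\<dots> = (LBINT s:{x<..}. complex_of_real (?l x s)) - of_real (ln (x / 2)) * of_real (exp (- x))"
      using set_integral_diff(2)[OF lint set_integrable_mult_right[OF eint, of "of_real (ln (x / 2))"]]
      by (simp only: set_integral_mult_right e)
    finally show ?thesis by (simp add: set_lebesgue_integral_def)
  qed
  have "(\<lambda>n. \<integral>s. indicator {X n<..} s *\<^sub>R complex_of_real (?l (X n) s) \<partial>lborel) \<longlonglongrightarrow>
      (\<integral>s. indicator {0<..} s *\<^sub>R complex_of_real (exp (- s) * ln s) \<partial>lborel)"
  proof (rule integral_dominated_convergence[OF _ _ wint])
    show "AE s in lborel. (\<lambda>n. indicator {X n<..} s *\<^sub>R complex_of_real (?l (X n) s))
        \<longlonglongrightarrow> indicator {0<..} s *\<^sub>R complex_of_real (exp (- s) * ln s)"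
    proof (rule AE_I2)
      fix s :: real
      show "(\<lambda>n. indicator {X n<..} s *\<^sub>R complex_of_real (?l (X n) s))
        \<longlonglongrightarrow> indicator {0<..} s *\<^sub>R complex_of_real (exp (- s) * ln s)"
      proof (cases "s > 0")
        case True
        have "(\<lambda>n. complex_of_real (?l (X n) s)) \<longlonglongrightarrow> complex_of_real (?l 0 s)"
          using True by (intro tendsto_intros X0) auto
        then have "(\<lambda>n. complex_of_real (?l (X n) s)) \<longlonglongrightarrow> complex_of_real (exp (- s) * ln s)"
          using True by simp
        then have "(\<lambda>n. indicator {X n<..} s *\<^sub>R complex_of_real (?l (X n) s)) \<longlonglongrightarrow> complex_of_real (exp (- s) * ln s)"
          by (rule Lim_transform_eventually) (use ev[OF True] in eventually_elim, simp)
        then show ?thesis using True by simp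
      next
        case False
        then have "indicator {X n<..} s = (0::real)" for n using X[of n] by auto
        then show ?thesis using False by simp
      qed
    qed
    show "AE s in lborel. norm (indicator {X n<..} s *\<^sub>R complex_of_real (?l (X n) s))
      \<le> indicator {0<..} s *\<^sub>R (\<bar>ln s\<bar> * exp (- s)) + ln 2 * (indicator {0<..} s *\<^sub>R exp (- s))" for n
      by (rule AE_I2, rule bd[OF X])
  qed measurable
  then have "(\<lambda>n. of_real (X n) * laplace_from_1 log_kernel (of_real (X n)) + of_real (exp (- X n) * ln (X n / 2))) \<longlonglongrightarrow> deriv Gamma 1"
    unfolding lk[OF X] deriv_Gamma_1 set_lebesgue_integral_def by (simp add: mult.commute)
  \<comment> \<open>The mass exp (- x) of the range s > x may be replaced by one in front of the logarithm.\<close>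
  moreover have "(\<lambda>n. complex_of_real ((1 - exp (- X n)) * ln (X n / 2))) \<longlonglongrightarrow> of_real 0"
  proof (intro tendsto_of_real)
    have "((\<lambda>x::real. (1 - exp (- x)) * ln (x / 2)) \<longlongrightarrow> 0) (at_right 0)" by real_asymp
    moreover have "filterlim X (at_right 0) sequentially" using X0 by (simp add: filterlim_at X order_less_imp_not_eq2[OF X])
    ultimately show "(\<lambda>n. (1 - exp (- X n)) * ln (X n / 2)) \<longlonglongrightarrow> 0" by (rule filterlim_compose)
  qed
  ultimately have "(\<lambda>n. of_real (X n) * laplace_from_1 log_kernel (of_real (X n)) + of_real (exp (- X n) * ln (X n / 2)) +
      complex_of_real ((1 - exp (- X n)) * ln (X n / 2))) \<longlonglongrightarrow> deriv Gamma 1 + of_real 0"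
    by (rule tendsto_add)
  also have "(\<lambda>n. of_real (X n) * laplace_from_1 log_kernel (of_real (X n)) + of_real (exp (- X n) * ln (X n / 2)) +
      complex_of_real ((1 - exp (- X n)) * ln (X n / 2))) =
     (\<lambda>n. of_real (X n) * laplace_from_1 log_kernel (of_real (X n)) + Ln (of_real (X n) / 2))"
  proof
    fix n
    have "Ln (of_real (X n) / 2) = of_real (ln (X n / 2))" using X[of n] Ln_of_real[of "X n / 2"] by simp
    then show "of_real (X n) * laplace_from_1 log_kernel (of_real (X n)) + of_real (exp (- X n) * ln (X n / 2)) +
      complex_of_real ((1 - exp (- X n)) * ln (X n / 2)) = of_real (X n) * laplace_from_1 log_kernel (of_real (X n)) + Ln (of_real (X n) / 2)"
      by (simp add: algebra_simps)
  qed
  finally show "(\<lambda>n. of_real (X n) * laplace_from_1 log_kernel (of_real (X n)) + Ln (of_real (X n) / 2)) \<longlonglongrightarrow> deriv Gamma 1" by simp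
qed

text \<open>
  Both sides solve the same first-order system. Multiplied by \<open>z\<close>, the cross products of their differences with
  the solutions \<open>I\<close> and \<open>K\<close> of the system are constant, and the behaviour at the origin makes these constants
  vanish.
\<close>
lemma integer_K_laplace:
  assumes "Re z > 0"
  shows "integer_K 0 z = z * laplace_from_1 log_kernel z" (is ?t0)
    and "integer_K 1 z = z * laplace_from_1 root_kernel z" (is ?t1)
proof -
  let ?F = "laplace_from_1 root_kernel" and ?A = "laplace_from_1 (\<lambda>v. v * root_kernel v)"
    and ?B = "laplace_from_1 (\<lambda>v. v * (v * root_kernel v))" and ?M = "laplace_from_1 log_kernel"
  define H where "H = {z::complex. Re z > 0}"
  have H: "convex H" "open H" unfolding H_def by (auto simp: convex_halfspace_Re_gt open_halfspace_Re_gt)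
  \<comment> \<open>The difference at order zero is written through A and F, whose derivatives are transforms again; by M this
    is the same as using the logarithmic kernel.\<close>
  define d0 where "d0 = (\<lambda>z. z * ?A z - 2 * ?F z - integer_K 0 z)"
  define d1 where "d1 = (\<lambda>z. z * ?F z - integer_K 1 z)"
  have M: "z * ?A z - 2 * ?F z = z * ?M z" if "z \<in> H" for z
    using laplace_kernel_relations(2)[of z] that by (simp add: H_def algebra_simps)
  have Hs: "z \<notin> \<real>\<^sub>\<le>\<^sub>0" "z \<noteq> 0" if "z \<in> H" for z using that by (auto simp: H_def complex_nonpos_Reals_iff)
  have dI: "(integer_I 0 has_field_derivative integer_I 1 z) (at z)"
     "(integer_I 1 has_field_derivative integer_I 0 z - integer_I 1 z / z) (at z)" if "z \<in> H" for z
    using integer_I_has_derivative[OF Hs(2)[OF that], of 0] integer_I_has_derivative[OF Hs(2)[OF that], of 1]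
      integer_I_recurrence[OF Hs(2)[OF that], of 0] by (simp_all add: numeral_2_eq_2 algebra_simps)
  have dK: "(integer_K 0 has_field_derivative - integer_K 1 z) (at z)"
     "(integer_K 1 has_field_derivative - integer_K 0 z - integer_K 1 z / z) (at z)" if "z \<in> H" for z
    using integer_K_has_derivative[OF Hs(1)[OF that], of 0] integer_K_has_derivative[OF Hs(1)[OF that], of 1]
      integer_K_recurrence[OF Hs(2)[OF that], of 0] by (simp_all add: numeral_2_eq_2 algebra_simps)
  have dd: "(d0 has_field_derivative - d1 z) (at z)" "(d1 has_field_derivative - d0 z - d1 z / z) (at z)" if z: "z \<in> H" for z
  proof -
    have Rz: "Re z > 0" using z by (simp add: H_def)
    note F = laplace_from_1_has_derivative[OF cubically_bounded_kernels(1) Rz]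
    note A = laplace_from_1_has_derivative[OF cubically_bounded_kernels(2) Rz]
    have "(d0 has_field_derivative (1 * ?A z + - ?B z * z) - 2 * (- ?A z) - (- integer_K 1 z)) (at z)"
      unfolding d0_def by (intro DERIV_diff DERIV_mult DERIV_cmult DERIV_ident F A dK[OF z])
    moreover have "(1 * ?A z + - ?B z * z) - 2 * (- ?A z) - (- integer_K 1 z) = - d1 z"
      using laplace_kernel_relations(1)[OF Rz] by (simp add: d1_def algebra_simps)
    ultimately show "(d0 has_field_derivative - d1 z) (at z)" by simp
    have "(d1 has_field_derivative (1 * ?F z + - ?A z * z) - (- integer_K 0 z - integer_K 1 z / z)) (at z)"
      unfolding d1_def by (intro DERIV_diff DERIV_mult DERIV_ident F dK[OF z])
    moreover have "(1 * ?F z + - ?A z * z) - (- integer_K 0 z - integer_K 1 z / z) = - d0 z - d1 z / z"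
      using Hs[OF z] by (simp add: d0_def d1_def field_simps)
    ultimately show "(d1 has_field_derivative - d0 z - d1 z / z) (at z)" by simp
  qed
  define c1 where "c1 = (\<lambda>z. z * (d1 z * integer_I 0 z + d0 z * integer_I 1 z))"
  define c2 where "c2 = (\<lambda>z. z * (d1 z * integer_K 0 z - d0 z * integer_K 1 z))"
  have "(c1 has_field_derivative 0) (at z)" if z: "z \<in> H" for z
  proof -
    have "(c1 has_field_derivative 1 * (d1 z * integer_I 0 z + d0 z * integer_I 1 z) +
      (((- d0 z - d1 z / z) * integer_I 0 z + integer_I 1 z * d1 z) +
       ((- d1 z) * integer_I 1 z + (integer_I 0 z - integer_I 1 z / z) * d0 z)) * z) (at z)"
      unfolding c1_def by (intro DERIV_mult DERIV_add DERIV_ident dd[OF z] dI[OF z])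
    moreover have "1 * (d1 z * integer_I 0 z + d0 z * integer_I 1 z) +
      (((- d0 z - d1 z / z) * integer_I 0 z + integer_I 1 z * d1 z) +
       ((- d1 z) * integer_I 1 z + (integer_I 0 z - integer_I 1 z / z) * d0 z)) * z = 0"
      using Hs[OF z] by (simp add: field_simps)
    ultimately show ?thesis by simp
  qed
  then obtain C1 where C1: "\<And>z. z \<in> H \<Longrightarrow> c1 z = C1"
    using has_field_derivative_zero_constant[OF H(1), of c1] by (metis has_field_derivative_at_within)
  have "(c2 has_field_derivative 0) (at z)" if z: "z \<in> H" for z
  proof -
    have "(c2 has_field_derivative 1 * (d1 z * integer_K 0 z - d0 z * integer_K 1 z) +
      (((- d0 z - d1 z / z) * integer_K 0 z + (- integer_K 1 z) * d1 z) -
       ((- d1 z) * integer_K 1 z + (- integer_K 0 z - integer_K 1 z / z) * d0 z)) * z) (at z)"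
      unfolding c2_def by (intro DERIV_mult DERIV_diff DERIV_ident dd[OF z] dK[OF z])
    moreover have "1 * (d1 z * integer_K 0 z - d0 z * integer_K 1 z) +
      (((- d0 z - d1 z / z) * integer_K 0 z + (- integer_K 1 z) * d1 z) -
       ((- d1 z) * integer_K 1 z + (- integer_K 0 z - integer_K 1 z / z) * d0 z)) * z = 0"
      using Hs[OF z] by (simp add: field_simps)
    ultimately show ?thesis by simp
  qed
  then obtain C2 where C2: "\<And>z. z \<in> H \<Longrightarrow> c2 z = C2"
    using has_field_derivative_zero_constant[OF H(1), of c2] by (metis has_field_derivative_at_within)
  have W: "z * (integer_I 0 z * integer_K 1 z + integer_I 1 z * integer_K 0 z) = 1" if "z \<in> H" for z
    using integer_I_K_cross_product[OF Hs(1)[OF that], of 0] by simp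
  define X where "X = (\<lambda>n::nat. complex_of_real (inverse (real (Suc n))))"
  have XH: "X n \<in> H" for n by (simp add: X_def H_def)
  have X0: "X \<longlonglongrightarrow> 0" unfolding X_def using tendsto_of_real[OF LIMSEQ_inverse_real_of_nat, where 'a=complex] unfolding of_real_0 .
  have Xat: "filterlim X (at 0) sequentially"
    using X0 Hs(2)[OF XH] by (auto simp: filterlim_at)
  have I0: "(\<lambda>n. integer_I 0 (X n)) \<longlonglongrightarrow> 1" and I1: "(\<lambda>n. integer_I 1 (X n)) \<longlonglongrightarrow> 0"
    using filterlim_compose[OF integer_I_tendsto_0(1) Xat] filterlim_compose[OF integer_I_tendsto_0(2)[of 0] Xat] by simp_all
  have d0lim: "(\<lambda>n. d0 (X n)) \<longlonglongrightarrow> 0"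
  proof -
    have "(\<lambda>n. (X n * ?M (X n) + Ln (X n / 2)) - (integer_K 0 (X n) + Ln (X n / 2))) \<longlonglongrightarrow> deriv Gamma 1 - (- deriv rGamma 1)"
      using laplace_kernels_at_0(2) unfolding X_def[symmetric]
      by (intro tendsto_diff filterlim_compose[OF integer_K_0_tendsto Xat]) (simp add: X_def)
    then show ?thesis by (simp add: d0_def M[OF XH] deriv_rGamma_1)
  qed
  have d1lim: "(\<lambda>n. X n * d1 (X n)) \<longlonglongrightarrow> 0"
  proof -
    have "(\<lambda>n. (X n)\<^sup>2 * ?F (X n) - 2 * ((X n / 2) ^ Suc 0 * integer_K (Suc 0) (X n))) \<longlonglongrightarrow> 1 - 2 * (fact 0 / 2)"
      using laplace_kernels_at_0(1)
      by (intro tendsto_diff tendsto_mult tendsto_const filterlim_compose[OF integer_K_Suc_tendsto Xat]) (simp add: X_def)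
    then show ?thesis by (simp add: d1_def power2_eq_square algebra_simps)
  qed
  have "(\<lambda>n. X n * d1 (X n) * integer_I 0 (X n) + X n * (d0 (X n) * integer_I 1 (X n))) \<longlonglongrightarrow> 0 * 1 + 0 * (0 * 0)"
    by (intro tendsto_intros I0 I1 d0lim d1lim X0)
  also have "(\<lambda>n. X n * d1 (X n) * integer_I 0 (X n) + X n * (d0 (X n) * integer_I 1 (X n))) = (\<lambda>n. c1 (X n))"
    by (simp add: c1_def algebra_simps)
  finally have "C1 = 0" using C1[OF XH] LIMSEQ_unique tendsto_const by force
  have e1: "d1 z * integer_I 0 z = - (d0 z * integer_I 1 z)" if "z \<in> H" for z
    using C1[OF that] Hs[OF that] \<open>C1 = 0\<close> by (simp add: c1_def eq_neg_iff_add_eq_0)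
  \<comment> \<open>The cross product of I and K expresses d0 through its own cross products; the one with I has already vanished.\<close>
  have d0c: "d0 z = - C2 * integer_I 0 z" if z: "z \<in> H" for z
  proof -
    have "d0 z = d0 z * (z * (integer_I 0 z * integer_K 1 z + integer_I 1 z * integer_K 0 z))" using W[OF z] by simp
    also have "\<dots> = z * integer_K 1 z * d0 z * integer_I 0 z - z * integer_K 0 z * (- (d0 z * integer_I 1 z))" by (simp add: algebra_simps)
    also have "\<dots> = - c2 z * integer_I 0 z" unfolding e1[OF z, symmetric] by (simp add: c2_def algebra_simps)
    finally show ?thesis using C2[OF z] by simp
  qed
  have "(\<lambda>n. - C2 * integer_I 0 (X n)) \<longlonglongrightarrow> - C2 * 1" by (intro tendsto_intros I0)
  then have "- C2 * 1 = 0" using d0lim LIMSEQ_unique unfolding d0c[OF XH] by blast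
  then have d0z: "d0 z = 0" if "z \<in> H" for z using d0c[OF that] by simp
  have zH: "z \<in> H" using assms by (simp add: H_def)
  have "(d0 has_field_derivative 0) (at z)"
    by (rule has_field_derivative_transform_within_open[of "\<lambda>_. 0" _ _ H]) (use H zH d0z in auto)
  then have "d1 z = 0" using dd(1)[OF zH] DERIV_unique by force
  then show ?t1 by (simp add: d1_def)
  show ?t0 using d0z[OF zH] M[OF zH] by (simp add: d0_def)
qed

section \<open>Values on the real axis and conjugation\<close>

lemma laplace_from_1_positive:
  assumes \<phi>: "cubically_bounded \<phi>" and pos: "\<And>v. v > 1 \<Longrightarrow> \<phi> v > 0" and x: "x > 0"
  obtains k where "k > 0" "laplace_from_1 \<phi> (of_real x) = of_real k"
proof -
  let ?g = "\<lambda>v. exp (- (x * v)) * \<phi> v"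
  have c: "exp (- (of_real x * of_real v)) * of_real (\<phi> v) = complex_of_real (?g v)" for v
    by (simp flip: exp_of_real)
  have "set_integrable lborel {1<..} (\<lambda>v. complex_of_real (?g v))"
    using laplace_from_1_integrable[OF \<phi>, of "of_real x"] x unfolding c by simp
  then have "integrable lborel (\<lambda>v. Re (indicator {1<..} v *\<^sub>R complex_of_real (?g v)))"
    unfolding set_integrable_def by (rule integrable_Re)
  then have int: "integrable lborel (\<lambda>v. indicator {1<..} v *\<^sub>R ?g v)" by simp
  have nn: "0 \<le> indicator {1<..} v *\<^sub>R ?g v" for v using pos[of v] by (auto split: split_indicator)
  define k where "k = (LBINT v:{1<..}. ?g v)"
  have "k \<ge> 0" unfolding k_def set_lebesgue_integral_def by (intro Bochner_Integration.integral_nonneg nn)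
  moreover have "k \<noteq> 0"
  proof
    assume "k = 0"
    then have "AE v in lborel. indicator {1<..} v *\<^sub>R ?g v = 0"
      using integral_nonneg_eq_0_iff_AE[OF int AE_I2[OF nn]] by (simp add: k_def set_lebesgue_integral_def)
    then have "AE v in lborel. v \<notin> {1::real<..}"
      by eventually_elim (use pos in \<open>force split: split_indicator\<close>)
    then have "{1::real<..} \<in> null_sets lborel" by (subst AE_iff_null_sets) auto
    moreover have "{1::real<..<2} \<subseteq> {1<..}" by auto
    ultimately have "emeasure lborel {1::real<..<2} = 0"
      using emeasure_mono[of "{1::real<..<2}" "{1<..}" lborel] by (auto simp: null_sets_def)
    then show False by simp
  qed
  moreover have "laplace_from_1 \<phi> (of_real x) = of_real k"
    unfolding laplace_from_1_def c k_def by (rule set_integral_complex_of_real)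
  ultimately show ?thesis using that[of k] by simp
qed

text \<open>
  Laplace integrals of positive kernels for the first two orders; the recurrence has positive coefficients.
\<close>
lemma integer_K_pos_real:
  assumes x: "x > 0"
  shows "\<exists>k>0. integer_K n (of_real x) = of_real k"
proof (induction n rule: less_induct)
  case (less n)
  have Re: "Re (of_real x) > 0" using x by simp
  consider "n = 0" | "n = 1" | m where "n = m + 2"
    by (metis One_nat_def add_2_eq_Suc' not0_implies_Suc)
  then show ?case
  proof cases
    case 1
    have "log_kernel v > 0" if "v > 1" for v
      unfolding log_kernel_def using kernel_bounds(1)[of v] that by (intro ln_gt_zero) linarith
    then obtain k where "k > 0" "laplace_from_1 log_kernel (of_real x) = of_real k"
      using laplace_from_1_positive[OF cubically_bounded_kernels(4) _ x] by metis
    then show ?thesis using integer_K_laplace(1)[OF Re] 1 x by (intro exI[of _ "x * k"]) simp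
  next
    case 2
    have "root_kernel v > 0" if "v > 1" for v using that by simp
    then obtain k where "k > 0" "laplace_from_1 root_kernel (of_real x) = of_real k"
      using laplace_from_1_positive[OF cubically_bounded_kernels(1) _ x] by metis
    then show ?thesis using integer_K_laplace(2)[OF Re] 2 x by (intro exI[of _ "x * k"]) simp
  next
    case 3
    obtain k0 k1 where k: "k0 > 0" "k1 > 0" "integer_K m (of_real x) = of_real k0" "integer_K (m + 1) (of_real x) = of_real k1"
      using less[of m] less[of "m + 1"] 3 by auto
    have "integer_K n (of_real x) = of_real (k0 + 2 * real (m + 1) / x * k1)"
      using integer_K_recurrence[of "of_real x" m] x k 3 by simp
    moreover have "k0 + 2 * real (m + 1) / x * k1 > 0" using k x by (intro add_pos_pos mult_pos_pos divide_pos_pos) auto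
    ultimately show ?thesis by blast
  qed
qed

lemma integer_I_pos_real:
  assumes x: "x > 0"
  shows "\<exists>i>0. integer_I n (of_real x) = of_real i"
proof -
  define t where "t = (\<lambda>k. inverse (fact (n + k)) / fact k * ((x / 2)\<^sup>2) ^ k :: real)"
  have tpos: "t k > 0" for k using x by (simp add: t_def)
  have "rGamma (of_nat n + of_nat k + 1 :: complex) = inverse (fact (n + k))" for k
    using Gamma_fact[of "n + k", where 'a=complex] by (simp add: rGamma_inverse_Gamma add_ac)
  then have "(\<lambda>k. complex_of_real (t k)) sums bessel_clifford (of_nat n) ((of_real x / 2)\<^sup>2)"
    using bessel_clifford_sums[of "of_nat n" "(of_real x / 2)\<^sup>2"] by (simp add: t_def)
  from sums_Re[OF this] sums_Im[OF this] have s: "t sums Re (bessel_clifford (of_nat n) ((of_real x / 2)\<^sup>2))"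
    "Im (bessel_clifford (of_nat n) ((of_real x / 2)\<^sup>2)) = 0"
    by (simp, metis (no_types, lifting) Im_complex_of_real sums_0 sums_unique2 sums_Im \<open>(\<lambda>k. complex_of_real (t k)) sums _\<close>)
  then have "bessel_clifford (of_nat n) ((of_real x / 2)\<^sup>2) = of_real (suminf t)"
    by (simp add: complex_eq_iff sums_iff)
  moreover have "suminf t > 0" using s tpos by (intro suminf_pos) (auto simp: sums_iff)
  ultimately show ?thesis using x
    by (intro exI[of _ "(x / 2) ^ n * suminf t"]) (simp add: integer_I_eq)
qed

text \<open>
  On the negative axis real and imaginary part of \<^const>\<open>integer_K\<close> come from the positive
  values of \<open>K\<close> and \<open>I\<close>, so there is no zero there.
\<close>
lemma integer_K_nonzero_real:
  assumes "x \<noteq> 0"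
  shows "integer_K n (of_real x) \<noteq> 0"
proof (cases "x > 0")
  case True
  then show ?thesis using integer_K_pos_real[of x n] by auto
next
  case False
  then have r: "- x > 0" using assms by simp
  obtain k i where "i > 0" "integer_K n (of_real (- x)) = of_real k" "integer_I n (of_real (- x)) = of_real i"
    using integer_K_pos_real[OF r, of n] integer_I_pos_real[OF r, of n] by auto
  then have "integer_K n (of_real x) = of_real ((-1) ^ n * k) - \<i> * of_real (pi * i)"
    using integer_K_neg(1)[OF r, of n] by simp
  then have "Im (integer_K n (of_real x)) = - (pi * i)" by simp
  then show ?thesis using \<open>i > 0\<close> by auto
qed

lemma positive_reals_islimpt_1: "1 islimpt complex_of_real ` {0<..}"
  unfolding islimpt_approachable
proof (intro allI impI)
  fix e :: real assume "e > 0"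
  then have "complex_of_real (1 + e / 2) \<in> complex_of_real ` {0<..}" by (intro imageI) simp
  moreover have "complex_of_real (1 + e / 2) \<noteq> 1 \<and> dist (complex_of_real (1 + e / 2)) 1 < e"
    using \<open>e > 0\<close> by (simp add: dist_norm)
  ultimately show "\<exists>x\<in>complex_of_real ` {0<..}. x \<noteq> 1 \<and> dist x 1 < e" by blast
qed

text \<open>
  The function is real on the positive axis, so it agrees with its conjugate there and hence everywhere.
\<close>
lemma integer_K_cnj:
  assumes "z \<notin> \<real>\<^sub>\<le>\<^sub>0"
  shows "integer_K n (cnj z) = cnj (integer_K n z)"
proof -
  have cs: "cnj ` (- \<real>\<^sub>\<le>\<^sub>0) = - \<real>\<^sub>\<le>\<^sub>0"
    by (auto simp: complex_nonpos_Reals_iff image_iff intro!: bexI[of _ "cnj _"])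
  have "(cnj \<circ> integer_K n \<circ> cnj) holomorphic_on (- \<real>\<^sub>\<le>\<^sub>0)"
    by (rule holomorphic_on_compose_cnj_cnj) (use integer_K_holomorphic slit_plane_facts cs in auto)
  then have hol: "(\<lambda>z. cnj (integer_K n (cnj z)) - integer_K n z) holomorphic_on (- \<real>\<^sub>\<le>\<^sub>0)"
    using integer_K_holomorphic by (auto intro!: holomorphic_intros simp: o_def)
  have "cnj (integer_K n (cnj z)) - integer_K n z = 0"
  proof (rule analytic_continuation[OF hol slit_plane_facts, of "of_real ` {0<..}" 1])
    show "1 islimpt complex_of_real ` {0<..}" by (rule positive_reals_islimpt_1)
    show "cnj (integer_K n (cnj w)) - integer_K n w = 0" if "w \<in> of_real ` {0<..}" for w
    proof -
      from that obtain x where x: "w = of_real x" "x \<in> {0<..}" by (rule imageE)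
      then have "x > 0" by simp
      show ?thesis using integer_K_pos_real[OF \<open>x > 0\<close>, of n] x by auto
    qed
  qed (use assms in \<open>auto simp: complex_nonpos_Reals_iff\<close>)
  then show ?thesis by (metis complex_cnj_cnj eq_iff_diff_eq_0)
qed

section \<open>Asymptotics in the slit plane\<close>

text \<open>
  With \<open>v = 1 + u / z\<close> the Laplace integral of the root kernel retains \<open>z\<close>, up to an elementary factor, in the square root alone. In this form it
  converges in the whole slit plane, and not merely in the right half-plane.
\<close>
definition root_moment :: "real \<Rightarrow> complex \<Rightarrow> complex" where
  "root_moment p z = (LBINT u:{0<..}. of_real (u powr p * exp (- u)) * csqrt (2 + of_real u / z))"

lemma csqrt_bound: "norm (csqrt w) \<le> 1 + norm w"
proof -
  have "norm (csqrt w) = sqrt (norm w)" by (rule norm_csqrt)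
  also have "\<dots> \<le> 1 + norm w" by (intro real_le_lsqrt) (auto simp: power2_eq_square algebra_simps)
  finally show ?thesis .
qed

text \<open>
  The principal root has non-negative real part, so its sum with \<open>sqrt 2\<close> has modulus at least one. Hence the
  expansion of the root at two has a remainder bound for all complex \<open>w\<close>, large or small.
\<close>
lemma csqrt_2_estimates:
  shows "norm (csqrt (2 + w) - of_real (sqrt 2)) \<le> norm w"
    and "norm (csqrt (2 + w) - of_real (sqrt 2) * (1 + w / 4)) \<le> (norm w)\<^sup>2"
proof -
  let ?s = "csqrt (2 + w)" and ?a = "complex_of_real (sqrt 2)"
  have a2: "?a * ?a = 2" by (simp flip: of_real_mult)
  have s2: "?s * ?s = 2 + w" using power2_csqrt[of "2 + w"] by (simp add: power2_eq_square)
  have re: "Re ?s \<ge> 0" using csqrt_principal[of "2 + w"] by auto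
  have "1 \<le> sqrt (2::real)" by simp
  also have "\<dots> \<le> Re (?s + ?a)" using re by simp
  also have "\<dots> \<le> norm (?s + ?a)" by (rule complex_Re_le_cmod)
  finally have n1: "1 \<le> norm (?s + ?a)" .
  have "(?s - ?a) * (?s + ?a) = w" using s2 a2 by (simp add: algebra_simps)
  then have "norm (?s - ?a) * norm (?s + ?a) = norm w" by (metis norm_mult)
  moreover have "norm (?s - ?a) * 1 \<le> norm (?s - ?a) * norm (?s + ?a)" using n1 by (intro mult_left_mono) auto
  ultimately show 1: "norm (?s - ?a) \<le> norm w" by simp
  have "(?s - ?a) * (?s - ?a) = - (2 * ?a * (?s - ?a * (1 + w / 4)))"
  proof -
    have "2 * ?a * (?s - ?a * (1 + w / 4)) = 2 * ?a * ?s - 2 * (?a * ?a) * (1 + w / 4)" by (simp add: algebra_simps)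
    then show ?thesis unfolding a2 using s2 a2 by (simp add: algebra_simps)
  qed
  then have "norm ((?s - ?a) * (?s - ?a)) = norm (2 * ?a * (?s - ?a * (1 + w / 4)))"
    by (simp only: norm_minus_cancel)
  then have "norm (?s - ?a) * norm (?s - ?a) = 2 * sqrt 2 * norm (?s - ?a * (1 + w / 4))"
    unfolding norm_mult by simp
  moreover have "norm (?s - ?a) * norm (?s - ?a) \<le> norm w * norm w" using 1 by (intro mult_mono) auto
  moreover have "1 * norm (?s - ?a * (1 + w / 4)) \<le> 2 * sqrt 2 * norm (?s - ?a * (1 + w / 4))"
    by (intro mult_right_mono) (auto intro: order.trans[of 1 "sqrt 2"])
  ultimately show "norm (?s - ?a * (1 + w / 4)) \<le> (norm w)\<^sup>2" by (simp add: power2_eq_square)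
qed

lemma root_moment_dominated:
  assumes "u > 0" "norm z \<ge> d" "d > 0"
  shows "norm (of_real (u powr p * exp (- u)) * csqrt (2 + of_real u / z)) \<le>
     3 * (u powr p * exp (- 1 * u)) + 1 / d * (u powr (p + 1) * exp (- 1 * u))"
proof -
  have "norm (csqrt (2 + of_real u / z)) \<le> 1 + (2 + u / norm z)"
    using order.trans[OF csqrt_bound add_left_mono[OF norm_triangle_ineq[of 2 "of_real u / z"]]] assms
    by (simp add: norm_divide)
  also have "u / norm z \<le> u / d" using assms by (intro divide_left_mono mult_pos_pos) auto
  finally have "norm (csqrt (2 + of_real u / z)) \<le> 3 + u / d" by simp
  then have "u powr p * exp (- u) * norm (csqrt (2 + of_real u / z)) \<le> u powr p * exp (- u) * (3 + u / d)"
    by (intro mult_left_mono) auto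
  moreover have "norm (of_real (u powr p * exp (- u)) * csqrt (2 + of_real u / z)) = u powr p * exp (- u) * norm (csqrt (2 + of_real u / z))"
    by (simp add: norm_mult)
  moreover have "u powr (p + 1) = u powr p * u" using assms by (simp add: powr_add)
  ultimately show ?thesis by (simp add: algebra_simps)
qed

lemma root_moment_weight: "p > -1 \<Longrightarrow> integrable lborel (\<lambda>u. indicator {0<..} u *\<^sub>R
   (3 * (u powr p * exp (- 1 * u)) + c * (u powr (p + 1) * exp (- 1 * u))) :: real)"
  using set_integral_add(1)[OF set_integrable_mult_right[OF gamma_weight_integrable[of p 1], of 3]
      set_integrable_mult_right[OF gamma_weight_integrable[of "p + 1" 1], of c]]
  by (auto simp: set_integrable_def)

lemma slit_shift:
  fixes z :: complex
  assumes "z \<notin> \<real>\<^sub>\<le>\<^sub>0" "u > 0"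
  shows "2 + of_real u / z \<notin> \<real>\<^sub>\<le>\<^sub>0"
proof
  assume "2 + of_real u / z \<in> \<real>\<^sub>\<le>\<^sub>0"
  then obtain a where a: "a \<le> 0" "2 + of_real u / z = of_real a" by (auto elim: nonpos_Reals_cases)
  have z0: "z \<noteq> 0" using assms by auto
  have "of_real u / z = of_real (a - 2)" using a(2) by (simp add: algebra_simps)
  then have "of_real u = of_real (a - 2) * z" using z0 by (simp add: field_simps)
  moreover have "complex_of_real (a - 2) \<noteq> 0" using a(1) by (simp only: of_real_eq_0_iff)
  ultimately have "z = of_real (u / (a - 2))" unfolding of_real_divide by (metis nonzero_mult_div_cancel_left)
  moreover have "u / (a - 2) \<le> 0" using a(1) assms(2) by (intro divide_nonneg_nonpos) auto
  ultimately have "z \<in> \<real>\<^sub>\<le>\<^sub>0" by (simp only: nonpos_Reals_of_real_iff)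
  then show False using assms(1) by simp
qed

lemma root_moment_measurable:
  "(\<lambda>u. indicator {0<..} u *\<^sub>R (of_real (u powr p * exp (- u)) * csqrt (2 + of_real u / z))) \<in> borel_measurable lborel"
proof -
  have "csqrt = (\<lambda>z. if z = 0 then 0 else exp (Ln z / 2))"
    by (auto simp: csqrt_exp_Ln)
  moreover have "(\<lambda>z. if z = 0 then 0 else exp (Ln z / 2)) \<in> borel_measurable borel" by measurable
  ultimately have [measurable]: "csqrt \<in> borel_measurable borel" by simp
  show ?thesis by measurable
qed

lemma root_moment_integrable:
  assumes "p > -1" "z \<noteq> 0"
  shows "set_integrable lborel {0<..} (\<lambda>u. of_real (u powr p * exp (- u)) * csqrt (2 + of_real u / z))"
  unfolding set_integrable_def
proof (rule Bochner_Integration.integrable_bound[OF root_moment_weight[OF assms(1), of "1 / norm z"] root_moment_measurable])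
  show "AE u in lborel. norm (indicator {0<..} u *\<^sub>R (of_real (u powr p * exp (- u)) * csqrt (2 + of_real u / z)))
    \<le> norm (indicator {0<..} u *\<^sub>R (3 * (u powr p * exp (- 1 * u)) + 1 / norm z * (u powr (p + 1) * exp (- 1 * u))))"
  proof (rule AE_I2)
    fix u
    show "norm (indicator {0<..} u *\<^sub>R (of_real (u powr p * exp (- u)) * csqrt (2 + of_real u / z)))
      \<le> norm (indicator {0<..} u *\<^sub>R (3 * (u powr p * exp (- 1 * u)) + 1 / norm z * (u powr (p + 1) * exp (- 1 * u))))"
    proof (cases "u > 0")
      case True
      then show ?thesis using order.trans[OF root_moment_dominated[OF True order.refl, of z p] abs_ge_self] assms(2) by simp
    qed simp
  qed
qed

lemma root_moment_holomorphic:
  assumes p: "p > -1"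
  shows "root_moment p holomorphic_on (- \<real>\<^sub>\<le>\<^sub>0)"
proof (subst holomorphic_on_open[OF slit_plane_facts(1)], intro ballI)
  fix z0 :: complex assume z0: "z0 \<in> - \<real>\<^sub>\<le>\<^sub>0"
  let ?f = "\<lambda>z u. indicator {0<..} u *\<^sub>R (of_real (u powr p * exp (- u)) * csqrt (2 + of_real u / z))"
  obtain r0 where r0: "r0 > 0" "ball z0 r0 \<subseteq> - \<real>\<^sub>\<le>\<^sub>0" using z0 slit_plane_facts(1) open_contains_ball by blast
  have n0: "norm z0 > 0" using z0 by auto
  define r where "r = min r0 (norm z0 / 2)"
  have r: "r > 0" "ball z0 r \<subseteq> - \<real>\<^sub>\<le>\<^sub>0" using r0 n0 by (auto simp: r_def)
  have lower: "norm z \<ge> norm z0 / 2" if "z \<in> ball z0 r" for z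
    using that norm_triangle_ineq2[of z0 z] by (auto simp: r_def dist_norm)
  have "((\<lambda>z. \<integral>u. ?f z u \<partial>lborel) has_field_derivative (\<integral>u. deriv (\<lambda>z. ?f z u) z0 \<partial>lborel)) (at z0)"
  proof (rule has_field_derivative_integral_dominated[OF r(1) root_moment_measurable])
    show "(\<lambda>z. ?f z u) holomorphic_on ball z0 r" for u
    proof (cases "u > 0")
      case True
      have "2 + of_real u / z \<notin> \<real>\<^sub>\<le>\<^sub>0" "z \<noteq> 0" if "z \<in> ball z0 r" for z
      proof -
        have "z \<notin> \<real>\<^sub>\<le>\<^sub>0" using r(2) that by blast
        then show "2 + of_real u / z \<notin> \<real>\<^sub>\<le>\<^sub>0" "z \<noteq> 0" using slit_shift[OF _ True, of z] by auto
      qed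
      moreover have "\<not> norm z0 < r" using calculation(2)[of 0] by auto
      ultimately show ?thesis using True by (auto intro!: holomorphic_intros)
    qed simp
    show "norm (?f z u) \<le> indicator {0<..} u *\<^sub>R
   (3 * (u powr p * exp (- 1 * u)) + 1 / (norm z0 / 2) * (u powr (p + 1) * exp (- 1 * u)))" if "z \<in> ball z0 r" for z u
    proof (cases "u > 0")
      case True
      then show ?thesis using root_moment_dominated[OF True lower[OF that], of p] n0 by simp
    qed simp
  qed (rule root_moment_weight[OF p])
  then show "\<exists>f'. (root_moment p has_field_derivative f') (at z0)"
    unfolding root_moment_def[abs_def] set_lebesgue_integral_def by blast
qed

lemma gamma_moment:
  assumes "p > -1"
  shows "set_integrable lborel {0<..} (\<lambda>u. complex_of_real (u powr p * exp (- u)))"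
    and "(LBINT u:{0<..}. complex_of_real (u powr p * exp (- u))) = Gamma (of_real (p + 1))"
proof -
  have e: "of_real u powr (of_real (p + 1) - 1) * of_real (exp (- u)) = complex_of_real (u powr p * exp (- u))" if "u \<in> {0<..}" for u
    using that by (simp add: powr_of_real)
  have R: "Re (of_real (p + 1)) > 0" using assms by simp
  show "set_integrable lborel {0<..} (\<lambda>u. complex_of_real (u powr p * exp (- u)))"
    using gamma_weight_complex(1)[OF R] by (rule set_integrable_cong[THEN iffD1, rotated -1]) (auto simp: powr_of_real)
  show "(LBINT u:{0<..}. complex_of_real (u powr p * exp (- u))) = Gamma (of_real (p + 1))"
    unfolding gamma_weight_complex(2)[OF R, symmetric] by (intro set_lebesgue_integral_cong) (auto simp: powr_of_real)
qed

text \<open>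
  Watson's lemma for this integral. It is uniform in the direction of \<open>z\<close> because the estimates of the
  principal root are.
\<close>
lemma root_moment_asymptotics:
  assumes p: "p > -1"
  obtains C where "C \<ge> 0" "\<And>z. z \<noteq> 0 \<Longrightarrow> norm (root_moment p z - of_real (sqrt 2) * Gamma (of_real (p + 1))) \<le> C / norm z"
    "\<And>z. z \<noteq> 0 \<Longrightarrow> norm (root_moment p z - of_real (sqrt 2) * (Gamma (of_real (p + 1)) + Gamma (of_real (p + 2)) / (4 * z))) \<le> C / (norm z)\<^sup>2"
proof -
  define m :: "real \<Rightarrow> real" where "m = (\<lambda>q. LBINT u:{0<..}. u powr q * exp (- 1 * u))"
  have mi: "set_integrable lborel {0<..} (\<lambda>u. u powr q * exp (- 1 * u))" if "q > -1" for q :: real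
    using gamma_weight_integrable[of q 1] that by simp
  have m0: "m q \<ge> 0" for q unfolding m_def set_lebesgue_integral_def by (intro Bochner_Integration.integral_nonneg) auto
  note g0 = gamma_moment[OF p]
  have g1: "set_integrable lborel {0<..} (\<lambda>u. complex_of_real (u powr (p + 1) * exp (- u)))"
    "(LBINT u:{0<..}. complex_of_real (u powr (p + 1) * exp (- u))) = Gamma (of_real (p + 2))"
    using gamma_moment[of "p + 1"] p by (simp_all add: add.assoc)
  have pw: "u powr (p + 1) = u powr p * u" "u powr (p + 2) = u powr p * u\<^sup>2" if "u > 0" for u
    using that by (simp_all add: powr_add powr_numeral)
  have 1: "norm (root_moment p z - of_real (sqrt 2) * Gamma (of_real (p + 1))) \<le> m (p + 1) / norm z" if z: "z \<noteq> 0" for z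
  proof -
    have eq: "root_moment p z - of_real (sqrt 2) * Gamma (of_real (p + 1)) =
      (LBINT u:{0<..}. of_real (u powr p * exp (- u)) * csqrt (2 + of_real u / z) - of_real (sqrt 2) * of_real (u powr p * exp (- u)))"
      using set_integral_diff(2)[OF root_moment_integrable[OF p z] set_integrable_mult_right[OF g0(1), of "of_real (sqrt 2)"]]
      unfolding root_moment_def set_integral_mult_right g0(2) by simp
    have "norm (LBINT u:{0<..}. of_real (u powr p * exp (- u)) * csqrt (2 + of_real u / z) - of_real (sqrt 2) * of_real (u powr p * exp (- u))) \<le> (LBINT u:{0<..}. 1 / norm z * (u powr (p + 1) * exp (- 1 * u)))"
      unfolding set_lebesgue_integral_def
    proof (rule Bochner_Integration.integral_norm_bound_integral)
      show "integrable lborel (\<lambda>u. indicator {0<..} u *\<^sub>R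
         (of_real (u powr p * exp (- u)) * csqrt (2 + of_real u / z) - of_real (sqrt 2) * of_real (u powr p * exp (- u))))"
        using set_integral_diff(1)[OF root_moment_integrable[OF p z] set_integrable_mult_right[OF g0(1), of "of_real (sqrt 2)"]]
        by (simp add: set_integrable_def)
      show "integrable lborel (\<lambda>u. indicator {0<..} u *\<^sub>R (1 / norm z * (u powr (p + 1) * exp (- 1 * u))))"
        using set_integrable_mult_right[OF mi[of "p + 1"], of "1 / norm z"] p unfolding set_integrable_def by simp
      fix u :: real
      show "norm (indicator {0<..} u *\<^sub>R (of_real (u powr p * exp (- u)) * csqrt (2 + of_real u / z) - of_real (sqrt 2) * of_real (u powr p * exp (- u))))
        \<le> indicator {0<..} u *\<^sub>R (1 / norm z * (u powr (p + 1) * exp (- 1 * u)))"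
      proof (cases "u > 0")
        case True
        have "norm (of_real (u powr p * exp (- u)) * (csqrt (2 + of_real u / z) - of_real (sqrt 2))) \<le> (u powr p * exp (- u)) * (u / norm z)"
          using csqrt_2_estimates(1)[of "of_real u / z"] True unfolding norm_mult
          by (intro mult_mono) (auto simp: norm_divide norm_mult)
        then show ?thesis using True pw by (simp add: algebra_simps)
      qed simp
    qed
    moreover have "(LBINT u:{0<..}. 1 / norm z * (u powr (p + 1) * exp (- 1 * u))) = m (p + 1) / norm z" by (simp add: m_def)
    ultimately show ?thesis unfolding eq by (simp only:)
  qed
  have 2: "norm (root_moment p z - of_real (sqrt 2) * (Gamma (of_real (p + 1)) + Gamma (of_real (p + 2)) / (4 * z))) \<le> m (p + 2) / (norm z)\<^sup>2" if z: "z \<noteq> 0" for z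
  proof -
    let ?t = "\<lambda>u. of_real (sqrt 2) * (of_real (u powr p * exp (- u)) + 1 / (4 * z) * of_real (u powr (p + 1) * exp (- u)))"
    note gi = set_integrable_mult_right[OF set_integral_add(1)[OF g0(1) set_integrable_mult_right[OF g1(1), of "1 / (4 * z)"]], of "of_real (sqrt 2)"]
    have "(LBINT u:{0<..}. ?t u) = of_real (sqrt 2) * (Gamma (of_real (p + 1)) + 1 / (4 * z) * Gamma (of_real (p + 2)))"
      unfolding set_integral_mult_right set_integral_add(2)[OF g0(1) set_integrable_mult_right[OF g1(1), of "1 / (4 * z)"]] g0(2) g1(2) ..
    then have eq: "root_moment p z - of_real (sqrt 2) * (Gamma (of_real (p + 1)) + Gamma (of_real (p + 2)) / (4 * z)) =
      (LBINT u:{0<..}. of_real (u powr p * exp (- u)) * csqrt (2 + of_real u / z) - ?t u)"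
      using set_integral_diff(2)[OF root_moment_integrable[OF p z] gi] unfolding root_moment_def by simp
    have "norm (LBINT u:{0<..}. of_real (u powr p * exp (- u)) * csqrt (2 + of_real u / z) - ?t u) \<le> (LBINT u:{0<..}. 1 / (norm z)\<^sup>2 * (u powr (p + 2) * exp (- 1 * u)))"
      unfolding set_lebesgue_integral_def
    proof (rule Bochner_Integration.integral_norm_bound_integral)
      show "integrable lborel (\<lambda>u. indicator {0<..} u *\<^sub>R
         (of_real (u powr p * exp (- u)) * csqrt (2 + of_real u / z) - ?t u))"
        using set_integral_diff(1)[OF root_moment_integrable[OF p z] gi] unfolding set_integrable_def .
      show "integrable lborel (\<lambda>u. indicator {0<..} u *\<^sub>R (1 / (norm z)\<^sup>2 * (u powr (p + 2) * exp (- 1 * u))))"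
        using set_integrable_mult_right[OF mi[of "p + 2"], of "1 / (norm z)\<^sup>2"] p unfolding set_integrable_def by simp
      fix u :: real
      show "norm (indicator {0<..} u *\<^sub>R (of_real (u powr p * exp (- u)) * csqrt (2 + of_real u / z) - ?t u))
        \<le> indicator {0<..} u *\<^sub>R (1 / (norm z)\<^sup>2 * (u powr (p + 2) * exp (- 1 * u)))"
      proof (cases "u > 0")
        case True
        have "?t u = of_real (u powr p * exp (- u)) * (of_real (sqrt 2) * (1 + of_real u / z / 4))"
          using pw(1)[OF True] z by (simp add: field_simps)
        then have eq2: "of_real (u powr p * exp (- u)) * csqrt (2 + of_real u / z) - ?t u =
           of_real (u powr p * exp (- u)) * (csqrt (2 + of_real u / z) - of_real (sqrt 2) * (1 + of_real u / z / 4))"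
          by (simp only: right_diff_distrib)
        have "norm (of_real (u powr p * exp (- u)) * (csqrt (2 + of_real u / z) - of_real (sqrt 2) * (1 + of_real u / z / 4)))
            \<le> (u powr p * exp (- u)) * (u / norm z)\<^sup>2"
          using csqrt_2_estimates(2)[of "of_real u / z"] True unfolding norm_mult
          by (intro mult_mono) (auto simp: norm_divide norm_mult)
        moreover have "(u powr p * exp (- u)) * (u / norm z)\<^sup>2 = 1 / (norm z)\<^sup>2 * (u powr (p + 2) * exp (- 1 * u))"
          using pw(2)[OF True] by (simp add: power_divide)
        ultimately show ?thesis unfolding eq2 using True by (simp only: indicator_simps greaterThan_iff scaleR_one)
      qed simp
    qed
    moreover have "(LBINT u:{0<..}. 1 / (norm z)\<^sup>2 * (u powr (p + 2) * exp (- 1 * u))) = m (p + 2) / (norm z)\<^sup>2" by (simp add: m_def)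
    ultimately show ?thesis unfolding eq by (simp only:)
  qed
  show ?thesis
  proof (rule that[of "m (p + 1) + m (p + 2)"])
    show "m (p + 1) + m (p + 2) \<ge> 0" using m0 by simp
    show "norm (root_moment p z - of_real (sqrt 2) * Gamma (of_real (p + 1))) \<le> (m (p + 1) + m (p + 2)) / norm z" if "z \<noteq> 0" for z
      by (rule order.trans[OF 1[OF that]], rule divide_right_mono) (use m0 in auto)
    show "norm (root_moment p z - of_real (sqrt 2) * (Gamma (of_real (p + 1)) + Gamma (of_real (p + 2)) / (4 * z))) \<le> (m (p + 1) + m (p + 2)) / (norm z)\<^sup>2" if "z \<noteq> 0" for z
      by (rule order.trans[OF 2[OF that]], rule divide_right_mono) (use m0 in auto)
  qed
qed

text \<open>
  On the positive axis this is the substitution \<open>v = 1 + u / x\<close>, the factor \<open>v\<close> of the second order splitting into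
  two moments. Analytic continuation does the rest.
\<close>
lemma integer_K_root_moment:
  assumes "z \<notin> \<real>\<^sub>\<le>\<^sub>0"
  shows "integer_K 1 z * csqrt z * exp z = root_moment (1/2) z"
    and "integer_K 2 z * csqrt z * exp z = root_moment (1/2) z + root_moment (3/2) z / z"
proof -
  have shift: "(LBINT s:{x<..}. complex_of_real (exp (- s) * \<psi> (s / x))) =
      (LBINT u:{0<..}. complex_of_real (exp (- x) * exp (- u) * \<psi> (1 + u / x)))" if "x > 0" for x \<psi>
  proof -
    have "(LBINT s:{x<..}. complex_of_real (exp (- s) * \<psi> (s / x))) =
      \<bar>1\<bar> *\<^sub>R (\<integral>u. indicator {x<..} (x + 1 * u) *\<^sub>R complex_of_real (exp (- (x + 1 * u)) * \<psi> ((x + 1 * u) / x)) \<partial>lborel)"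
      unfolding set_lebesgue_integral_def by (rule lborel_integral_real_affine) simp
    also have "(\<lambda>u. indicator {x<..} (x + 1 * u) *\<^sub>R complex_of_real (exp (- (x + 1 * u)) * \<psi> ((x + 1 * u) / x))) =
       (\<lambda>u. indicator {0<..} u *\<^sub>R complex_of_real (exp (- x) * exp (- u) * \<psi> (1 + u / x)))"
    proof
      fix u
      have "exp (- (x + 1 * u)) = exp (- x) * exp (- u)" by (simp add: mult_exp_exp)
      moreover have "(x + 1 * u) / x = 1 + u / x" using that by (simp add: add_divide_distrib)
      moreover have "indicator {x<..} (x + 1 * u) = (indicator {0<..} u :: real)" by (simp split: split_indicator)
      ultimately show "indicator {x<..} (x + 1 * u) *\<^sub>R complex_of_real (exp (- (x + 1 * u)) * \<psi> ((x + 1 * u) / x)) =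
         indicator {0<..} u *\<^sub>R complex_of_real (exp (- x) * exp (- u) * \<psi> (1 + u / x))"
        by (simp only:)
    qed
    finally show ?thesis by (simp add: set_lebesgue_integral_def)
  qed
  have rk: "root_kernel (1 + u / x) = u powr (1/2) / sqrt x * sqrt (2 + u / x)" if "x > 0" "u > 0" for x u :: real
  proof -
    have "(1 + u / x)\<^sup>2 - 1 = u / x * (2 + u / x)" by (simp add: power2_eq_square algebra_simps)
    then have "root_kernel (1 + u / x) = sqrt (u / x) * sqrt (2 + u / x)" by (simp only: real_sqrt_mult)
    then show ?thesis using that by (simp add: real_sqrt_divide powr_half_sqrt)
  qed
  have cs: "csqrt (2 + of_real u / of_real x) = of_real (sqrt (2 + u / x))" if "x > 0" "u > 0" for x u :: real
    using of_real_sqrt[of "2 + u / x"] that by simp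
  have R1: "integer_K 1 (of_real x) * csqrt (of_real x) * exp (of_real x) = root_moment (1/2) (of_real x)" if x: "x > 0" for x
  proof -
    have "integer_K 1 (of_real x) = of_real x * laplace_from_1 root_kernel (of_real x)"
      using integer_K_laplace(2)[of "of_real x"] x by simp
    also have "\<dots> = (LBINT u:{0<..}. complex_of_real (exp (- x) * exp (- u) * root_kernel (1 + u / x)))"
      by (rule trans[OF laplace_from_1_rescale[OF x] shift[OF x]])
    also have "\<dots> = (LBINT u:{0<..}. of_real (exp (- x) / sqrt x) * (of_real (u powr (1/2) * exp (- u)) * csqrt (2 + of_real u / of_real x)))"
      by (intro set_lebesgue_integral_cong) (use rk[OF x] cs[OF x] in auto)
    also have "\<dots> = of_real (exp (- x) / sqrt x) * root_moment (1/2) (of_real x)"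
      unfolding root_moment_def by (rule set_integral_mult_right)
    finally have "integer_K 1 (of_real x) = of_real (exp (- x) / sqrt x) * root_moment (1/2) (of_real x)" .
    moreover have "csqrt (of_real x) = of_real (sqrt x)" using x by simp
    ultimately show ?thesis using x by (simp add: exp_of_real[symmetric] exp_minus field_simps)
  qed
  have R2: "integer_K 2 (of_real x) * csqrt (of_real x) * exp (of_real x) = root_moment (1/2) (of_real x) + root_moment (3/2) (of_real x) / of_real x" if x: "x > 0" for x
  proof -
    have Re: "Re (of_real x) > 0" using x by simp
    have "integer_K 2 (of_real x) = of_real x * laplace_from_1 (\<lambda>v. v * root_kernel v) (of_real x)"
      using integer_K_laplace[OF Re] laplace_kernel_relations(2)[OF Re] integer_K_recurrence[of "of_real x" 0] x
      by (simp add: numeral_2_eq_2 field_simps)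
    also have "\<dots> = (LBINT u:{0<..}. complex_of_real (exp (- x) * exp (- u) * ((1 + u / x) * root_kernel (1 + u / x))))"
      by (rule trans[OF laplace_from_1_rescale[OF x] shift[OF x]])
    also have "\<dots> = (LBINT u:{0<..}. of_real (exp (- x) / sqrt x) * (of_real (u powr (1/2) * exp (- u)) * csqrt (2 + of_real u / of_real x) +
        1 / of_real x * (of_real (u powr (3/2) * exp (- u)) * csqrt (2 + of_real u / of_real x))))"
    proof (intro set_lebesgue_integral_cong)
      show "\<forall>u. u \<in> {0<..} \<longrightarrow> complex_of_real (exp (- x) * exp (- u) * ((1 + u / x) * root_kernel (1 + u / x))) =
        of_real (exp (- x) / sqrt x) * (of_real (u powr (1/2) * exp (- u)) * csqrt (2 + of_real u / of_real x) +
        1 / of_real x * (of_real (u powr (3/2) * exp (- u)) * csqrt (2 + of_real u / of_real x)))"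
      proof (intro allI impI)
        fix u :: real assume "u \<in> {0<..}"
        then have u: "u > 0" by simp
        have p: "u powr (3/2) = u * u powr (1/2)" using u powr_add[of u 1 "1/2"] by simp
        have "exp (- x) * exp (- u) * ((1 + u / x) * root_kernel (1 + u / x)) =
          exp (- x) / sqrt x * (u powr (1/2) * exp (- u) * sqrt (2 + u / x) + 1 / x * (u powr (3/2) * exp (- u) * sqrt (2 + u / x)))"
          unfolding rk[OF x u] p by (simp add: algebra_simps add_divide_distrib)
        then show "complex_of_real (exp (- x) * exp (- u) * ((1 + u / x) * root_kernel (1 + u / x))) =
          of_real (exp (- x) / sqrt x) * (of_real (u powr (1/2) * exp (- u)) * csqrt (2 + of_real u / of_real x) +
          1 / of_real x * (of_real (u powr (3/2) * exp (- u)) * csqrt (2 + of_real u / of_real x)))"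
          unfolding cs[OF x u] by (simp only: of_real_mult of_real_add of_real_divide of_real_1)
      qed
    qed simp
    also have "\<dots> = of_real (exp (- x) / sqrt x) * (root_moment (1/2) (of_real x) + 1 / of_real x * root_moment (3/2) (of_real x))"
      unfolding root_moment_def set_integral_mult_right
      using set_integral_add(2)[OF root_moment_integrable[of "1/2" "of_real x"] set_integrable_mult_right[OF root_moment_integrable[of "3/2" "of_real x"], of "1 / of_real x"]] x
      unfolding set_integral_mult_right by simp
    finally have "integer_K 2 (of_real x) = of_real (exp (- x) / sqrt x) * (root_moment (1/2) (of_real x) + 1 / of_real x * root_moment (3/2) (of_real x))" .
    moreover have "csqrt (of_real x) = of_real (sqrt x)" using x by simp
    ultimately show ?thesis using x by (simp add: exp_of_real[symmetric] exp_minus field_simps)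
  qed
  have zS: "z \<in> - \<real>\<^sub>\<le>\<^sub>0" using assms by simp
  have sub: "complex_of_real ` {0<..} \<subseteq> - \<real>\<^sub>\<le>\<^sub>0" by (auto simp: complex_nonpos_Reals_iff)
  have one: "(1::complex) \<in> - \<real>\<^sub>\<le>\<^sub>0" by (simp add: complex_nonpos_Reals_iff)
  have nz: "w \<noteq> 0" if "w \<in> - \<real>\<^sub>\<le>\<^sub>0" for w :: complex using that by auto
  have hol: "(\<lambda>z. integer_K m z * csqrt z * exp z) holomorphic_on - \<real>\<^sub>\<le>\<^sub>0" for m
    by (intro holomorphic_intros integer_K_holomorphic) auto
  have "integer_K 1 z * csqrt z * exp z - root_moment (1/2) z = 0"
  proof (rule analytic_continuation[OF _ slit_plane_facts sub one positive_reals_islimpt_1 _ zS])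
    show "(\<lambda>z. integer_K 1 z * csqrt z * exp z - root_moment (1/2) z) holomorphic_on - \<real>\<^sub>\<le>\<^sub>0"
      by (intro holomorphic_on_diff hol root_moment_holomorphic) simp
    fix w assume "w \<in> complex_of_real ` {0<..}"
    then obtain x where x: "w = of_real x" "x \<in> {0<..}" by (rule imageE)
    then show "integer_K 1 w * csqrt w * exp w - root_moment (1/2) w = 0" using R1[of x] by (metis greaterThan_iff right_minus_eq)
  qed
  then show "integer_K 1 z * csqrt z * exp z = root_moment (1/2) z" by simp
  have "integer_K 2 z * csqrt z * exp z - (root_moment (1/2) z + root_moment (3/2) z / z) = 0"
  proof (rule analytic_continuation[OF _ slit_plane_facts sub one positive_reals_islimpt_1 _ zS])
    show "(\<lambda>z. integer_K 2 z * csqrt z * exp z - (root_moment (1/2) z + root_moment (3/2) z / z)) holomorphic_on - \<real>\<^sub>\<le>\<^sub>0"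
      using nz by (intro holomorphic_on_diff holomorphic_on_add holomorphic_on_divide hol root_moment_holomorphic holomorphic_on_ident) auto
    fix w assume "w \<in> complex_of_real ` {0<..}"
    then obtain x where x: "w = of_real x" "x \<in> {0<..}" by (rule imageE)
    then show "integer_K 2 w * csqrt w * exp w - (root_moment (1/2) w + root_moment (3/2) w / w) = 0" using R2[of x] by (metis greaterThan_iff right_minus_eq)
  qed
  then show "integer_K 2 z * csqrt z * exp z = root_moment (1/2) z + root_moment (3/2) z / z" by simp
qed

text \<open>
  Infinity approached from within the slit plane; estimates along this filter are uniform up to the cut.
\<close>
definition slit_infinity :: "complex filter" where
  "slit_infinity = inf at_infinity (principal (- \<real>\<^sub>\<le>\<^sub>0))"

text \<open>
  The quotient of \<open>K\<close> by its leading asymptotic term \<open>sqrt (\<pi> / (2 z)) exp (- z)\<close>; the constant is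
  \<open>sqrt (\<pi> / 2)\<close> in the form in which the integrals deliver it.
\<close>
definition scaled_K :: "nat \<Rightarrow> complex \<Rightarrow> complex" where
  "scaled_K n z = integer_K n z * csqrt z * exp z / (of_real (sqrt 2) * Gamma (of_real (3/2)))"

text \<open>The first coefficient of Hankel's asymptotic expansion.\<close>
definition K_coeff :: "nat \<Rightarrow> complex" where "K_coeff n = (4 * (of_nat n)\<^sup>2 - 1) / 8"

lemma eventually_slit_infinity:
  "eventually P slit_infinity \<longleftrightarrow> (\<exists>R. \<forall>z. z \<notin> \<real>\<^sub>\<le>\<^sub>0 \<longrightarrow> R \<le> norm z \<longrightarrow> P z)"
  by (auto simp: slit_infinity_def eventually_inf_principal eventually_at_infinity)

lemma slit_infinity_bigoI:
  assumes "\<And>z. z \<notin> \<real>\<^sub>\<le>\<^sub>0 \<Longrightarrow> R \<le> norm z \<Longrightarrow> norm (f z) \<le> C * norm (g z)"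
  shows "f \<in> O[slit_infinity](g)"
  by (rule bigoI[of _ C]) (use assms in \<open>auto simp: eventually_slit_infinity\<close>)

lemma slit_infinity_powers:
  "(\<lambda>z. 1 / z\<^sup>2) \<in> O[slit_infinity](\<lambda>z. 1 / z)" "(\<lambda>z. c / z) \<in> O[slit_infinity](\<lambda>z. 1 / z)"
  "(\<lambda>z. c / z\<^sup>2) \<in> O[slit_infinity](\<lambda>z. 1 / z\<^sup>2)" "(\<lambda>z. c / z) \<in> O[slit_infinity](\<lambda>_. 1)" for c :: complex
proof -
  show "(\<lambda>z::complex. 1 / z\<^sup>2) \<in> O[slit_infinity](\<lambda>z. 1 / z)"
  proof (rule slit_infinity_bigoI[of 1 _ 1])
    fix z :: complex assume "1 \<le> norm z"
    then show "norm (1 / z\<^sup>2) \<le> 1 * norm (1 / z)"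
      by (simp add: norm_divide power2_eq_square norm_mult divide_le_eq mult_le_cancel_right1)
  qed
  show "(\<lambda>z. c / z) \<in> O[slit_infinity](\<lambda>z. 1 / z)" "(\<lambda>z. c / z\<^sup>2) \<in> O[slit_infinity](\<lambda>z. 1 / z\<^sup>2)"
    by (rule slit_infinity_bigoI[of 0 _ "norm c"]; simp add: norm_divide norm_power)+
  show "(\<lambda>z. c / z) \<in> O[slit_infinity](\<lambda>_. 1)"
  proof (rule slit_infinity_bigoI[of 1 _ "norm c"])
    fix z :: complex assume "1 \<le> norm z"
    then show "norm (c / z) \<le> norm c * norm (1::complex)"
      by (simp add: norm_divide divide_le_eq mult_le_cancel_left1)
  qed
qed

text \<open>
  The integrals give the orders one and two. The recurrence, used downwards once and then upwards, gives all
  others: \<open>K_coeff (n + 2) - K_coeff n = 2 (n + 1)\<close> is exactly its contribution of first order.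
\<close>
lemma scaled_K_asymptotics:
  "(\<lambda>z. scaled_K n z - (1 + K_coeff n / z)) \<in> O[slit_infinity](\<lambda>z. 1 / z\<^sup>2)"
proof -
  let ?E = "\<lambda>n z. scaled_K n z - (1 + K_coeff n / z)"
  let ?G = "Gamma (complex_of_real (3/2))" and ?s = "complex_of_real (sqrt 2)"
  have G0: "?G \<noteq> 0" "?s \<noteq> 0" by (auto simp: Gamma_eq_zero_iff)
  have G1: "Gamma (complex_of_real (5/2)) = 3 / 2 * ?G"
  proof -
    have "complex_of_real (3/2) \<notin> \<int>\<^sub>\<le>\<^sub>0" by (auto elim!: nonpos_Ints_cases simp: complex_eq_iff)
    from Gamma_plus1[OF this] show ?thesis by simp
  qed
  have e: "(1/2::real) + 1 = 3/2" "(1/2::real) + 2 = 5/2" "(3/2::real) + 1 = 5/2" by simp_all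
  have p1: "(1/2::real) > -1" and p2: "(3/2::real) > -1" by simp_all
  obtain C1 where C1: "C1 \<ge> 0" "\<And>z. z \<noteq> 0 \<Longrightarrow> norm (root_moment (1/2) z - ?s * (?G + Gamma (of_real (5/2)) / (4 * z))) \<le> C1 / (norm z)\<^sup>2"
    by (rule root_moment_asymptotics[OF p1, unfolded e]) (rule that; assumption)
  obtain C2 where C2: "C2 \<ge> 0" "\<And>z. z \<noteq> 0 \<Longrightarrow> norm (root_moment (3/2) z - ?s * Gamma (of_real (5/2))) \<le> C2 / norm z"
    by (rule root_moment_asymptotics[OF p2, unfolded e]) (rule that; assumption)
  have 1: "?E 1 \<in> O[slit_infinity](\<lambda>z. 1 / z\<^sup>2)"
  proof (rule slit_infinity_bigoI[of 0 _ "C1 / norm (?s * ?G)"])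
    fix z :: complex assume z: "z \<notin> \<real>\<^sub>\<le>\<^sub>0"
    then have z0: "z \<noteq> 0" by auto
    have eq: "?E 1 z = (root_moment (1/2) z - ?s * (?G + Gamma (of_real (5/2)) / (4 * z))) / (?s * ?G)"
      unfolding scaled_K_def integer_K_root_moment(1)[OF z] G1 K_coeff_def using z0 G0 by (simp add: field_simps)
    have "norm (root_moment (1/2) z - ?s * (?G + Gamma (of_real (5/2)) / (4 * z))) / norm (?s * ?G) \<le> C1 / (norm z)\<^sup>2 / norm (?s * ?G)"
      by (intro divide_right_mono C1(2)[OF z0]) auto
    then show "norm (?E 1 z) \<le> C1 / norm (?s * ?G) * norm (1 / z\<^sup>2)"
      unfolding eq norm_divide[of _ "?s * ?G"] by (simp add: norm_divide norm_power mult.commute)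
  qed
  have 2: "?E 2 \<in> O[slit_infinity](\<lambda>z. 1 / z\<^sup>2)"
  proof (rule slit_infinity_bigoI[of 0 _ "(C1 + C2) / norm (?s * ?G)"])
    fix z :: complex assume z: "z \<notin> \<real>\<^sub>\<le>\<^sub>0"
    then have z0: "z \<noteq> 0" by auto
    have eq: "?E 2 z = ((root_moment (1/2) z - ?s * (?G + Gamma (of_real (5/2)) / (4 * z))) +
        (root_moment (3/2) z - ?s * Gamma (of_real (5/2))) / z) / (?s * ?G)"
      unfolding scaled_K_def integer_K_root_moment(2)[OF z] G1 K_coeff_def using z0 G0 by (simp add: field_simps)
    have "norm ((root_moment (3/2) z - ?s * Gamma (of_real (5/2))) / z) \<le> C2 / norm z / norm z"
      unfolding norm_divide using C2(2)[OF z0] by (intro divide_right_mono) auto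
    then have "norm ((root_moment (1/2) z - ?s * (?G + Gamma (of_real (5/2)) / (4 * z))) +
        (root_moment (3/2) z - ?s * Gamma (of_real (5/2))) / z) \<le> C1 / (norm z)\<^sup>2 + C2 / norm z / norm z"
      by (intro order.trans[OF norm_triangle_ineq] add_mono C1(2)[OF z0])
    then have "norm ((root_moment (1/2) z - ?s * (?G + Gamma (of_real (5/2)) / (4 * z))) +
        (root_moment (3/2) z - ?s * Gamma (of_real (5/2))) / z) / norm (?s * ?G) \<le> (C1 + C2) / (norm z)\<^sup>2 / norm (?s * ?G)"
      by (intro divide_right_mono) (auto simp: add_divide_distrib power2_eq_square)
    then show "norm (?E 2 z) \<le> (C1 + C2) / norm (?s * ?G) * norm (1 / z\<^sup>2)"
      unfolding eq norm_divide[of _ "?s * ?G"] by (simp add: norm_divide norm_power mult.commute)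
  qed
  have rec: "?E (m + 2) z = ?E m z + (2 * of_nat (m + 1) / z * ?E (m + 1) z + 2 * of_nat (m + 1) * K_coeff (m + 1) / z\<^sup>2)"
    if "z \<noteq> 0" for m z
  proof -
    have a: "K_coeff (m + 2) = K_coeff m + 2 * of_nat (m + 1)"
      unfolding K_coeff_def by (simp add: field_simps power2_eq_square)
    have "scaled_K (m + 2) z = scaled_K m z + 2 * of_nat (m + 1) / z * scaled_K (m + 1) z"
      unfolding scaled_K_def integer_K_recurrence[OF that] by (simp add: ring_distribs add_divide_distrib mult.assoc)
    moreover have "S + c / z * T - (1 + (k + c) / z) = S - (1 + k / z) + (c / z * (T - (1 + j / z)) + c * j / z\<^sup>2)" for S T c k j
      using that by (simp add: field_simps power2_eq_square)
    ultimately show ?thesis unfolding a by metis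
  qed
  have rec_bigo: "(\<lambda>z. 2 * of_nat (m + 1) / z * ?E (m + 1) z + 2 * of_nat (m + 1) * K_coeff (m + 1) / z\<^sup>2) \<in> O[slit_infinity](\<lambda>z. 1 / z\<^sup>2)"
    if "?E (m + 1) \<in> O[slit_infinity](\<lambda>z. 1 / z\<^sup>2)" for m
  proof (intro sum_in_bigo)
    show "(\<lambda>z. 2 * of_nat (m + 1) / z * ?E (m + 1) z) \<in> O[slit_infinity](\<lambda>z. 1 / z\<^sup>2)"
      using landau_o.big.mult[OF slit_infinity_powers(4)[of "2 * of_nat (m + 1)"] that] by simp
    show "(\<lambda>z. 2 * of_nat (m + 1) * K_coeff (m + 1) / z\<^sup>2) \<in> O[slit_infinity](\<lambda>z. 1 / z\<^sup>2)"
      by (rule slit_infinity_powers(3))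
  qed
  have ev0: "eventually (\<lambda>z. z \<noteq> 0) slit_infinity" by (auto simp: eventually_slit_infinity)
  have base: "?E 0 \<in> O[slit_infinity](\<lambda>z. 1 / z\<^sup>2)"
  proof -
    define Y where "Y = (\<lambda>z. 2 * of_nat (0 + 1) / z * ?E (0 + 1) z + 2 * of_nat (0 + 1) * K_coeff (0 + 1) / z\<^sup>2)"
    have "Y \<in> O[slit_infinity](\<lambda>z. 1 / z\<^sup>2)" unfolding Y_def using 1 by (intro rec_bigo) simp
    then have "(\<lambda>z. ?E 2 z - Y z) \<in> O[slit_infinity](\<lambda>z. 1 / z\<^sup>2)" by (rule sum_in_bigo(2)[OF 2])
    moreover have "?E 2 z - Y z = ?E 0 z" if "z \<noteq> 0" for z
    proof -
      have "?E 2 z = ?E 0 z + Y z" using rec[OF that, of 0] unfolding Y_def by (simp only: add_0_left)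
      then show ?thesis by (simp only: add_diff_cancel_right')
    qed
    then have "eventually (\<lambda>z. ?E 2 z - Y z = ?E 0 z) slit_infinity"
      using ev0 by (rule eventually_mono[rotated])
    ultimately show ?thesis by (rule landau_o.big.in_cong[THEN iffD1, rotated])
  qed
  have "?E n \<in> O[slit_infinity](\<lambda>z. 1 / z\<^sup>2) \<and> ?E (n + 1) \<in> O[slit_infinity](\<lambda>z. 1 / z\<^sup>2)"
  proof (induction n)
    case 0
    show ?case using base 1 by simp
  next
    case (Suc n)
    have "(\<lambda>z. ?E n z + (2 * of_nat (n + 1) / z * ?E (n + 1) z + 2 * of_nat (n + 1) * K_coeff (n + 1) / z\<^sup>2)) \<in> O[slit_infinity](\<lambda>z. 1 / z\<^sup>2)"
      using Suc by (intro sum_in_bigo(1) rec_bigo) auto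
    moreover have "eventually (\<lambda>z. ?E n z + (2 * of_nat (n + 1) / z * ?E (n + 1) z + 2 * of_nat (n + 1) * K_coeff (n + 1) / z\<^sup>2) = ?E (n + 2) z) slit_infinity"
      using ev0 by eventually_elim (use rec in metis)
    ultimately have "?E (n + 2) \<in> O[slit_infinity](\<lambda>z. 1 / z\<^sup>2)" by (rule landau_o.big.in_cong[THEN iffD1, rotated])
    then show ?case using Suc by (simp del: of_nat_Suc)
  qed
  then show ?thesis ..
qed

text \<open>
  Off the cut this is \<open>z + 1 / 2 + z K' / K\<close>, a normalised symbol of the Dirichlet-to-Neumann map of the exterior
  wave equation. Replacing the derivative by the next order gives it a meaning on the cut as well, namely as the limit
  from above, whereas \<open>K\<close> is not differentiable there.
\<close>
definition dirichlet_to_neumann :: "nat \<Rightarrow> complex \<Rightarrow> complex" where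
  "dirichlet_to_neumann n z = z + 1 / 2 + of_nat n - z * integer_K (n + 1) z / integer_K n z"

text \<open>
  The terms of order \<open>z\<close> and of order one cancel because \<open>K_coeff (n + 1) - K_coeff n = n + 1 / 2\<close>.
\<close>
lemma dirichlet_to_neumann_decay_slit:
  "\<exists>R C. \<forall>z. z \<notin> \<real>\<^sub>\<le>\<^sub>0 \<longrightarrow> R \<le> norm z \<longrightarrow> integer_K n z \<noteq> 0 \<and> norm (dirichlet_to_neumann n z) \<le> C / norm z"
proof -
  define E where "E = (\<lambda>n z. scaled_K n z - (1 + K_coeff n / z))"
  have E: "E m \<in> O[slit_infinity](\<lambda>z. 1 / z\<^sup>2)" for m
    using scaled_K_asymptotics[of m] by (simp add: E_def)
  have lim: "((\<lambda>z. 1 / z) \<longlongrightarrow> (0::complex)) slit_infinity"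
    unfolding slit_infinity_def using tendsto_mono[OF inf_le1 tendsto_inverse_0] by (simp add: divide_inverse)
  have "((\<lambda>z. scaled_K n z) \<longlongrightarrow> 1) slit_infinity"
  proof -
    have "E n \<in> O[slit_infinity](\<lambda>z. 1 / z)" using E slit_infinity_powers(1) by (rule landau_o.big_trans)
    then have "(E n \<longlongrightarrow> 0) slit_infinity"
    proof -
      have "(\<lambda>z. 1 / z) \<in> o[slit_infinity](\<lambda>_. 1 :: complex)"
        by (rule smalloI_tendsto) (use lim in auto)
      with \<open>E n \<in> O[slit_infinity](\<lambda>z. 1 / z)\<close> have "E n \<in> o[slit_infinity](\<lambda>_. 1 :: complex)"
        by (rule landau_o.big_small_trans)
      from smalloD_tendsto[OF this] show ?thesis by simp
    qed
    then have "((\<lambda>z. E n z + (1 + K_coeff n * (1 / z))) \<longlongrightarrow> 0 + (1 + K_coeff n * 0)) slit_infinity"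
      by (intro tendsto_intros lim)
    then show ?thesis by (simp add: E_def)
  qed
  then have ev1: "eventually (\<lambda>z. dist (scaled_K n z) 1 < 1/2) slit_infinity" by (rule tendstoD) simp
  then have ev2: "eventually (\<lambda>z. norm (scaled_K n z) \<ge> 1/2) slit_infinity"
  proof eventually_elim
    case (elim z)
    then show ?case using norm_triangle_ineq2[of 1 "1 - scaled_K n z"] by (simp add: dist_norm norm_minus_commute)
  qed
  define N where "N = (\<lambda>z. (z + 1 / 2 + of_nat n) * scaled_K n z - z * scaled_K (n + 1) z)"
  have ev0: "eventually (\<lambda>z. z \<noteq> 0) slit_infinity" by (auto simp: eventually_slit_infinity)
  have zE: "(\<lambda>z. z * E m z) \<in> O[slit_infinity](\<lambda>z. 1 / z)" for m
  proof -
    have "(\<lambda>z. z * E m z) \<in> O[slit_infinity](\<lambda>z. z * (1 / z\<^sup>2))" by (intro landau_o.big.mult_left E)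
    moreover have "(\<lambda>z::complex. z * (1 / z\<^sup>2)) = (\<lambda>z. 1 / z)"
    proof
      show "z * (1 / z\<^sup>2) = 1 / z" for z :: complex by (cases "z = 0") (auto simp: power2_eq_square)
    qed
    ultimately show ?thesis by simp
  qed
  have "(\<lambda>z. z * E n z + (1 / 2 + of_nat n) * E n z - z * E (n + 1) z + ((1 / 2 + of_nat n) * K_coeff n) / z) \<in> O[slit_infinity](\<lambda>z. 1 / z)"
  proof (intro sum_in_bigo zE slit_infinity_powers(2))
    have "E n \<in> O[slit_infinity](\<lambda>z. 1 / z)" using E slit_infinity_powers(1) by (rule landau_o.big_trans)
    then show "(\<lambda>z. (1 / 2 + of_nat n) * E n z) \<in> O[slit_infinity](\<lambda>z. 1 / z)" by simp
  qed
  moreover have "eventually (\<lambda>z. z * E n z + (1 / 2 + of_nat n) * E n z - z * E (n + 1) z + ((1 / 2 + of_nat n) * K_coeff n) / z = N z) slit_infinity"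
    using ev0
  proof eventually_elim
    case (elim z)
    have a: "K_coeff (n + 1) = K_coeff n + of_nat n + 1 / 2"
      unfolding K_coeff_def by (simp add: field_simps power2_eq_square)
    have "z * (S - (1 + k / z)) + (1/2 + m) * (S - (1 + k / z)) - z * (T - (1 + (k + m + 1/2) / z)) + ((1/2 + m) * k) / z
      = (z + 1/2 + m) * S - z * T" for S T k m using elim by (simp add: field_simps)
    then show ?case unfolding E_def N_def a by (simp only:)
  qed
  ultimately have "N \<in> O[slit_infinity](\<lambda>z. 1 / z)" by (rule landau_o.big.in_cong[THEN iffD1, rotated])
  then obtain c where "eventually (\<lambda>z. norm (N z) \<le> c * norm (1 / z)) slit_infinity" by (rule landau_o.bigE)
  with ev2 ev0 have "eventually (\<lambda>z. integer_K n z \<noteq> 0 \<and> norm (dirichlet_to_neumann n z) \<le> 2 * c / norm z) slit_infinity"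
  proof eventually_elim
    case (elim z)
    define \<kappa> where "\<kappa> = csqrt z * exp z / (of_real (sqrt 2) * Gamma (of_real (3/2)))"
    have sc: "scaled_K m z = integer_K m z * \<kappa>" for m by (simp add: scaled_K_def \<kappa>_def)
    have nz: "integer_K n z \<noteq> 0" "\<kappa> \<noteq> 0" using elim(1) by (auto simp: sc)
    have "dirichlet_to_neumann n z = N z / scaled_K n z"
      unfolding dirichlet_to_neumann_def N_def sc using nz by (simp add: field_simps)
    then have "norm (dirichlet_to_neumann n z) * norm (scaled_K n z) = norm (N z)"
      using nz by (simp add: norm_divide sc)
    moreover have "norm (dirichlet_to_neumann n z) * (1/2) \<le> norm (dirichlet_to_neumann n z) * norm (scaled_K n z)"
      using elim(1) by (intro mult_left_mono) auto
    ultimately show ?case using elim(3) nz by (simp add: norm_divide)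
  qed
  then show ?thesis unfolding eventually_slit_infinity by blast
qed

section \<open>Bromwich integrals\<close>

lemma segment_re_im_bounds:
  assumes "z \<in> closed_segment a b"
  shows "Re z \<le> max (Re a) (Re b)" "min (Re a) (Re b) \<le> Re z" "Im z \<le> max (Im a) (Im b)" "min (Im a) (Im b) \<le> Im z"
proof -
  have "Re z \<in> closed_segment (Re a) (Re b)" "Im z \<in> closed_segment (Im a) (Im b)"
    using assms by (auto simp: closed_segment_def)
  then show "Re z \<le> max (Re a) (Re b)" "min (Re a) (Re b) \<le> Re z" "Im z \<le> max (Im a) (Im b)" "min (Im a) (Im b) \<le> Im z"
    by (auto simp: closed_segment_eq_real_ivl split: if_splits)
qed

lemma contour_integral_side_tendsto_0:
  fixes A B :: "real \<Rightarrow> complex" and m l M :: "real \<Rightarrow> real"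
  assumes cont: "continuous_on D f"
    and bd: "\<And>z. z \<in> D \<Longrightarrow> norm (f z) \<le> C / norm z * exp (\<tau> * Re z)"
    and C: "C \<ge> 0" and \<tau>: "\<tau> > 0"
    and seg: "eventually (\<lambda>T. closed_segment (A T) (B T) \<subseteq> D \<and> m T > 0 \<and> norm (B T - A T) \<le> l T \<and>
        (\<forall>z\<in>closed_segment (A T) (B T). Re z \<le> M T \<and> m T \<le> norm z)) at_top"
    and lim: "((\<lambda>T. C / m T * exp (\<tau> * M T) * l T) \<longlongrightarrow> 0) at_top"
  shows "((\<lambda>T. contour_integral (linepath (A T) (B T)) f) \<longlongrightarrow> 0) at_top"
proof (rule Lim_null_comparison[OF _ lim])
  show "eventually (\<lambda>T. norm (contour_integral (linepath (A T) (B T)) f) \<le> C / m T * exp (\<tau> * M T) * l T) at_top"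
    using seg
  proof eventually_elim
    case (elim T)
    have "norm (contour_integral (linepath (A T) (B T)) f) \<le> (C / m T * exp (\<tau> * M T)) * norm (B T - A T)"
    proof (rule contour_integral_bound_linepath)
      show "f contour_integrable_on linepath (A T) (B T)"
        using elim by (intro contour_integrable_continuous_linepath continuous_on_subset[OF cont]) auto
      show "0 \<le> C / m T * exp (\<tau> * M T)" using C elim by simp
      fix z assume z: "z \<in> closed_segment (A T) (B T)"
      have "norm (f z) \<le> C / norm z * exp (\<tau> * Re z)" using z elim by (intro bd) auto
      also have "\<dots> \<le> C / m T * exp (\<tau> * M T)"
      proof (rule mult_mono)
        have "m T \<le> norm z" using elim z by blast
        then show "C / norm z \<le> C / m T" using C elim by (intro divide_left_mono mult_pos_pos) linarith+
        show "exp (\<tau> * Re z) \<le> exp (\<tau> * M T)" using elim z \<tau> by (auto intro!: mult_left_mono)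
      qed (use C elim in auto)
      finally show "norm (f z) \<le> C / m T * exp (\<tau> * M T)" .
    qed
    also have "\<dots> \<le> C / m T * exp (\<tau> * M T) * l T" using C elim by (intro mult_left_mono) auto
    finally show ?case .
  qed
qed

text \<open>
  The rectangles have height \<open>T\<close> but width only of order \<open>sqrt T\<close>. On the horizontal sides the decay
  of order \<open>1 / T\<close> then beats the length, and on the left side the exponential does. The sign \<open>s\<close> selects the upper
  or the lower side.
\<close>
lemma horizontal_side_tendsto_0:
  fixes s :: real
  assumes cont: "continuous_on {z. R \<le> norm z \<and> 0 \<le> s * Im z} f"
    and bd: "\<And>z. R \<le> norm z \<Longrightarrow> 0 \<le> s * Im z \<Longrightarrow> norm (f z) \<le> C / norm z * exp (\<tau> * Re z)"
    and C: "C \<ge> 0" and \<tau>: "\<tau> > 0" and s: "s = 1 \<or> s = -1"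
  shows "((\<lambda>T. contour_integral (linepath (Complex (- sqrt T) (s * T)) (Complex \<gamma> (s * T))) f) \<longlongrightarrow> 0) at_top"
proof (rule contour_integral_side_tendsto_0[OF cont _ C \<tau>, where m="\<lambda>T. T" and M="\<lambda>_. \<bar>\<gamma>\<bar>" and l="\<lambda>T. \<bar>\<gamma>\<bar> + sqrt T"])
  show "eventually (\<lambda>T. closed_segment (Complex (- sqrt T) (s * T)) (Complex \<gamma> (s * T)) \<subseteq> {z. R \<le> norm z \<and> 0 \<le> s * Im z} \<and> 0 < T \<and>
      norm (Complex \<gamma> (s * T) - Complex (- sqrt T) (s * T)) \<le> \<bar>\<gamma>\<bar> + sqrt T \<and>
      (\<forall>z\<in>closed_segment (Complex (- sqrt T) (s * T)) (Complex \<gamma> (s * T)). Re z \<le> \<bar>\<gamma>\<bar> \<and> T \<le> norm z)) at_top"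
    using eventually_gt_at_top[of "max 0 R"]
  proof eventually_elim
    case (elim T)
    have *: "Im z = s * T" "Re z \<le> \<bar>\<gamma>\<bar>" "T \<le> norm z" "R \<le> norm z" "0 \<le> s * Im z"
      if "z \<in> closed_segment (Complex (- sqrt T) (s * T)) (Complex \<gamma> (s * T))" for z
    proof -
      show 1: "Im z = s * T" using segment_re_im_bounds(3,4)[OF that] by simp
      have "Re z \<le> max (- sqrt T) \<gamma>" using segment_re_im_bounds(1)[OF that] by simp
      also have "\<dots> \<le> \<bar>\<gamma>\<bar>"
      proof (rule max.boundedI)
        have "0 \<le> sqrt T" using elim by simp
        then show "- sqrt T \<le> \<bar>\<gamma>\<bar>" using abs_ge_zero[of \<gamma>] by linarith
      qed simp
      finally show "Re z \<le> \<bar>\<gamma>\<bar>" .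
      show "0 \<le> s * Im z" using 1 s elim by auto
      have "\<bar>Im z\<bar> = T" using 1 s elim by auto
      then show "T \<le> norm z" using abs_Im_le_cmod[of z] by simp
      then show "R \<le> norm z" using elim by simp
    qed
    have "norm (Complex \<gamma> (s * T) - Complex (- sqrt T) (s * T)) = \<bar>\<gamma> + sqrt T\<bar>"
      by (simp add: cmod_def)
    also have "\<dots> \<le> \<bar>\<gamma>\<bar> + sqrt T" using elim abs_triangle_ineq[of \<gamma> "sqrt T"] by simp
    finally show ?case using * elim by auto
  qed
  show "((\<lambda>T. C / T * exp (\<tau> * \<bar>\<gamma>\<bar>) * (\<bar>\<gamma>\<bar> + sqrt T)) \<longlongrightarrow> 0) at_top"
    by real_asymp
qed (use bd in auto)

text \<open>
  With \<open>s = 1\<close> the estimate is asked for in the upper half-plane only, with \<open>s = 0\<close> everywhere; \<open>k1\<close> and \<open>k2\<close> mark the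
  part of the left side that is traversed.
\<close>
lemma left_side_tendsto_0:
  fixes s k1 k2 :: real
  assumes cont: "continuous_on {z. R \<le> norm z \<and> s * Im z \<ge> 0} f"
    and bd: "\<And>z. R \<le> norm z \<Longrightarrow> s * Im z \<ge> 0 \<Longrightarrow> norm (f z) \<le> C / norm z * exp (\<tau> * Re z)"
    and C: "C \<ge> 0" and \<tau>: "\<tau> > 0" and k: "\<bar>k1\<bar> \<le> 1" "\<bar>k2\<bar> \<le> 1" "s * k1 \<ge> 0" "s * k2 \<ge> 0"
  shows "((\<lambda>T. contour_integral (linepath (Complex (- sqrt T) (k1 * T)) (Complex (- sqrt T) (k2 * T))) f) \<longlongrightarrow> 0) at_top"
proof (rule contour_integral_side_tendsto_0[OF cont _ C \<tau>, where m="\<lambda>T. sqrt T" and M="\<lambda>T. - sqrt T" and l="\<lambda>T. 2 * T"])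
  show "eventually (\<lambda>T. closed_segment (Complex (- sqrt T) (k1 * T)) (Complex (- sqrt T) (k2 * T)) \<subseteq> {z. R \<le> norm z \<and> s * Im z \<ge> 0} \<and> 0 < sqrt T \<and>
      norm (Complex (- sqrt T) (k2 * T) - Complex (- sqrt T) (k1 * T)) \<le> 2 * T \<and>
      (\<forall>z\<in>closed_segment (Complex (- sqrt T) (k1 * T)) (Complex (- sqrt T) (k2 * T)). Re z \<le> - sqrt T \<and> sqrt T \<le> norm z)) at_top"
    using eventually_gt_at_top[of "max 0 (R\<^sup>2)"]
  proof eventually_elim
    case (elim T)
    then have "R\<^sup>2 < T" by simp
    then have T: "T > 0" "R \<le> sqrt T" using le_less_trans[OF zero_le_power2[of R]] by (auto intro: real_le_rsqrt)
    have *: "Re z \<le> - sqrt T" "sqrt T \<le> norm z" "R \<le> norm z" "s * Im z \<ge> 0"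
      if zs: "z \<in> closed_segment (Complex (- sqrt T) (k1 * T)) (Complex (- sqrt T) (k2 * T))" for z
    proof -
      have 1: "Re z = - sqrt T" using segment_re_im_bounds(1,2)[OF zs] by simp
      then show "Re z \<le> - sqrt T" by simp
      show 2: "sqrt T \<le> norm z" using abs_Re_le_cmod[of z] 1 T by simp
      show "R \<le> norm z" using 2 T by simp
      obtain u where u: "0 \<le> u" "u \<le> 1" "Im z = (1 - u) * (k1 * T) + u * (k2 * T)"
      proof -
        from zs obtain u where "0 \<le> u" "u \<le> 1" "z = (1 - u) *\<^sub>R Complex (- sqrt T) (k1 * T) + u *\<^sub>R Complex (- sqrt T) (k2 * T)"
          unfolding closed_segment_def by blast
        then show ?thesis using that[of u] by simp
      qed
      have "s * Im z = (1 - u) * (s * k1) * T + u * (s * k2) * T" unfolding u(3) by (simp add: algebra_simps)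
      also have "\<dots> \<ge> 0"
        using mult_nonneg_nonneg[OF mult_nonneg_nonneg[OF _ k(3)], of "1 - u" T] mult_nonneg_nonneg[OF mult_nonneg_nonneg[OF _ k(4)], of u T] u T by simp
      finally show "s * Im z \<ge> 0" .
    qed
    have "norm (Complex (- sqrt T) (k2 * T) - Complex (- sqrt T) (k1 * T)) = \<bar>k2 * T - k1 * T\<bar>"
      by (simp add: cmod_def)
    also have "\<dots> = \<bar>k2 - k1\<bar> * T" using T by (simp add: abs_mult flip: left_diff_distrib)
    also have "\<dots> \<le> 2 * T" using k T by (intro mult_right_mono) linarith+
    finally show ?case using * T by auto
  qed
  show "((\<lambda>T. C / sqrt T * exp (\<tau> * - sqrt T) * (2 * T)) \<longlongrightarrow> 0) at_top"
    using \<tau> by real_asymp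
qed (use bd in auto)

text \<open>
  Cauchy's formula on a rectangle around the pole, three sides of which contribute nothing in the limit.
\<close>
lemma bromwich_simple_pole:
  assumes \<tau>: "\<tau> > 0" and a: "Re a < \<gamma>"
  shows "((\<lambda>T. contour_integral (linepath (Complex \<gamma> (- T)) (Complex \<gamma> T)) (\<lambda>z. exp (of_real \<tau> * z) / (z - a)))
      \<longlongrightarrow> 2 * of_real pi * \<i> * exp (of_real \<tau> * a)) at_top"
proof -
  let ?f = "\<lambda>z. exp (of_real \<tau> * z) / (z - a)"
  define R where "R = 2 * norm a + 1"
  have lower: "norm (z - a) \<ge> norm z / 2" "z \<noteq> a" if "R \<le> norm z" for z
  proof -
    show "norm (z - a) \<ge> norm z / 2" using that norm_triangle_ineq2[of z a] by (simp add: R_def)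
    show "z \<noteq> a" using that norm_ge_zero[of a] by (auto simp: R_def simp del: norm_ge_zero)
  qed
  have bd: "norm (?f z) \<le> 2 / norm z * exp (\<tau> * Re z)" if "R \<le> norm z" for z
  proof -
    have zp: "norm z > 0" using that norm_ge_zero[of a] unfolding R_def by linarith
    have "norm (?f z) = exp (\<tau> * Re z) / norm (z - a)" by (simp add: norm_divide norm_exp_eq_Re)
    also have "\<dots> \<le> exp (\<tau> * Re z) / (norm z / 2)"
      using lower(1)[OF that] zp by (intro divide_left_mono mult_pos_pos exp_ge_zero) linarith+
    finally show ?thesis by (simp add: field_simps)
  qed
  have cont: "continuous_on {z. R \<le> norm z \<and> P z} ?f" for P
    by (intro continuous_intros) (use lower(2) in auto)
  have top: "((\<lambda>T. contour_integral (linepath (Complex (- sqrt T) (1 * T)) (Complex \<gamma> (1 * T))) ?f) \<longlongrightarrow> 0) at_top"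
    by (rule horizontal_side_tendsto_0[where R=R and s=1, OF cont bd]) (use \<tau> in auto)
  have bot: "((\<lambda>T. contour_integral (linepath (Complex (- sqrt T) (- 1 * T)) (Complex \<gamma> (- 1 * T))) ?f) \<longlongrightarrow> 0) at_top"
    by (rule horizontal_side_tendsto_0[where R=R and s="-1", OF cont bd]) (use \<tau> in auto)
  have left: "((\<lambda>T. contour_integral (linepath (Complex (- sqrt T) (1 * T)) (Complex (- sqrt T) (- 1 * T))) ?f) \<longlongrightarrow> 0) at_top"
    by (rule left_side_tendsto_0[where R=R and s=0, OF cont bd]) (use \<tau> in auto)
  have "((\<lambda>T. 2 * of_real pi * \<i> * exp (of_real \<tau> * a)
      - contour_integral (linepath (Complex (- sqrt T) (- 1 * T)) (Complex \<gamma> (- 1 * T))) ?f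
      + contour_integral (linepath (Complex (- sqrt T) (1 * T)) (Complex \<gamma> (1 * T))) ?f
      - contour_integral (linepath (Complex (- sqrt T) (1 * T)) (Complex (- sqrt T) (- 1 * T))) ?f) \<longlongrightarrow>
      2 * of_real pi * \<i> * exp (of_real \<tau> * a) - 0 + 0 - 0) at_top"
    by (intro tendsto_intros top bot left)
  then have "((\<lambda>T. 2 * of_real pi * \<i> * exp (of_real \<tau> * a)
      - contour_integral (linepath (Complex (- sqrt T) (- 1 * T)) (Complex \<gamma> (- 1 * T))) ?f
      + contour_integral (linepath (Complex (- sqrt T) (1 * T)) (Complex \<gamma> (1 * T))) ?f
      - contour_integral (linepath (Complex (- sqrt T) (1 * T)) (Complex (- sqrt T) (- 1 * T))) ?f) \<longlongrightarrow>
      2 * of_real pi * \<i> * exp (of_real \<tau> * a)) at_top" by simp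
  then show ?thesis
  proof (rule Lim_transform_eventually)
    show "eventually (\<lambda>T. 2 * of_real pi * \<i> * exp (of_real \<tau> * a)
      - contour_integral (linepath (Complex (- sqrt T) (- 1 * T)) (Complex \<gamma> (- 1 * T))) ?f
      + contour_integral (linepath (Complex (- sqrt T) (1 * T)) (Complex \<gamma> (1 * T))) ?f
      - contour_integral (linepath (Complex (- sqrt T) (1 * T)) (Complex (- sqrt T) (- 1 * T))) ?f =
      contour_integral (linepath (Complex \<gamma> (- T)) (Complex \<gamma> T)) ?f) at_top"
      using eventually_gt_at_top[of "max (\<bar>Im a\<bar>) (max 0 ((Re a)\<^sup>2))"]
    proof eventually_elim
      case (elim T)
      have "sqrt ((Re a)\<^sup>2) < sqrt T" using elim by (intro real_sqrt_less_mono) simp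
      then have s: "- sqrt T < Re a" by simp
      define a1 a2 a3 a4 where "a1 = Complex (- sqrt T) (- T)" and "a2 = Complex \<gamma> (- T)"
        and "a3 = Complex \<gamma> T" and "a4 = Complex (- sqrt T) T"
      have box: "a \<in> box a1 a3" using elim s a by (auto simp: in_box_complex_iff a1_def a3_def)
      have pi1: "a \<notin> path_image (rectpath a1 a3)"
        using box path_image_rectpath_cbox_minus_box[of a1 a3] elim s a by (auto simp: a1_def a3_def)
      have "(?f has_contour_integral (2 * pi * \<i> * winding_number (rectpath a1 a3) a * exp (of_real \<tau> * a))) (rectpath a1 a3)"
        by (rule Cauchy_integral_formula_convex_simple[where S=UNIV]) (use pi1 in \<open>auto intro!: holomorphic_intros\<close>)
      then have I: "(?f has_contour_integral (2 * pi * \<i> * exp (of_real \<tau> * a))) (rectpath a1 a3)"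
        using winding_number_rectpath[OF box] by simp
      have rp: "rectpath a1 a3 = linepath a1 a2 +++ linepath a2 a3 +++ linepath a3 a4 +++ linepath a4 a1"
        by (simp add: rectpath_def Let_def a1_def a2_def a3_def a4_def)
      have pim: "path_image (rectpath a1 a3) = closed_segment a1 a2 \<union> closed_segment a2 a3 \<union> closed_segment a3 a4 \<union> closed_segment a4 a1"
        unfolding rp by (simp add: path_image_join Un_assoc)
      have c: "continuous_on (closed_segment x y) ?f" if "closed_segment x y \<subseteq> path_image (rectpath a1 a3)" for x y
        by (intro continuous_intros) (use pi1 that in auto)
      have c4: "continuous_on (closed_segment a1 a2) ?f" "continuous_on (closed_segment a2 a3) ?f"
         "continuous_on (closed_segment a3 a4) ?f" "continuous_on (closed_segment a4 a1) ?f"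
        by (rule c; use pim in blast)+
      have "contour_integral (rectpath a1 a3) ?f = contour_integral (linepath a1 a2) ?f + (contour_integral (linepath a2 a3) ?f +
          (contour_integral (linepath a3 a4) ?f + contour_integral (linepath a4 a1) ?f))"
        unfolding rp using c4[THEN contour_integrable_continuous_linepath]
        by (simp add: contour_integrable_join)
      moreover have "contour_integral (linepath a3 a4) ?f = - contour_integral (linepath a4 a3) ?f"
        by (rule contour_integral_reverse_linepath[OF c4(3)])
      ultimately show ?case using contour_integral_unique[OF I] by (simp add: a1_def a2_def a3_def a4_def algebra_simps)
    qed
  qed
qed

text \<open>
  Closing the contour separately in the two half-planes keeps it on the real axis, where the function
  is continuous up to the cut from above, as Cauchy's theorem asks for on the boundary. The contributions of
  the positive axis cancel and the negative axis leaves the jump across the cut.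
\<close>
lemma bromwich_cut:
  assumes \<tau>: "\<tau> > 0" and \<gamma>: "\<gamma> > 0"
    and hol: "q holomorphic_on (- \<real>\<^sub>\<le>\<^sub>0)"
    and cont: "continuous_on {z. Im z \<ge> 0} q"
    and bd: "\<And>z. Im z \<ge> 0 \<Longrightarrow> R \<le> norm z \<Longrightarrow> norm (q z) \<le> C / norm z"
    and C: "C \<ge> 0"
    and sym: "\<And>z. z \<notin> \<real>\<^sub>\<le>\<^sub>0 \<Longrightarrow> q (cnj z) = cnj (q z)"
  shows "set_integrable lborel {0..} (\<lambda>r. Im (q (- of_real r)) * exp (- \<tau> * r))"
    and "((\<lambda>T. contour_integral (linepath (Complex \<gamma> (- T)) (Complex \<gamma> T)) (\<lambda>z. q z * exp (of_real \<tau> * z)))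
      \<longlongrightarrow> - (2 * \<i> * of_real (LBINT r:{0..}. Im (q (- of_real r)) * exp (- \<tau> * r)))) at_top"
proof -
  let ?f = "\<lambda>z. q z * exp (of_real \<tau> * z)"
  let ?w = "\<lambda>r. Im (q (- of_real r)) * exp (- \<tau> * r)"
  have contf: "continuous_on {z. Im z \<ge> 0} ?f" by (intro continuous_intros cont)
  have cq: "continuous_on {0..} (\<lambda>r::real. q (- of_real r))"
    by (rule continuous_on_compose2[OF cont]) (auto intro!: continuous_intros)
  have contw: "continuous_on {0..} ?w" by (intro continuous_intros cq)
  obtain B where B: "\<And>r. r \<ge> 0 \<Longrightarrow> norm (q (- of_real r)) \<le> B"
  proof -
    have "compact ((\<lambda>r::real. q (- of_real r)) ` {0..max R 1})"
      by (intro compact_continuous_image continuous_on_subset[OF cq]) auto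
    then obtain B1 where B1: "\<And>r. r \<in> {0..max R 1} \<Longrightarrow> norm (q (- of_real r)) \<le> B1"
      by (metis bounded_iff compact_imp_bounded imageI)
    have "norm (q (- of_real r)) \<le> max B1 C" if "r \<ge> 0" for r
    proof (cases "r \<le> max R 1")
      case True
      then show ?thesis using B1[of r] that by simp
    next
      case False
      then have "norm (q (- of_real r)) \<le> C / r" using bd[of "- of_real r"] that by simp
      also have "\<dots> \<le> C / 1" using False C by (intro divide_left_mono) auto
      finally show ?thesis by simp
    qed
    then show ?thesis using that by blast
  qed
  have B0: "B \<ge> 0" using B[of 0] norm_ge_zero order.trans by blast
  show int: "set_integrable lborel {0..} ?w"
    unfolding set_integrable_def
  proof (rule Bochner_Integration.integrable_bound)
    have "set_integrable lborel {0<..} (\<lambda>r. exp (- \<tau> * r))"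
    proof -
      have "set_integrable lborel (einterval 0 \<infinity>) (\<lambda>r. exp (- \<tau> * r))"
      proof (rule interval_integral_FTC_nonneg(1)[where F="\<lambda>r. - exp (- \<tau> * r) / \<tau>" and A="-1/\<tau>" and B=0])
        show "DERIV (\<lambda>r. - exp (- \<tau> * r) / \<tau>) r :> exp (- \<tau> * r)" for r
          using \<tau> by (auto intro!: derivative_eq_intros)
        show "(((\<lambda>r. - exp (- \<tau> * r) / \<tau>) \<circ> real_of_ereal) \<longlongrightarrow> - 1 / \<tau>) (at_right 0)"
          unfolding zero_ereal_def ereal_tendsto_simps1 using \<tau> by (auto intro!: tendsto_eq_intros)
        show "(((\<lambda>r. - exp (- \<tau> * r) / \<tau>) \<circ> real_of_ereal) \<longlongrightarrow> 0) (at_left \<infinity>)"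
          unfolding ereal_tendsto_simps1 using \<tau> by real_asymp
      qed auto
      then show ?thesis by (simp add: einterval_eq zero_ereal_def)
    qed
    then have "integrable lborel (\<lambda>r. indicator {0<..} r *\<^sub>R exp (- \<tau> * r))" by (simp add: set_integrable_def)
    also have "?this \<longleftrightarrow> integrable lborel (\<lambda>r. indicator {0..} r *\<^sub>R exp (- \<tau> * r))"
      by (rule integrable_cong_AE) (use AE_lborel_singleton[of "0::real"] in \<open>auto split: split_indicator elim!: eventually_mono\<close>)
    finally show "integrable lborel (\<lambda>r. B * (indicator {0..} r *\<^sub>R exp (- \<tau> * r)))" by (rule integrable_mult_right)
    show "(\<lambda>r. indicator {0..} r *\<^sub>R ?w r) \<in> borel_measurable lborel"
      using borel_measurable_continuous_on_indicator[OF _ contw] by simp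
    show "AE r in lborel. norm (indicator {0..} r *\<^sub>R ?w r) \<le> norm (B * (indicator {0..} r *\<^sub>R exp (- \<tau> * r)))"
    proof (rule AE_I2)
      fix r
      show "norm (indicator {0..} r *\<^sub>R ?w r) \<le> norm (B * (indicator {0..} r *\<^sub>R exp (- \<tau> * r)))"
      proof (cases "r \<ge> 0")
        case True
        have "\<bar>Im (q (- of_real r))\<bar> \<le> B" using order.trans[OF abs_Im_le_cmod B[OF True]] .
        then show ?thesis using True B0 by (simp add: abs_mult mult_right_mono)
      qed simp
    qed
  qed
  \<comment> \<open>U is the upper half of the Bromwich integral and V the integral along the real axis; by symmetry the
    whole integral is 2 \<i> Im U, so that only imaginary parts have to be followed.\<close>
  define U where "U = (\<lambda>T. contour_integral (linepath (of_real \<gamma>) (Complex \<gamma> T)) ?f)"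
  define V where "V = (\<lambda>T. contour_integral (linepath (- of_real (sqrt T)) (of_real \<gamma>)) ?f)"
  have bdf: "norm (?f z) \<le> C / norm z * exp (\<tau> * Re z)" if "R \<le> norm z" "0 \<le> 1 * Im z" for z
    using bd[of z] that unfolding norm_mult by (intro mult_mono) (auto simp: norm_exp_eq_Re C)
  have contf': "continuous_on {z. R \<le> norm z \<and> 0 \<le> 1 * Im z} ?f"
    by (rule continuous_on_subset[OF contf]) auto
  have top: "((\<lambda>T. contour_integral (linepath (Complex (- sqrt T) (1 * T)) (Complex \<gamma> (1 * T))) ?f) \<longlongrightarrow> 0) at_top"
    by (rule horizontal_side_tendsto_0[OF contf' bdf C \<tau>]) auto
  have left: "((\<lambda>T. contour_integral (linepath (Complex (- sqrt T) (1 * T)) (Complex (- sqrt T) (0 * T))) ?f) \<longlongrightarrow> 0) at_top"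
    by (rule left_side_tendsto_0[OF contf' bdf C \<tau>]) auto
  have UV: "((\<lambda>T. U T + V T) \<longlongrightarrow> 0) at_top"
  proof (rule Lim_transform_eventually)
    show "((\<lambda>T. contour_integral (linepath (Complex (- sqrt T) (1 * T)) (Complex \<gamma> (1 * T))) ?f
       - contour_integral (linepath (Complex (- sqrt T) (1 * T)) (Complex (- sqrt T) (0 * T))) ?f) \<longlongrightarrow> 0) at_top"
      using tendsto_diff[OF top left] by simp
    show "eventually (\<lambda>T. contour_integral (linepath (Complex (- sqrt T) (1 * T)) (Complex \<gamma> (1 * T))) ?f
       - contour_integral (linepath (Complex (- sqrt T) (1 * T)) (Complex (- sqrt T) (0 * T))) ?f = U T + V T) at_top"
      using eventually_gt_at_top[of 0]
    proof eventually_elim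
      case (elim T)
      define a1 a2 a3 a4 where "a1 = - complex_of_real (sqrt T)" and "a2 = complex_of_real \<gamma>"
        and "a3 = Complex \<gamma> T" and "a4 = Complex (- sqrt T) T"
      have cv: "convex {z::complex. Im z \<ge> 0}" by (rule convex_halfspace_Im_ge)
      have seg: "closed_segment x y \<subseteq> {z. Im z \<ge> 0}" if "Im x \<ge> 0" "Im y \<ge> 0" for x y
        by (rule closed_segment_subset) (use that cv in auto)
      have im: "Im a1 \<ge> 0" "Im a2 \<ge> 0" "Im a3 \<ge> 0" "Im a4 \<ge> 0" using elim by (auto simp: a1_def a2_def a3_def a4_def)
      have c4: "continuous_on (closed_segment a1 a2) ?f" "continuous_on (closed_segment a2 a3) ?f"
         "continuous_on (closed_segment a3 a4) ?f" "continuous_on (closed_segment a4 a1) ?f"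
        by (rule continuous_on_subset[OF contf seg]; use im in simp)+
      let ?p = "linepath a1 a2 +++ linepath a2 a3 +++ linepath a3 a4 +++ linepath a4 a1"
      have "(?f has_contour_integral 0) ?p"
      proof (rule Cauchy_theorem_convex[where K="{}"])
        show "continuous_on {z. Im z \<ge> 0} ?f" by (rule contf)
        show "?f field_differentiable at z" if "z \<in> interior {z. Im z \<ge> 0} - {}" for z
        proof -
          have "interior {z. Im z \<ge> 0} = {z. Im z > 0}" using interior_halfspace_ge[of "\<i>" 0] by (simp add: inner_complex_def)
          then have "z \<in> - \<real>\<^sub>\<le>\<^sub>0" using that by (auto simp: complex_nonpos_Reals_iff)
          then have "q field_differentiable at z" using hol slit_plane_facts(1) holomorphic_on_imp_differentiable_at by blast
          then show ?thesis by (intro field_differentiable_mult derivative_intros) (auto intro!: holomorphic_on_imp_differentiable_at[of _ UNIV] holomorphic_intros)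
        qed
        show "path_image ?p \<subseteq> {z. Im z \<ge> 0}" using seg im by (simp add: path_image_join)
      qed (use cv in auto)
      then have "contour_integral ?p ?f = 0" by (rule contour_integral_unique)
      moreover have "contour_integral ?p ?f = contour_integral (linepath a1 a2) ?f + (contour_integral (linepath a2 a3) ?f +
          (contour_integral (linepath a3 a4) ?f + contour_integral (linepath a4 a1) ?f))"
        using c4[THEN contour_integrable_continuous_linepath] by (simp add: contour_integrable_join)
      moreover have "contour_integral (linepath a3 a4) ?f = - contour_integral (linepath a4 a3) ?f"
        by (rule contour_integral_reverse_linepath[OF c4(3)])
      moreover have "Complex (- sqrt T) (0 * T) = a1" by (simp add: a1_def complex_eq_iff)
      ultimately show ?case by (simp add: U_def V_def a1_def a2_def a3_def a4_def algebra_simps add_eq_0_iff)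
    qed
  qed
  have real_pos: "Im (q (of_real x)) = 0" if "x > 0" for x
  proof -
    have "of_real x \<notin> (\<real>\<^sub>\<le>\<^sub>0 :: complex set)" using that by (simp add: complex_nonpos_Reals_iff)
    from sym[OF this] show ?thesis by (simp add: complex_eq_iff)
  qed
  have ImV: "((\<lambda>T. Im (V T)) \<longlongrightarrow> (LBINT r:{0..}. ?w r)) at_top"
  proof (rule Lim_transform_eventually)
    have "((\<lambda>b. LBINT r:{0..b}. ?w r) \<longlongrightarrow> (LBINT r:{0..}. ?w r)) at_top"
      by (rule tendsto_set_lebesgue_integral_at_top[OF _ int]) auto
    then show "((\<lambda>T. LBINT r:{0..sqrt T}. ?w r) \<longlongrightarrow> (LBINT r:{0..}. ?w r)) at_top"
      by (rule filterlim_compose[OF _ sqrt_at_top])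
    show "eventually (\<lambda>T. (LBINT r:{0..sqrt T}. ?w r) = Im (V T)) at_top"
      using eventually_gt_at_top[of 0]
    proof eventually_elim
      case (elim T)
      have cx: "continuous_on {- sqrt T..\<gamma>} (\<lambda>x::real. ?f (of_real x))"
        by (rule continuous_on_compose2[OF contf]) (auto intro!: continuous_intros)
      then have intx: "(\<lambda>x::real. ?f (of_real x)) integrable_on {- sqrt T..\<gamma>}" by (rule integrable_continuous_real)
      have "0 < sqrt T" using elim by simp
      then have "- sqrt T < \<gamma>" using \<gamma> by linarith
      then have "V T = integral {- sqrt T..\<gamma>} (\<lambda>x. ?f (of_real x))"
        unfolding V_def by (subst contour_integral_linepath_Reals_eq) auto
      then have "Im (V T) = integral {- sqrt T..\<gamma>} (\<lambda>x. Im (?f (of_real x)))"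
        using integral_linear[OF intx bounded_linear_Im] by (simp add: o_def)
      also have "\<dots> = integral {- sqrt T..0} (\<lambda>x. Im (?f (of_real x))) + integral {0..\<gamma>} (\<lambda>x. Im (?f (of_real x)))"
      proof (rule Henstock_Kurzweil_Integration.integral_combine[symmetric])
        show "(\<lambda>x. Im (?f (of_real x))) integrable_on {- sqrt T..\<gamma>}"
          using integrable_linear[OF intx bounded_linear_Im] by (simp add: o_def)
      qed (use elim \<gamma> in auto)
      also have "integral {0..\<gamma>} (\<lambda>x. Im (?f (of_real x))) = integral {0..\<gamma>} (\<lambda>x. 0)"
      proof (rule integral_spike[of "{0}"])
        show "0 = Im (?f (of_real x))" if "x \<in> {0..\<gamma>} - {0}" for x
          using real_pos[of x] that by (simp add: Im_exp)
      qed auto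
      also have "integral {- sqrt T..0} (\<lambda>x. Im (?f (of_real x))) = integral {0..sqrt T} (\<lambda>x. Im (?f (of_real (- x))))"
        using Henstock_Kurzweil_Integration.integral_reflect_real[of "sqrt T" 0 "\<lambda>x. Im (?f (of_real (- x)))"] by simp
      also have "\<dots> = integral {0..sqrt T} ?w"
        by (rule Henstock_Kurzweil_Integration.integral_cong) (simp add: Im_exp Re_exp)
      also have "\<dots> = (LBINT r:{0..sqrt T}. ?w r)"
        by (rule set_borel_integral_eq_integral(2)[symmetric]) (rule set_integrable_subset[OF int]; auto)
      finally show ?case by simp
    qed
  qed
  have "((\<lambda>T. Im (U T + V T) - Im (V T)) \<longlongrightarrow> Im 0 - (LBINT r:{0..}. ?w r)) at_top"
    by (intro tendsto_diff tendsto_Im UV ImV)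
  then have ImU: "((\<lambda>T. Im (U T)) \<longlongrightarrow> - (LBINT r:{0..}. ?w r)) at_top" by simp
  have lim: "((\<lambda>T. 2 * \<i> * of_real (Im (U T))) \<longlongrightarrow> 2 * \<i> * of_real (- (LBINT r:{0..}. ?w r))) at_top"
    by (intro tendsto_intros ImU)
  have eq: "contour_integral (linepath (Complex \<gamma> (- T)) (Complex \<gamma> T)) ?f = 2 * \<i> * of_real (Im (U T))" if T: "T > 0" for T
  proof -
    have slit: "z \<in> - \<real>\<^sub>\<le>\<^sub>0" if "Re z = \<gamma>" for z using that \<gamma> by (auto simp: complex_nonpos_Reals_iff)
    have re: "Re z = \<gamma>" if "z \<in> closed_segment x y" "Re x = \<gamma>" "Re y = \<gamma>" for x y z
      using segment_re_im_bounds(1,2)[OF that(1)] that by simp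
    have c: "continuous_on (closed_segment x y) ?f" if "Re x = \<gamma>" "Re y = \<gamma>" for x y
      by (intro continuous_intros continuous_on_subset[OF holomorphic_on_imp_continuous_on[OF hol]]) (use slit re that in blast)
    have mid: "of_real \<gamma> \<in> closed_segment (Complex \<gamma> (- T)) (Complex \<gamma> T)"
      unfolding closed_segment_def by (rule CollectI, rule exI[of _ "1/2"]) (auto simp: complex_eq_iff)
    have "contour_integral (linepath (Complex \<gamma> (- T)) (Complex \<gamma> T)) ?f =
      contour_integral (linepath (Complex \<gamma> (- T)) (of_real \<gamma>)) ?f + U T"
      unfolding U_def by (rule contour_integral_split_linepath[OF c mid]) auto
    also have "contour_integral (linepath (Complex \<gamma> (- T)) (of_real \<gamma>)) ?f = - contour_integral (linepath (of_real \<gamma>) (Complex \<gamma> (- T))) ?f"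
      by (rule contour_integral_reverse_linepath[OF c]) auto
    also have "linepath (of_real \<gamma>) (Complex \<gamma> (- T)) = cnj \<circ> linepath (of_real \<gamma>) (Complex \<gamma> T)"
      by (auto simp: fun_eq_iff linepath_def complex_eq_iff)
    also have "contour_integral (cnj \<circ> linepath (of_real \<gamma>) (Complex \<gamma> T)) ?f = cnj (contour_integral (linepath (of_real \<gamma>) (Complex \<gamma> T)) (cnj \<circ> ?f \<circ> cnj))"
      by (rule contour_integral_cnj) simp
    also have "contour_integral (linepath (of_real \<gamma>) (Complex \<gamma> T)) (cnj \<circ> ?f \<circ> cnj) = U T"
      unfolding U_def
    proof (rule contour_integral_cong[OF refl])
      fix z assume "z \<in> path_image (linepath (of_real \<gamma>) (Complex \<gamma> T))"
      then have "z \<notin> \<real>\<^sub>\<le>\<^sub>0" using slit re[of z "of_real \<gamma>" "Complex \<gamma> T"] by auto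
      then show "(cnj \<circ> ?f \<circ> cnj) z = ?f z" using sym[of z] by (simp add: exp_cnj)
    qed
    finally show ?thesis by (simp add: complex_eq_iff)
  qed
  have "eventually (\<lambda>T. 2 * \<i> * of_real (Im (U T)) = contour_integral (linepath (Complex \<gamma> (- T)) (Complex \<gamma> T)) ?f) at_top"
    using eventually_gt_at_top[of 0] by (rule eventually_mono) (simp only: eq)
  from Lim_transform_eventually[OF lim this]
  show "((\<lambda>T. contour_integral (linepath (Complex \<gamma> (- T)) (Complex \<gamma> T)) ?f)
      \<longlongrightarrow> - (2 * \<i> * of_real (LBINT r:{0..}. ?w r))) at_top"
    by (simp only: of_real_minus mult_minus_right)
qed

section \<open>Bessel functions of half-integer order\<close>

lemma bessel_I_recurrence:
  assumes "z \<noteq> 0"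
  shows "bessel_I (\<mu> - 1) z = 2 * \<mu> / z * bessel_I \<mu> z + bessel_I (\<mu> + 1) z"
proof -
  have "p / w * (\<mu> * C + w\<^sup>2 * D) = 2 * \<mu> / (2 * w) * (p * C) + p * w * D" if "w \<noteq> 0" for p w C D
    using that by (simp add: field_simps power2_eq_square)
  from this[of "z / 2"] show ?thesis
    using assms unfolding bessel_I_eq bessel_clifford_recurrence[of \<mu>] by (simp add: powr_diff powr_add)
qed

lemma half_integer_not_Ints: "of_nat n + 1 / 2 \<notin> (\<int> :: complex set)"
proof
  assume "of_nat n + 1 / 2 \<in> (\<int> :: complex set)"
  then obtain m :: int where "of_nat n + 1 / 2 = (of_int m :: complex)" by (auto elim: Ints_cases)
  then have "Re (of_nat n + 1 / 2) = Re (of_int m)" by simp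
  then have "real_of_int (2 * int n + 1) = real_of_int (2 * m)" by simp
  then have "2 * int n + 1 = 2 * m" by (simp only: of_int_eq_iff)
  then show False by presburger
qed

lemma sin_half_integer: "sin ((of_nat n + 1 / 2) * complex_of_real pi) = (-1) ^ n"
proof -
  have "(of_nat n + 1 / 2) * complex_of_real pi = of_real (pi / 2 + real n * pi)" by (simp add: algebra_simps)
  also have "sin \<dots> = of_real (sin (pi / 2 + real n * pi))" by (rule sin_of_real)
  also have "sin (pi / 2 + real n * pi) = (-1) ^ n" by (simp add: sin_add cos_npi)
  finally show ?thesis by simp
qed

lemma bessel_K_half_integer:
  "bessel_K (of_nat n + 1 / 2) z = of_real pi / 2 * (-1) ^ n * (bessel_I (- (of_nat n + 1 / 2)) z - bessel_I (of_nat n + 1 / 2) z)"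
proof -
  have "(-1) ^ n * (-1) ^ n = (1::complex)" by (simp flip: power_mult_distrib)
  then have "a / (-1) ^ n = a * (-1) ^ n" for a :: complex by (simp add: divide_eq_eq mult.assoc)
  then show ?thesis
    unfolding bessel_K_def Let_def sin_half_integer using half_integer_not_Ints[of n] by (simp add: mult_ac)
qed

lemma bessel_K_half_integer_recurrence:
  assumes "z \<noteq> 0"
  shows "bessel_K (of_nat (n + 2) + 1 / 2) z = bessel_K (of_nat n + 1 / 2) z + of_nat (2 * n + 3) / z * bessel_K (of_nat (n + 1) + 1 / 2) z"
    and "bessel_K (of_nat 1 + 1 / 2) z = (1 + 1 / z) * bessel_K (of_nat 0 + 1 / 2) z"
proof -
  let ?\<nu> = "of_nat n + 3 / 2 :: complex"
  have 1: "bessel_I (- (?\<nu> + 1)) z = - (2 * ?\<nu> / z) * bessel_I (- ?\<nu>) z + bessel_I (- (?\<nu> - 1)) z"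
  proof -
    have "- (?\<nu> + 1) = - ?\<nu> - 1" "- (?\<nu> - 1) = - ?\<nu> + 1" by simp_all
    then show ?thesis
      using bessel_I_recurrence[OF assms, of "- ?\<nu>"] by (simp only: mult_minus_right minus_divide_left)
  qed
  have 2: "bessel_I (?\<nu> + 1) z = bessel_I (?\<nu> - 1) z - 2 * ?\<nu> / z * bessel_I ?\<nu> z"
    using bessel_I_recurrence[OF assms, of ?\<nu>] by (simp add: algebra_simps)
  have e: "of_nat (n + 2) + 1 / 2 = ?\<nu> + 1" "of_nat (n + 1) + 1 / 2 = ?\<nu>" "of_nat n + 1 / 2 = ?\<nu> - 1"
    "of_nat (2 * n + 3) = 2 * ?\<nu>" by (simp_all add: field_simps)
  have alg: "p * s * (- c * A + B - (D - c * E)) = p * s * (B - D) + c * (p * (s * - 1) * (A - E))" for p s c A B D E :: complex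
    by (simp add: algebra_simps)
  show "bessel_K (of_nat (n + 2) + 1 / 2) z = bessel_K (of_nat n + 1 / 2) z + of_nat (2 * n + 3) / z * bessel_K (of_nat (n + 1) + 1 / 2) z"
    using alg[of "of_real pi / 2" "(-1)^n" "2 * ?\<nu> / z" "bessel_I (- ?\<nu>) z" "bessel_I (- (?\<nu> - 1)) z" "bessel_I (?\<nu> - 1) z" "bessel_I ?\<nu> z"]
    unfolding bessel_K_half_integer unfolding e 1 2 by (simp add: power_add)
  have 3: "bessel_I (- (3/2)) z = - (1 / z) * bessel_I (- (1/2)) z + bessel_I (1/2) z"
    using bessel_I_recurrence[OF assms, of "- (1/2)"] by simp
  have 4: "bessel_I (3/2) z = bessel_I (- (1/2)) z - 1 / z * bessel_I (1/2) z"
    using bessel_I_recurrence[OF assms, of "1/2"] by simp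
  show "bessel_K (of_nat 1 + 1 / 2) z = (1 + 1 / z) * bessel_K (of_nat 0 + 1 / 2) z"
  proof -
    have e1: "of_nat 1 + 1 / 2 = (3/2 :: complex)" "of_nat 0 + 1 / 2 = (1/2 :: complex)" by simp_all
    have "p * (-1) ^ 1 * ((- (1 / z) * B + C) - (B - 1 / z * C)) = (1 + 1 / z) * (p * (-1) ^ 0 * (B - C))" for p B C
      by (simp add: algebra_simps)
    then show ?thesis
      using bessel_K_half_integer[of 1 z] bessel_K_half_integer[of 0 z] unfolding e1 3 4 by (simp only:)
  qed
qed

text \<open>
  With \<open>w = z / 2\<close>, the even part \<open>c\<close> and the odd part \<open>s\<close> of the expression in parentheses satisfy \<open>c' = 2 s\<close> and
  \<open>s' = 2 c\<close>, so \<open>c - s\<close> is a multiple of \<open>exp (- 2 w)\<close>.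
\<close>
lemma bessel_K_one_half:
  assumes "z \<noteq> 0"
  shows "bessel_K (of_nat 0 + 1 / 2) z = of_real pi / 2 * rGamma (1 / 2) * (z / 2) powr (- (1 / 2)) * exp (- z)"
proof -
  define f where "f = (\<lambda>w. (bessel_clifford (- (1/2)) (w\<^sup>2) - w * bessel_clifford (1/2) (w\<^sup>2)) * exp (2 * w))"
  have sq: "((\<lambda>w::complex. w\<^sup>2) has_field_derivative 2 * w) (at w)" for w
    by (rule derivative_eq_intros refl | simp)+
  have ex: "((\<lambda>w::complex. exp (2 * w)) has_field_derivative 2 * exp (2 * w)) (at w)" for w
    by (rule derivative_eq_intros refl | simp)+
  have "(f has_field_derivative 0) (at w within UNIV)" for w
  proof -
    have "(f has_field_derivative (bessel_clifford (- (1/2) + 1) (w\<^sup>2) * (2 * w) -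
        (1 * bessel_clifford (1/2) (w\<^sup>2) + bessel_clifford (1/2 + 1) (w\<^sup>2) * (2 * w) * w)) * exp (2 * w)
        + 2 * exp (2 * w) * (bessel_clifford (- (1/2)) (w\<^sup>2) - w * bessel_clifford (1/2) (w\<^sup>2))) (at w)"
      unfolding f_def
      by (intro DERIV_mult DERIV_diff DERIV_ident ex DERIV_chain2[OF bessel_clifford_has_derivative sq])
    moreover have "bessel_clifford (- (1/2)) (w\<^sup>2) = 1/2 * bessel_clifford (1/2) (w\<^sup>2) + w\<^sup>2 * bessel_clifford (1/2 + 1) (w\<^sup>2)"
      using bessel_clifford_recurrence[of "1/2" "w\<^sup>2"] by simp
    then have "(bessel_clifford (- (1/2) + 1) (w\<^sup>2) * (2 * w) -
        (1 * bessel_clifford (1/2) (w\<^sup>2) + bessel_clifford (1/2 + 1) (w\<^sup>2) * (2 * w) * w)) * exp (2 * w)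
        + 2 * exp (2 * w) * (bessel_clifford (- (1/2)) (w\<^sup>2) - w * bessel_clifford (1/2) (w\<^sup>2)) = 0"
      by (simp add: algebra_simps power2_eq_square)
    ultimately show ?thesis by simp
  qed
  then obtain A where A: "\<And>w. f w = A"
    using has_field_derivative_zero_constant[of UNIV f] by auto
  have "A = rGamma (1/2)" using A[of 0] by (simp add: f_def power_series_at_0)
  have w: "z / 2 \<noteq> 0" using assms by simp
  have "f (z/2) * exp (- z) = bessel_clifford (- (1/2)) ((z/2)\<^sup>2) - z/2 * bessel_clifford (1/2) ((z/2)\<^sup>2)"
    by (simp add: f_def mult.assoc mult_exp_exp)
  then have fz: "bessel_clifford (- (1/2)) ((z/2)\<^sup>2) - z/2 * bessel_clifford (1/2) ((z/2)\<^sup>2) = rGamma (1/2) * exp (- z)"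
    using A[of "z/2"] \<open>A = _\<close> by simp
  have pw: "w powr (1/2) = w powr (- (1/2)) * w" if "w \<noteq> 0" for w :: complex
    using powr_add[of w "- (1/2)" 1] that by simp
  have "bessel_I (- (1/2)) z - bessel_I (1/2) z = (z/2) powr (- (1/2)) * (bessel_clifford (- (1/2)) ((z/2)\<^sup>2) - z/2 * bessel_clifford (1/2) ((z/2)\<^sup>2))"
    unfolding bessel_I_eq pw[OF w] by (simp only: right_diff_distrib mult.assoc)
  then show ?thesis unfolding fz using bessel_K_half_integer[of 0 z] by simp
qed

text \<open>
  The reverse Bessel polynomials, by the recurrence of \<open>K\<close> multiplied by the power of \<open>z\<close> that clears denominators.
\<close>
fun reverse_bessel_poly :: "nat \<Rightarrow> complex poly" where
  "reverse_bessel_poly 0 = 1"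
| "reverse_bessel_poly (Suc 0) = [:1, 1:]"
| "reverse_bessel_poly (Suc (Suc n)) = smult (of_nat (2 * n + 3)) (reverse_bessel_poly (Suc n)) + [:0, 0, 1:] * reverse_bessel_poly n"

lemma bessel_K_half_integer_poly:
  assumes "z \<noteq> 0"
  shows "bessel_K (of_nat n + 1 / 2) z =
    of_real pi / 2 * rGamma (1 / 2) * (z / 2) powr (- (1 / 2)) * exp (- z) * (poly (reverse_bessel_poly n) z / z ^ n)"
proof (induction n rule: reverse_bessel_poly.induct)
  case 1
  then show ?case using bessel_K_one_half[OF assms] by simp
next
  case 2
  have alg: "(1 + 1 / z) * k = k * ((1 + z) / z)" for k :: complex using assms by (simp add: field_simps)
  have "bessel_K (of_nat 1 + 1 / 2) z = of_real pi / 2 * rGamma (1 / 2) * (z / 2) powr (- (1 / 2)) * exp (- z) * ((1 + z) / z)"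
    unfolding bessel_K_half_integer_recurrence(2)[OF assms] bessel_K_one_half[OF assms] by (rule alg)
  then show ?case by simp
next
  case (3 n)
  have alg: "k * (P0 / q) + c / z * (k * (P1 / (z * q))) = k * ((c * P1 + z * (z * P0)) / (z * (z * q)))" if "q \<noteq> 0" for k P0 P1 q c
    using assms that by (simp add: field_simps)
  have q: "z ^ n \<noteq> 0" using assms by simp
  let ?k = "of_real pi / 2 * rGamma (1 / 2) * (z / 2) powr (- (1 / 2)) * exp (- z)"
  have "bessel_K (of_nat (Suc (Suc n)) + 1 / 2) z = bessel_K (of_nat n + 1 / 2) z + of_nat (2 * n + 3) / z * bessel_K (of_nat (Suc n) + 1 / 2) z"
    using bessel_K_half_integer_recurrence(1)[OF assms, of n] by (simp only: add_2_eq_Suc' Suc_eq_plus1[symmetric])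
  also have "\<dots> = ?k * (poly (reverse_bessel_poly n) z / z ^ n) + of_nat (2 * n + 3) / z * (?k * (poly (reverse_bessel_poly (Suc n)) z / (z * z ^ n)))"
    using 3 by (simp only: power_Suc)
  also have "\<dots> = ?k * ((of_nat (2 * n + 3) * poly (reverse_bessel_poly (Suc n)) z + z * (z * poly (reverse_bessel_poly n) z)) / (z * (z * z ^ n)))"
    by (rule alg[OF q])
  also have "of_nat (2 * n + 3) * poly (reverse_bessel_poly (Suc n)) z + z * (z * poly (reverse_bessel_poly n) z) = poly (reverse_bessel_poly (Suc (Suc n))) z"
    by simp
  finally show ?case by (simp only: power_Suc)
qed

text \<open>
  The derivative of \<open>K\<close> in terms of the order below, in polynomial form. It turns a multiple zero into a common
  zero of consecutive polynomials.
\<close>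
lemma reverse_bessel_poly_pderiv:
  "pderiv (reverse_bessel_poly (Suc n)) = reverse_bessel_poly (Suc n) - [:0, 1:] * reverse_bessel_poly n"
proof (induction n rule: less_induct)
  case (less n)
  consider "n = 0" | "n = 1" | m where "n = m + 2"
    by (metis One_nat_def add_2_eq_Suc' not0_implies_Suc)
  then show ?case
  proof cases
    case 1
    then show ?thesis by (simp add: pderiv_pCons)
  next
    case 2
    then show ?thesis by (simp add: pderiv_pCons pderiv_add pderiv_smult)
  next
    case 3
    let ?P = reverse_bessel_poly and ?X = "[:0, 1:] :: complex poly"
    let ?c = "\<lambda>k. [:of_nat (2 * k + 3):] :: complex poly"
    have rec: "?P (Suc (Suc k)) = ?c k * ?P (Suc k) + ?X\<^sup>2 * ?P k" for k
      by (simp add: power2_eq_square)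
    have dX: "pderiv (?X\<^sup>2) = 2 * ?X" by (simp add: power2_eq_square pderiv_pCons pderiv_mult numeral_poly)
    have d1: "pderiv (?P (Suc (Suc m))) = ?P (Suc (Suc m)) - ?X * ?P (Suc m)"
      and d0: "pderiv (?P (Suc m)) = ?P (Suc m) - ?X * ?P m" using less[of "Suc m"] less[of m] 3 by simp_all
    have "pderiv (?P (Suc (Suc (Suc m)))) = ?c (Suc m) * pderiv (?P (Suc (Suc m))) + (2 * ?X * ?P (Suc m) + ?X\<^sup>2 * pderiv (?P (Suc m)))"
      unfolding rec[of "Suc m"] pderiv_add pderiv_mult dX by (simp add: pderiv_pCons algebra_simps)
    also have "\<dots> = ?c (Suc m) * ?P (Suc (Suc m)) + ?X\<^sup>2 * ?P (Suc m) - ?X * ((?c (Suc m) - 2) * ?P (Suc m) + ?X\<^sup>2 * ?P m)"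
      unfolding d1 d0 by (simp add: algebra_simps power2_eq_square)
    also have "?c (Suc m) - 2 = ?c m" by (simp add: numeral_poly)
    finally show ?thesis using 3 rec[of m] rec[of "Suc m"] by simp
  qed
qed

lemma reverse_bessel_poly_at_0: "poly (reverse_bessel_poly n) 0 \<noteq> 0"
  by (induction n rule: reverse_bessel_poly.induct) (auto simp del: of_nat_add of_nat_mult simp: add_eq_0_iff of_nat_eq_0_iff)

lemma reverse_bessel_poly_degree: "degree (reverse_bessel_poly n) = n"
proof (induction n rule: reverse_bessel_poly.induct)
  case (3 n)
  have nz: "reverse_bessel_poly n \<noteq> 0" using reverse_bessel_poly_at_0[of n] by auto
  have "degree ([:0, 0, 1:] * reverse_bessel_poly n) = n + 2" using 3 nz by (subst degree_mult_eq) auto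
  moreover have "degree (smult (of_nat (2 * n + 3)) (reverse_bessel_poly (Suc n))) < n + 2"
    using 3 by (intro le_less_trans[OF degree_smult_le]) simp
  ultimately show ?case by (simp only: reverse_bessel_poly.simps) (subst degree_add_eq_right; simp)
qed auto

text \<open>
  A common zero of the polynomial and its derivative would propagate down the recurrence to the constant polynomial one.
\<close>
lemma reverse_bessel_poly_simple: "rsquarefree (reverse_bessel_poly n)"
  unfolding rsquarefree_roots
proof (intro allI notI)
  fix a assume a: "poly (reverse_bessel_poly n) a = 0 \<and> poly (pderiv (reverse_bessel_poly n)) a = 0"
  have a0: "a \<noteq> 0" using a reverse_bessel_poly_at_0[of n] by auto
  have down: "poly (reverse_bessel_poly (Suc k)) a \<noteq> 0 \<or> poly (reverse_bessel_poly k) a \<noteq> 0" for k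
    by (induction k) (use a0 in auto)
  show False
  proof (cases n)
    case (Suc k)
    have e: "poly (pderiv (reverse_bessel_poly (Suc k))) a = poly (reverse_bessel_poly (Suc k)) a - a * poly (reverse_bessel_poly k) a"
      unfolding reverse_bessel_poly_pderiv by simp
    have p: "poly (pderiv (reverse_bessel_poly (Suc k))) a = 0" "poly (reverse_bessel_poly (Suc k)) a = 0"
      using a Suc by blast+
    have "poly (reverse_bessel_poly k) a = 0" using e a0 unfolding p by simp
    then show False using down[of k] a Suc by auto
  qed (use a in auto)
qed

lemma bessel_K_zeros_half_integer:
  "bessel_K_zeros (of_nat n + 1 / 2) = {z. poly (reverse_bessel_poly n) z = 0}"
proof -
  have "rGamma (1/2 :: complex) \<noteq> 0" using rGamma_eq_zero_iff[of "1/2::complex"] by (auto elim!: nonpos_Ints_cases simp: complex_eq_iff)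
  then have "bessel_K (of_nat n + 1 / 2) z = 0 \<longleftrightarrow> poly (reverse_bessel_poly n) z = 0" if "z \<noteq> 0" for z
    using that by (simp add: bessel_K_half_integer_poly)
  then show ?thesis using reverse_bessel_poly_at_0[of n] unfolding bessel_K_zeros_def by (intro Collect_cong) metis
qed

lemma bessel_K_zeros_half_integer_finite: "finite (bessel_K_zeros (of_nat n + 1 / 2))"
  and bessel_K_zeros_half_integer_card: "card (bessel_K_zeros (of_nat n + 1 / 2)) = n"
  and reverse_bessel_poly_factor: "\<exists>k. k \<noteq> 0 \<and> (\<forall>z. poly (reverse_bessel_poly n) z = k * (\<Prod>a\<in>bessel_K_zeros (of_nat n + 1 / 2). z - a))"
proof -
  let ?P = "reverse_bessel_poly n" and ?Z = "bessel_K_zeros (of_nat n + 1 / 2)"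
  have P0: "?P \<noteq> 0" using reverse_bessel_poly_at_0[of n] by auto
  show fin: "finite ?Z" unfolding bessel_K_zeros_half_integer by (rule poly_roots_finite[OF P0])
  have dec: "smult (lead_coeff ?P) (\<Prod>a\<in>?Z. [:- a, 1:]) = ?P"
    using complex_poly_decompose_rsquarefree[OF reverse_bessel_poly_simple[of n]] unfolding bessel_K_zeros_half_integer .
  have "n = degree (smult (lead_coeff ?P) (\<Prod>a\<in>?Z. [:- a, 1:]))" unfolding dec by (simp add: reverse_bessel_poly_degree)
  also have "\<dots> = card ?Z" using P0 by (simp add: degree_prod_eq_sum_degree)
  finally show "card ?Z = n" by simp
  have "poly ?P z = lead_coeff ?P * (\<Prod>a\<in>?Z. z - a)" for z
    using arg_cong[OF dec, of "\<lambda>p. poly p z"] by (simp add: poly_prod)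
  then show "\<exists>k. k \<noteq> 0 \<and> (\<forall>z. poly ?P z = k * (\<Prod>a\<in>?Z. z - a))" using P0 by (intro exI[of _ "lead_coeff ?P"]) auto
qed

section \<open>Zeros, poles and admissible abscissae\<close>

lemma holomorphic_factor_finite_zeros:
  assumes "finite Z" "open S" "Z \<subseteq> S" "f holomorphic_on S" "\<And>a. a \<in> Z \<Longrightarrow> f a = 0"
  shows "\<exists>g. g holomorphic_on S \<and> (\<forall>z\<in>S. f z = (\<Prod>a\<in>Z. z - a) * g z)"
  using assms
proof (induction Z rule: finite_induct)
  case empty
  then show ?case by (intro exI[of _ f]) simp
next
  case (insert a Z)
  then obtain g where g: "g holomorphic_on S" "\<And>z. z \<in> S \<Longrightarrow> f z = (\<Prod>a\<in>Z. z - a) * g z" by auto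
  define G where "G = (\<lambda>z. if z = a then deriv g a else (g z - g a) / (z - a))"
  have "f a = 0" "a \<in> S" using insert by auto
  then have "g a = 0" using g(2)[of a] insert by auto
  then have "g z = (z - a) * G z" for z by (simp add: G_def)
  then have "\<forall>z\<in>S. f z = (\<Prod>a\<in>insert a Z. z - a) * G z" using g(2) insert by (simp add: mult_ac)
  moreover have "G holomorphic_on S" unfolding G_def using g(1) insert by (intro pole_lemma_open) auto
  ultimately show ?case by blast
qed

text \<open>
  Splits off the zeros, making them simple. The set may contain points of the cut, where a zero of half-integer
  order can lie; the factorisation itself is only asked for off the cut.
\<close>
definition zero_factorization :: "(complex \<Rightarrow> complex) \<Rightarrow> complex set \<Rightarrow> (complex \<Rightarrow> complex) \<Rightarrow> bool" where
  "zero_factorization K Z g \<longleftrightarrow> finite Z \<and> g holomorphic_on (- \<real>\<^sub>\<le>\<^sub>0) \<and>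
     (\<forall>z. z \<notin> \<real>\<^sub>\<le>\<^sub>0 \<longrightarrow> g z \<noteq> 0 \<and> K z = (\<Prod>a\<in>Z. z - a) * g z)"

text \<open>
  What \<open>z + 1 / 2 + z K' / K\<close> leaves after its principal parts \<open>a / (z - a)\<close> are removed. The cardinality arises
  from \<open>z / (z - a) = 1 + a / (z - a)\<close>.
\<close>
definition regular_part :: "complex set \<Rightarrow> (complex \<Rightarrow> complex) \<Rightarrow> complex \<Rightarrow> complex" where
  "regular_part Z g z = z + 1 / 2 + of_nat (card Z) + z * deriv g z / g z"

lemma regular_part_holomorphic:
  "zero_factorization K Z g \<Longrightarrow> regular_part Z g holomorphic_on (- \<real>\<^sub>\<le>\<^sub>0)"
  unfolding regular_part_def[abs_def] zero_factorization_def
  by (intro holomorphic_intros holomorphic_deriv slit_plane_facts) auto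

lemma zero_factorization_K:
  assumes F: "zero_factorization K Z g"
  shows zero_factorization_holomorphic: "K holomorphic_on (- \<real>\<^sub>\<le>\<^sub>0)"
    and zero_factorization_zero_iff: "z \<notin> \<real>\<^sub>\<le>\<^sub>0 \<Longrightarrow> K z = 0 \<longleftrightarrow> z \<in> Z"
    and zero_factorization_log_deriv:
      "z \<notin> \<real>\<^sub>\<le>\<^sub>0 \<Longrightarrow> z \<notin> Z \<Longrightarrow> z + 1 / 2 + z * (deriv K z / K z) = regular_part Z g z + (\<Sum>a\<in>Z. a / (z - a))"
    and zero_factorization_simple: "a \<in> Z \<Longrightarrow> a \<notin> \<real>\<^sub>\<le>\<^sub>0 \<Longrightarrow> deriv K a \<noteq> 0"
proof -
  have fin: "finite Z" and g: "g holomorphic_on (- \<real>\<^sub>\<le>\<^sub>0)"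
    and K: "\<And>z. z \<notin> \<real>\<^sub>\<le>\<^sub>0 \<Longrightarrow> g z \<noteq> 0" "\<And>z. z \<notin> \<real>\<^sub>\<le>\<^sub>0 \<Longrightarrow> K z = (\<Prod>a\<in>Z. z - a) * g z"
    using F by (auto simp: zero_factorization_def)
  have dg: "(g has_field_derivative deriv g z) (at z)" if "z \<notin> \<real>\<^sub>\<le>\<^sub>0" for z
    using holomorphic_derivI[OF g slit_plane_facts(1)] that by blast
  have der: "(K has_field_derivative D) (at z)" if "((\<lambda>z. (\<Prod>a\<in>Z. z - a) * g z) has_field_derivative D) (at z)" "z \<notin> \<real>\<^sub>\<le>\<^sub>0" for D z
    by (rule has_field_derivative_transform_within_open[OF that(1) slit_plane_facts(1)]) (use that K in auto)
  show "K holomorphic_on (- \<real>\<^sub>\<le>\<^sub>0)"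
    by (rule holomorphic_transform[of "\<lambda>z. (\<Prod>a\<in>Z. z - a) * g z"]) (use K in \<open>auto intro!: holomorphic_intros g\<close>)
  show "z \<notin> \<real>\<^sub>\<le>\<^sub>0 \<Longrightarrow> K z = 0 \<longleftrightarrow> z \<in> Z" using K fin by auto
  show "z + 1 / 2 + z * (deriv K z / K z) = regular_part Z g z + (\<Sum>a\<in>Z. a / (z - a))" if z: "z \<notin> \<real>\<^sub>\<le>\<^sub>0" "z \<notin> Z"
  proof -
    let ?P = "\<Prod>a\<in>Z. z - a"
    have P0: "?P \<noteq> 0" using fin z by auto
    have "((\<lambda>z. \<Prod>a\<in>Z. z - a) has_field_derivative ?P * (\<Sum>a\<in>Z. 1 / (z - a))) (at z)"
      by (rule has_field_derivative_prod') (use z in \<open>auto intro!: derivative_eq_intros\<close>)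
    from DERIV_mult[OF this dg[OF z(1)]]
    have "deriv K z = ?P * (\<Sum>a\<in>Z. 1 / (z - a)) * g z + deriv g z * ?P"
      by (intro DERIV_imp_deriv der z(1))
    then have "deriv K z / K z = (\<Sum>a\<in>Z. 1 / (z - a)) + deriv g z / g z"
      using K(1)[OF z(1)] P0 unfolding K(2)[OF z(1)] by (simp add: field_simps)
    then have "z * (deriv K z / K z) = (\<Sum>a\<in>Z. z / (z - a)) + z * deriv g z / g z"
      by (simp add: sum_distrib_left algebra_simps)
    also have "(\<Sum>a\<in>Z. z / (z - a)) = (\<Sum>a\<in>Z. 1 + a / (z - a))"
    proof (rule sum.cong[OF refl])
      fix a assume "a \<in> Z"
      then have "z - a \<noteq> 0" using z(2) by auto
      then show "z / (z - a) = 1 + a / (z - a)" by (simp add: field_simps)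
    qed
    also have "\<dots> = of_nat (card Z) + (\<Sum>a\<in>Z. a / (z - a))" by (simp add: sum.distrib)
    finally show ?thesis by (simp add: regular_part_def)
  qed
  show "deriv K a \<noteq> 0" if a: "a \<in> Z" "a \<notin> \<real>\<^sub>\<le>\<^sub>0"
  proof -
    let ?G = "\<lambda>z. (\<Prod>b\<in>Z - {a}. z - b) * g z"
    have "((\<lambda>z. (z - a) * ?G z) has_field_derivative 1 * ?G a + deriv ?G a * (a - a)) (at a)"
    proof (rule DERIV_mult)
      have "?G holomorphic_on (- \<real>\<^sub>\<le>\<^sub>0)" by (intro holomorphic_intros g)
      then show "(?G has_field_derivative deriv ?G a) (at a)"
        using a by (intro holomorphic_derivI[OF _ slit_plane_facts(1)]) auto
    qed (auto intro!: derivative_eq_intros)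
    moreover have "(\<lambda>z. (z - a) * ?G z) = (\<lambda>z. (\<Prod>a\<in>Z. z - a) * g z)"
      using fin a by (intro ext) (simp add: prod.remove mult.assoc)
    ultimately have "deriv K a = ?G a" using der[OF _ a(2)] by (intro DERIV_imp_deriv) simp
    then show ?thesis using K(1)[OF a(2)] fin by auto
  qed
qed

lemma contour_integral_linepath_scale:
  assumes "\<beta> \<noteq> 0"
  shows "contour_integral (linepath a b) (\<lambda>s. f (\<beta> * s)) = contour_integral (linepath (\<beta> * a) (\<beta> * b)) f / \<beta>"
proof -
  have "\<beta> * linepath a b x = linepath (\<beta> * a) (\<beta> * b) x" for x
    by (simp add: linepath_def algebra_simps)
  then have "contour_integral (linepath (\<beta> * a) (\<beta> * b)) f = integral {0..1} (\<lambda>x. \<beta> * (f (\<beta> * linepath a b x) * (b - a)))"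
    unfolding contour_integral_integral vector_derivative_linepath_at by (simp add: algebra_simps)
  also have "\<dots> = \<beta> * integral {0..1} (\<lambda>x. f (\<beta> * linepath a b x) * (b - a))" by (rule integral_mult_right)
  finally show ?thesis using assms unfolding contour_integral_integral vector_derivative_linepath_at by simp
qed

context
  fixes b c :: real and \<nu> :: complex and Z :: "complex set" and g :: "complex \<Rightarrow> complex"
  assumes b: "b > 0" and c: "c > 0"
    and F: "zero_factorization (bessel_K \<nu>) Z g"
begin

lemma sigma_transform_eq:
  assumes "of_real (b / c) * s \<notin> \<real>\<^sub>\<le>\<^sub>0" "of_real (b / c) * s \<notin> Z"
  shows "sigma_transform b c \<nu> s = 1 / of_real b * (regular_part Z g (of_real (b / c) * s) + (\<Sum>a\<in>Z. a / (of_real (b / c) * s - a)))"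
proof -
  have e: "s * of_real b / of_real c = of_real (b / c) * s" by simp
  have "s / of_real c + 1 / (2 * of_real b) + s / of_real c * R = 1 / of_real b * (of_real (b / c) * s + 1 / 2 + of_real (b / c) * s * R)" for R
    using b c by (simp add: field_simps)
  then show ?thesis
    unfolding sigma_transform_def e zero_factorization_log_deriv[OF F assms, symmetric] by blast
qed

lemma sigma_transform_holomorphic:
  assumes "\<gamma>\<^sub>0 \<ge> 0" "\<And>a. a \<in> Z \<Longrightarrow> Re a \<le> b / c * \<gamma>\<^sub>0"
  shows "sigma_transform b c \<nu> holomorphic_on {s. Re s > \<gamma>\<^sub>0}"
proof -
  have ok: "of_real (b / c) * s \<notin> \<real>\<^sub>\<le>\<^sub>0" "of_real (b / c) * s \<notin> Z" if "Re s > \<gamma>\<^sub>0" for s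
  proof -
    have "Re (of_real (b / c) * s) = b / c * Re s" by simp
    also have "b / c * Re s > b / c * \<gamma>\<^sub>0" using that b c by (intro mult_strict_left_mono) auto
    finally have *: "Re (of_real (b / c) * s) > b / c * \<gamma>\<^sub>0" .
    moreover have "b / c * \<gamma>\<^sub>0 \<ge> 0" using assms(1) b c by simp
    ultimately show "of_real (b / c) * s \<notin> \<real>\<^sub>\<le>\<^sub>0" unfolding complex_nonpos_Reals_iff by linarith
    show "of_real (b / c) * s \<notin> Z" using assms(2)[of "of_real (b / c) * s"] * by linarith
  qed
  have "(\<lambda>s. 1 / of_real b * (regular_part Z g (of_real (b / c) * s) + (\<Sum>a\<in>Z. a / (of_real (b / c) * s - a)))) holomorphic_on {s. Re s > \<gamma>\<^sub>0}"
    using ok b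
    by (intro holomorphic_intros holomorphic_on_compose_gen[OF _ regular_part_holomorphic[OF F], unfolded o_def]) auto
  then show ?thesis
    by (rule holomorphic_transform) (use ok sigma_transform_eq in auto)
qed

lemma sigma_transform_admissible_exists: "\<exists>\<gamma>. right_of_singularities (sigma_transform b c \<nu>) \<gamma>"
proof -
  have fin: "finite Z" using F by (simp add: zero_factorization_def)
  define \<gamma>0 where "\<gamma>0 = c / b * Max (insert 0 (Re ` Z))"
  have "Max (insert 0 (Re ` Z)) \<ge> 0" using fin by (intro Max_ge) auto
  then have "\<gamma>0 \<ge> 0" using b c by (simp add: \<gamma>0_def)
  moreover have "Re a \<le> b / c * \<gamma>0" if "a \<in> Z" for a
  proof -
    have "Re a \<le> Max (insert 0 (Re ` Z))" using fin that by (intro Max_ge) auto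
    then show ?thesis using b c by (simp add: \<gamma>0_def)
  qed
  ultimately have "sigma_transform b c \<nu> holomorphic_on {s. Re s > \<gamma>0}" by (rule sigma_transform_holomorphic)
  then have "right_of_singularities (sigma_transform b c \<nu>) (\<gamma>0 + 1)"
    unfolding right_of_singularities_def by (intro exI[of _ \<gamma>0]) simp
  then show ?thesis ..
qed

text \<open>
  A zero of the Bessel function to the right of an admissible line would be a pole of the logarithmic derivative,
  whatever value is assigned to the transform at that point.
\<close>
lemma sigma_transform_zero_not_right:
  assumes hol: "sigma_transform b c \<nu> holomorphic_on {s. Re s > \<gamma>\<^sub>0}" and a: "a \<in> Z" "a \<notin> \<real>\<^sub>\<le>\<^sub>0"
  shows "Re a \<le> b / c * \<gamma>\<^sub>0"
proof (rule ccontr)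
  assume "\<not> Re a \<le> b / c * \<gamma>\<^sub>0"
  then have gt: "b / c * \<gamma>\<^sub>0 < Re a" by simp
  let ?\<beta> = "complex_of_real (b / c)" and ?K = "bessel_K \<nu>" and ?H = "sigma_transform b c \<nu>"
  define s0 where "s0 = a / ?\<beta>"
  have \<beta>0: "?\<beta> \<noteq> 0" using b c by simp
  have bs: "?\<beta> * s0 = a" using \<beta>0 by (simp add: s0_def)
  have "Re s0 = Re a / (b / c)" unfolding s0_def by (rule Re_divide_of_real)
  then have "b * Re s0 = c * Re a" "b * \<gamma>\<^sub>0 < c * Re a" using gt b c by (simp_all add: field_simps)
  then have "b * \<gamma>\<^sub>0 < b * Re s0" by simp
  then have "Re s0 > \<gamma>\<^sub>0" using b by simp
  then have H: "?H \<midarrow>s0\<rightarrow> ?H s0"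
    using hol holomorphic_on_imp_continuous_on continuous_on_eq_continuous_at[OF open_halfspace_Re_gt[of \<gamma>\<^sub>0]] isContD by blast
  note holK = zero_factorization_holomorphic[OF F]
  have K0: "?K a = 0" using zero_factorization_zero_iff[OF F a(2)] a(1) by simp
  have dK: "(?K has_field_derivative deriv ?K a) (at a)"
    using a by (intro holomorphic_derivI[OF holK slit_plane_facts(1)]) auto
  have lin: "((\<lambda>s. ?\<beta> * s) \<longlongrightarrow> a) (at s0)" using tendsto_mult[OF tendsto_const tendsto_ident_at, of ?\<beta> s0 UNIV] unfolding bs .
  have Klim: "((\<lambda>s. ?K (?\<beta> * s)) \<longlongrightarrow> 0) (at s0)"
    using isCont_tendsto_compose[OF DERIV_isCont[OF dK] lin] K0 by simp
  have "isCont (deriv ?K) a"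
    using holomorphic_deriv[OF holK slit_plane_facts(1)] a holomorphic_on_imp_continuous_on
      continuous_on_eq_continuous_at[OF slit_plane_facts(1)] by blast
  then have dKlim: "((\<lambda>s. deriv ?K (?\<beta> * s)) \<longlongrightarrow> deriv ?K a) (at s0)" using lin by (rule isCont_tendsto_compose)
  have "((\<lambda>s. ?K (?\<beta> * s) * (?H s - s / of_real c - 1 / (2 * of_real b))) \<longlongrightarrow>
      0 * (?H s0 - s0 / of_real c - 1 / (2 * of_real b))) (at s0)"
    by (intro tendsto_intros Klim H) (use b c in auto)
  moreover have "eventually (\<lambda>s. ?K (?\<beta> * s) * (?H s - s / of_real c - 1 / (2 * of_real b)) = s / of_real c * deriv ?K (?\<beta> * s)) (at s0)"
  proof -
    have "eventually (\<lambda>z. (?K z - ?K a) / (z - a) \<noteq> 0) (at a)"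
      using dK zero_factorization_simple[OF F a] unfolding has_field_derivative_iff by (rule tendsto_imp_eventually_ne)
    then have "eventually (\<lambda>z. ?K z \<noteq> 0) (at a)" by (rule eventually_mono) (use K0 in auto)
    moreover have "filterlim (\<lambda>s. ?\<beta> * s) (at a) (at s0)"
      unfolding filterlim_at
    proof (intro conjI lin)
      have "?\<beta> * s \<noteq> a" if "s \<noteq> s0" for s using that \<beta>0 unfolding bs[symmetric] by (simp only: mult_cancel_left) simp
      then show "eventually (\<lambda>s. ?\<beta> * s \<in> UNIV \<and> ?\<beta> * s \<noteq> a) (at s0)" unfolding eventually_at_filter by (intro always_eventually) blast
    qed
    ultimately have "eventually (\<lambda>s. ?K (?\<beta> * s) \<noteq> 0) (at s0)" by (rule eventually_compose_filterlim)
    then show ?thesis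
    proof eventually_elim
      case (elim s)
      have e: "s * of_real b / of_real c = ?\<beta> * s" by simp
      show ?case unfolding sigma_transform_def e using elim by simp
    qed
  qed
  ultimately have "((\<lambda>s. s / of_real c * deriv ?K (?\<beta> * s)) \<longlongrightarrow> 0) (at s0)"
    by (simp add: tendsto_cong)
  moreover have "((\<lambda>s. s / of_real c * deriv ?K (?\<beta> * s)) \<longlongrightarrow> s0 / of_real c * deriv ?K a) (at s0)"
    by (intro tendsto_intros dKlim) (use c in auto)
  ultimately have "s0 / of_real c * deriv ?K a = 0" using tendsto_unique at_neq_bot by blast
  moreover have "a \<noteq> 0" using a(2) by auto
  ultimately show False using zero_factorization_simple[OF F a] c \<beta>0 by (simp add: s0_def)
qed

text \<open>
  Every admissible line has positive abscissa, by the hypothesis on negative abscissae, and lies to the right of all zeros. So each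
  principal part contributes its residue, and the regular part a limit \<open>Q\<close> that does not depend on the line. The factor
  \<open>c / b\<^sup>2\<close> collects the factor \<open>1 / b\<close> of the transform and the change of variable \<open>z = b s / c\<close>.
\<close>
lemma sigma_has_inverse_laplace:
  fixes t :: real and Q :: complex
  defines "\<tau> \<equiv> c * t / b"
  assumes t: "t > 0"
    and cut: "\<And>\<gamma>\<^sub>0. \<gamma>\<^sub>0 < 0 \<Longrightarrow> \<not> sigma_transform b c \<nu> holomorphic_on {s. Re s > \<gamma>\<^sub>0}"
    and Q: "\<And>\<gamma>. \<gamma> > 0 \<Longrightarrow> ((\<lambda>T. contour_integral (linepath (Complex \<gamma> (- T)) (Complex \<gamma> T))
        (\<lambda>z. regular_part Z g z * exp (of_real \<tau> * z))) \<longlongrightarrow> Q) at_top"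
  shows "has_inverse_laplace (sigma_transform b c \<nu>) t
     (of_real (c / b\<^sup>2) * ((\<Sum>a\<in>Z. a * exp (of_real \<tau> * a)) + Q / (2 * of_real pi * \<i>)))"
  unfolding has_inverse_laplace_def
proof (intro conjI allI impI)
  show "\<exists>\<gamma>. right_of_singularities (sigma_transform b c \<nu>) \<gamma>" by (rule sigma_transform_admissible_exists)
  fix \<gamma> assume "right_of_singularities (sigma_transform b c \<nu>) \<gamma>"
  then obtain \<gamma>0 where \<gamma>0: "\<gamma>0 < \<gamma>" "sigma_transform b c \<nu> holomorphic_on {s. Re s > \<gamma>0}"
    by (auto simp: right_of_singularities_def)
  let ?\<beta> = "complex_of_real (b / c)"
  let ?P = "\<lambda>z. regular_part Z g z * exp (of_real \<tau> * z)"
  let ?E = "\<lambda>a z. a * (exp (of_real \<tau> * z) / (z - a))"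
  define \<delta> where "\<delta> = b / c * \<gamma>"
  have fin: "finite Z" using F by (simp add: zero_factorization_def)
  have \<tau>: "\<tau> > 0" using t b c by (simp add: \<tau>_def)
  have \<beta>0: "?\<beta> \<noteq> 0" using b c by simp
  have "\<gamma>0 \<ge> 0" using cut[of \<gamma>0] \<gamma>0(2) by (meson not_less)
  then have \<delta>: "\<delta> > 0" using \<gamma>0 b c by (simp add: \<delta>_def)
  have Z\<delta>: "Re a < \<delta>" if "a \<in> Z" for a
  proof (cases "a \<in> \<real>\<^sub>\<le>\<^sub>0")
    case True
    then show ?thesis using \<delta> by (simp add: complex_nonpos_Reals_iff)
  next
    case False
    have "Re a \<le> b / c * \<gamma>0" by (rule sigma_transform_zero_not_right[OF \<gamma>0(2) that False])
    also have "\<dots> < \<delta>" unfolding \<delta>_def using \<gamma>0(1) b c by (intro mult_strict_left_mono) auto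
    finally show ?thesis .
  qed
  have seg: "z \<notin> \<real>\<^sub>\<le>\<^sub>0" "z \<notin> Z" if "z \<in> closed_segment (Complex \<delta> (- T)) (Complex \<delta> T)" for z T
  proof -
    have "Re z = \<delta>" using segment_re_im_bounds(1,2)[OF that] by simp
    then show "z \<notin> \<real>\<^sub>\<le>\<^sub>0" "z \<notin> Z" using \<delta> Z\<delta>[of z] by (auto simp: complex_nonpos_Reals_iff)
  qed
  have intP: "?P contour_integrable_on linepath (Complex \<delta> (- T)) (Complex \<delta> T)" for T
    by (intro contour_integrable_continuous_linepath continuous_intros
         continuous_on_subset[OF holomorphic_on_imp_continuous_on[OF regular_part_holomorphic[OF F]]]) (use seg in auto)
  have intE0: "(\<lambda>z. exp (of_real \<tau> * z) / (z - a)) contour_integrable_on linepath (Complex \<delta> (- T)) (Complex \<delta> T)" if "a \<in> Z" for a T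
    by (intro contour_integrable_continuous_linepath continuous_intros) (use seg that in auto)
  have intE: "?E a contour_integrable_on linepath (Complex \<delta> (- T)) (Complex \<delta> T)" if "a \<in> Z" for a T
    by (rule contour_integrable_lmul[OF intE0[OF that]])
  have eq: "contour_integral (linepath (Complex \<gamma> (- T)) (Complex \<gamma> T)) (\<lambda>s. sigma_transform b c \<nu> s * exp (of_real t * s)) =
     of_real (c / b\<^sup>2) * (contour_integral (linepath (Complex \<delta> (- (b / c * T))) (Complex \<delta> (b / c * T))) ?P +
        (\<Sum>a\<in>Z. a * contour_integral (linepath (Complex \<delta> (- (b / c * T))) (Complex \<delta> (b / c * T))) (\<lambda>z. exp (of_real \<tau> * z) / (z - a))))" for T
  proof -
    let ?l = "linepath (Complex \<delta> (- (b / c * T))) (Complex \<delta> (b / c * T))"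
    have ends: "?\<beta> * Complex \<gamma> (- T) = Complex \<delta> (- (b / c * T))" "?\<beta> * Complex \<gamma> T = Complex \<delta> (b / c * T)"
      by (simp_all add: \<delta>_def complex_eq_iff)
    have "contour_integral (linepath (Complex \<gamma> (- T)) (Complex \<gamma> T)) (\<lambda>s. sigma_transform b c \<nu> s * exp (of_real t * s)) =
      contour_integral (linepath (Complex \<gamma> (- T)) (Complex \<gamma> T)) (\<lambda>s. (\<lambda>z. 1 / of_real b * (?P z + (\<Sum>a\<in>Z. ?E a z))) (?\<beta> * s))"
    proof (rule contour_integral_cong[OF refl])
      fix s assume s: "s \<in> path_image (linepath (Complex \<gamma> (- T)) (Complex \<gamma> T))"
      then have Re: "Re s = \<gamma>" using segment_re_im_bounds(1,2)[of s] by fastforce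
      have Re\<beta>: "Re (?\<beta> * s) = \<delta>" using Re by (simp add: \<delta>_def)
      have ok: "?\<beta> * s \<notin> \<real>\<^sub>\<le>\<^sub>0" "?\<beta> * s \<notin> Z" using Re\<beta> \<delta> Z\<delta>[of "?\<beta> * s"] unfolding complex_nonpos_Reals_iff by force+
      have "of_real \<tau> * (?\<beta> * s) = of_real t * s" using b c by (simp add: \<tau>_def)
      then show "sigma_transform b c \<nu> s * exp (of_real t * s) = 1 / of_real b * (?P (?\<beta> * s) + (\<Sum>a\<in>Z. ?E a (?\<beta> * s)))"
        unfolding sigma_transform_eq[OF ok] by (simp add: sum_distrib_left sum_distrib_right algebra_simps)
    qed
    also have "\<dots> = contour_integral ?l (\<lambda>z. 1 / of_real b * (?P z + (\<Sum>a\<in>Z. ?E a z))) / ?\<beta>"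
      using contour_integral_linepath_scale[OF \<beta>0, of "Complex \<gamma> (- T)" "Complex \<gamma> T" "\<lambda>z. 1 / of_real b * (?P z + (\<Sum>a\<in>Z. ?E a z))"]
      unfolding ends .
    also have "contour_integral ?l (\<lambda>z. 1 / of_real b * (?P z + (\<Sum>a\<in>Z. ?E a z))) = 1 / of_real b * contour_integral ?l (\<lambda>z. ?P z + (\<Sum>a\<in>Z. ?E a z))"
      by (intro contour_integral_lmul contour_integrable_add contour_integrable_sum intP intE fin)
    also have "contour_integral ?l (\<lambda>z. ?P z + (\<Sum>a\<in>Z. ?E a z)) = contour_integral ?l ?P + (\<Sum>a\<in>Z. contour_integral ?l (?E a))"
      by (simp only: contour_integral_add[OF intP contour_integrable_sum[OF fin intE]] contour_integral_sum[OF fin intE])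
    also have "(\<Sum>a\<in>Z. contour_integral ?l (?E a)) = (\<Sum>a\<in>Z. a * contour_integral ?l (\<lambda>z. exp (of_real \<tau> * z) / (z - a)))"
      by (intro sum.cong refl contour_integral_lmul intE0)
    finally show ?thesis using b c by (simp add: power2_eq_square)
  qed
  have scale: "filterlim (\<lambda>T. b / c * T) at_top at_top" using b c by (intro filterlim_tendsto_pos_mult_at_top[OF tendsto_const] filterlim_ident) auto
  have "((\<lambda>T. of_real (c / b\<^sup>2) * (contour_integral (linepath (Complex \<delta> (- (b / c * T))) (Complex \<delta> (b / c * T))) ?P +
        (\<Sum>a\<in>Z. a * contour_integral (linepath (Complex \<delta> (- (b / c * T))) (Complex \<delta> (b / c * T))) (\<lambda>z. exp (of_real \<tau> * z) / (z - a)))))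
     \<longlongrightarrow> of_real (c / b\<^sup>2) * (Q + (\<Sum>a\<in>Z. a * (2 * of_real pi * \<i> * exp (of_real \<tau> * a))))) at_top"
    by (intro tendsto_intros filterlim_compose[OF Q[OF \<delta>] scale] filterlim_compose[OF bromwich_simple_pole[OF \<tau> Z\<delta>] scale])
  then have "((\<lambda>T. 1 / (2 * of_real pi * \<i>) * contour_integral (linepath (Complex \<gamma> (- T)) (Complex \<gamma> T)) (\<lambda>s. sigma_transform b c \<nu> s * exp (of_real t * s)))
     \<longlongrightarrow> 1 / (2 * of_real pi * \<i>) * (of_real (c / b\<^sup>2) * (Q + (\<Sum>a\<in>Z. a * (2 * of_real pi * \<i> * exp (of_real \<tau> * a)))))) at_top"
    unfolding eq[symmetric] by (intro tendsto_mult tendsto_const)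
  moreover have "1 / (2 * of_real pi * \<i>) * (of_real (c / b\<^sup>2) * (Q + (\<Sum>a\<in>Z. a * (2 * of_real pi * \<i> * exp (of_real \<tau> * a))))) =
      of_real (c / b\<^sup>2) * ((\<Sum>a\<in>Z. a * exp (of_real \<tau> * a)) + Q / (2 * of_real pi * \<i>))"
  proof -
    have "(\<Sum>a\<in>Z. a * (2 * of_real pi * \<i> * exp (of_real \<tau> * a))) = 2 * of_real pi * \<i> * (\<Sum>a\<in>Z. a * exp (of_real \<tau> * a))"
      by (simp add: sum_distrib_left mult_ac)
    moreover have "1 / p * (C * (Q + p * S)) = C * (S + Q / p)" if "p \<noteq> 0" for p C S :: complex
      using that by (simp add: field_simps)
    moreover have "2 * of_real pi * \<i> \<noteq> (0::complex)" by simp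
    ultimately show ?thesis by (simp only:)
  qed
  ultimately show "((\<lambda>T. 1 / (2 * of_real pi * \<i>) * contour_integral (linepath (Complex \<gamma> (- T)) (Complex \<gamma> T)) (\<lambda>s. sigma_transform b c \<nu> s * exp (of_real t * s)))
     \<longlongrightarrow> of_real (c / b\<^sup>2) * ((\<Sum>a\<in>Z. a * exp (of_real \<tau> * a)) + Q / (2 * of_real pi * \<i>))) at_top"
    by (simp only:)
qed

end

section \<open>The transform at half-integer order\<close>

text \<open>
  The function is an elementary factor times a polynomial. The logarithmic derivative \<open>- 1 - 1 / (2 z) - n / z\<close> of the
  factor cancels the remaining terms of the regular part, since there are \<open>n\<close> zeros.
\<close>
lemma half_integer_factorization:
  obtains g where "zero_factorization (bessel_K (of_nat n + 1 / 2)) (bessel_K_zeros (of_nat n + 1 / 2)) g"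
    "\<And>z. z \<notin> \<real>\<^sub>\<le>\<^sub>0 \<Longrightarrow> regular_part (bessel_K_zeros (of_nat n + 1 / 2)) g z = 0"
proof -
  let ?\<nu> = "of_nat n + 1 / 2 :: complex"
  let ?Z = "bessel_K_zeros ?\<nu>"
  obtain k where k: "k \<noteq> 0" "\<And>z. poly (reverse_bessel_poly n) z = k * (\<Prod>a\<in>?Z. z - a)"
    using reverse_bessel_poly_factor[of n] by blast
  define C where "C = of_real pi / 2 * rGamma (1 / 2 :: complex) * k"
  have "rGamma (1/2 :: complex) \<noteq> 0" using rGamma_eq_zero_iff[of "1/2::complex"] by (auto elim!: nonpos_Ints_cases simp: complex_eq_iff)
  then have C0: "C \<noteq> 0" using k(1) by (simp add: C_def)
  define g where "g = (\<lambda>z. C * ((z / 2) powr (- (1 / 2)) * exp (- z)) / z ^ n)"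
  have dg: "(g has_field_derivative g z * (- 1 - 1 / (2 * z) - of_nat n / z)) (at z)" if z: "z \<notin> \<real>\<^sub>\<le>\<^sub>0" for z
  proof -
    have z0: "z \<noteq> 0" using z by auto
    have z2: "z / 2 \<notin> \<real>\<^sub>\<le>\<^sub>0" using z by (auto simp: complex_nonpos_Reals_iff)
    have "((\<lambda>z. (z / 2) powr (- (1/2))) has_field_derivative - (1/2) * (z / 2) powr (- (1/2) - 1) * (1 / 2)) (at z)"
      by (rule DERIV_chain2[where f="\<lambda>w. w powr (- (1/2))" and g="\<lambda>z. z / 2", OF has_field_derivative_powr[OF z2]])
         (auto intro!: derivative_eq_intros)
    moreover have "- (1/2) * (z / 2) powr (- (1/2) - 1) * (1 / 2) = - (1 / (2 * z)) * (z / 2) powr (- (1/2))"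
    proof -
      have "w powr (- (1/2) - 1) = w powr (- (1/2)) / w" if "w \<noteq> 0" for w :: complex
        using powr_diff[of w "- (1/2)" 1] that by simp
      moreover have "z / 2 \<noteq> 0" using z0 by simp
      ultimately have "(z / 2) powr (- (1/2) - 1) = (z / 2) powr (- (1/2)) / (z / 2)" by blast
      moreover have "- (1/2) * (p / (z / 2)) * (1 / 2) = - (1 / (2 * z)) * p" for p using z0 by (simp add: field_simps)
      ultimately show ?thesis by (simp only:)
    qed
    ultimately have d1: "((\<lambda>z. (z / 2) powr (- (1/2))) has_field_derivative - (1 / (2 * z)) * (z / 2) powr (- (1/2))) (at z)" by simp
    have d2: "((\<lambda>z. exp (- z)) has_field_derivative - exp (- z)) (at z)" by (auto intro!: derivative_eq_intros)
    have d3: "((\<lambda>z. z ^ n) has_field_derivative of_nat n / z * z ^ n) (at z)"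
    proof -
      have "((\<lambda>z. z ^ n) has_field_derivative of_nat n * z ^ (n - 1)) (at z)" by (auto intro!: derivative_eq_intros)
      moreover have "of_nat n * z ^ (n - 1) = of_nat n / z * z ^ n" using z0 by (cases n) auto
      ultimately show ?thesis by simp
    qed
    have "(g has_field_derivative (C * (- (1 / (2 * z)) * (z / 2) powr (- (1/2)) * exp (- z) + - exp (- z) * (z / 2) powr (- (1/2))) * z ^ n
       - C * ((z / 2) powr (- (1/2)) * exp (- z)) * (of_nat n / z * z ^ n)) / (z ^ n * z ^ n)) (at z)"
      unfolding g_def using z0 by (intro DERIV_divide DERIV_cmult DERIV_mult d1 d2 d3) auto
    moreover have "(C * (- (1 / (2 * z)) * p * e + - e * p) * q - C * (p * e) * (of_nat n / z * q)) / (q * q)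
       = C * (p * e) / q * (- 1 - 1 / (2 * z) - of_nat n / z)" if "q \<noteq> 0" for p e q
      using z0 that by (simp add: field_simps)
    ultimately show ?thesis using z0 by (simp add: g_def)
  qed
  have g0: "g z \<noteq> 0" if "z \<notin> \<real>\<^sub>\<le>\<^sub>0" for z using that C0 by (auto simp: g_def)
  have "g holomorphic_on (- \<real>\<^sub>\<le>\<^sub>0)"
    using dg by (subst holomorphic_on_open[OF slit_plane_facts(1)]) auto
  moreover have "bessel_K ?\<nu> z = (\<Prod>a\<in>?Z. z - a) * g z" if "z \<notin> \<real>\<^sub>\<le>\<^sub>0" for z
  proof -
    have z0: "z \<noteq> 0" using that by auto
    show ?thesis unfolding bessel_K_half_integer_poly[OF z0] k(2) by (simp add: g_def C_def)
  qed
  ultimately have "zero_factorization (bessel_K ?\<nu>) ?Z g"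
    using g0 bessel_K_zeros_half_integer_finite[of n] by (simp add: zero_factorization_def)
  moreover have "regular_part ?Z g z = 0" if z: "z \<notin> \<real>\<^sub>\<le>\<^sub>0" for z
  proof -
    have z0: "z \<noteq> 0" using z by auto
    have "z * deriv g z / g z = z * (- 1 - 1 / (2 * z) - of_nat n / z)"
      using DERIV_imp_deriv[OF dg[OF z]] g0[OF z] by simp
    also have "\<dots> = - z - 1 / 2 - of_nat n" using z0 by (simp add: field_simps)
    finally show ?thesis by (simp add: regular_part_def bessel_K_zeros_half_integer_card)
  qed
  ultimately show ?thesis by (rule that)
qed

text \<open>
  At the origin the factor \<open>s\<close> annihilates the logarithmic derivative, whereas the limit along the positive axis
  is different; so no admissible abscissa is negative.
\<close>
lemma half_integer_not_holomorphic_at_0: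
  assumes b: "b > 0" and c: "c > 0" and neg: "\<gamma>\<^sub>0 < 0"
  shows "\<not> sigma_transform b c (of_nat n + 1 / 2) holomorphic_on {s. Re s > \<gamma>\<^sub>0}"
proof
  let ?\<nu> = "of_nat n + 1 / 2 :: complex"
  let ?H = "sigma_transform b c ?\<nu>" and ?Z = "bessel_K_zeros ?\<nu>"
  assume hol: "?H holomorphic_on {s. Re s > \<gamma>\<^sub>0}"
  obtain g where F: "zero_factorization (bessel_K ?\<nu>) ?Z g"
    and reg: "\<And>z. z \<notin> \<real>\<^sub>\<le>\<^sub>0 \<Longrightarrow> regular_part ?Z g z = 0" using half_integer_factorization by blast
  have fin: "finite ?Z" by (rule bessel_K_zeros_half_integer_finite)
  have Z0: "0 \<notin> ?Z" by (simp add: bessel_K_zeros_def)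
  have cont: "isCont ?H 0"
    using holomorphic_on_imp_continuous_on[OF hol] neg unfolding continuous_on_eq_continuous_at[OF open_halfspace_Re_gt[of \<gamma>\<^sub>0]] by auto
  have of0: "((\<lambda>x. complex_of_real x) \<longlongrightarrow> 0) (at_right 0)"
    using tendsto_of_real[OF tendsto_ident_at, of "0::real" "{0<..}"] by simp
  have 1: "((\<lambda>x. ?H (of_real x)) \<longlongrightarrow> ?H 0) (at_right 0)" by (rule isCont_tendsto_compose[OF cont of0])
  have \<beta>lim: "((\<lambda>x. of_real (b / c) * complex_of_real x) \<longlongrightarrow> of_real (b / c) * 0) (at_right 0)"
    by (intro tendsto_intros of0)
  have "((\<lambda>x. 1 / of_real b * (\<Sum>a\<in>?Z. a / (of_real (b / c) * of_real x - a))) \<longlongrightarrow>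
      1 / of_real b * (\<Sum>a\<in>?Z. a / (of_real (b / c) * 0 - a))) (at_right (0::real))"
    by (intro tendsto_intros of0) (use Z0 in auto)
  also have "(\<Sum>a\<in>?Z. a / (of_real (b / c) * 0 - a)) = (\<Sum>a\<in>?Z. - 1)"
    by (rule sum.cong) (use Z0 in auto)
  also have "\<dots> = - of_nat n" by (simp add: bessel_K_zeros_half_integer_card)
  finally have 2: "((\<lambda>x. 1 / of_real b * (\<Sum>a\<in>?Z. a / (of_real (b / c) * of_real x - a))) \<longlongrightarrow> 1 / of_real b * (- of_nat n)) (at_right (0::real))" .
  have "eventually (\<lambda>x. of_real (b / c) * complex_of_real x \<in> - ?Z) (at_right 0)"
    by (rule topological_tendstoD[OF \<beta>lim]) (use fin Z0 in \<open>auto simp: finite_imp_closed\<close>)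
  then have "eventually (\<lambda>x. 1 / of_real b * (\<Sum>a\<in>?Z. a / (of_real (b / c) * of_real x - a)) = ?H (of_real x)) (at_right 0)"
    using eventually_at_right_less[of 0]
  proof eventually_elim
    case (elim x)
    have "b / c * x > 0" using elim b c by simp
    then have ok: "of_real (b / c) * complex_of_real x \<notin> \<real>\<^sub>\<le>\<^sub>0" by (simp add: complex_nonpos_Reals_iff)
    show ?case using sigma_transform_eq[OF b c F ok] elim reg[OF ok] by simp
  qed
  with 2 have "((\<lambda>x. ?H (of_real x)) \<longlongrightarrow> 1 / of_real b * (- of_nat n)) (at_right 0)" by (rule Lim_transform_eventually)
  then have "?H 0 = 1 / of_real b * (- of_nat n)" using 1 tendsto_unique trivial_limit_at_right_real by blast
  moreover have "?H 0 = 1 / (2 * of_real b)" by (simp add: sigma_transform_def)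
  ultimately have "1 / (2 * of_real b) = 1 / of_real b * (- of_nat n :: complex)" by simp
  then have "(1::complex) = - (2 * of_nat n)" using b by (simp add: field_simps)
  then have "Re 1 = Re (- (2 * of_nat n))" by simp
  then show False by simp
qed

lemma half_integer_inverse_laplace:
  assumes "b > 0" "c > 0" "t > 0"
  shows "has_inverse_laplace (sigma_transform b c (of_nat n + 1 / 2)) t
     (of_real (c / b\<^sup>2) * (\<Sum>z\<in>bessel_K_zeros (of_nat n + 1 / 2). z * exp (of_real (c * t / b) * z)))"
proof -
  let ?\<nu> = "of_nat n + 1 / 2 :: complex"
  obtain g where F: "zero_factorization (bessel_K ?\<nu>) (bessel_K_zeros ?\<nu>) g"
    and reg: "\<And>z. z \<notin> \<real>\<^sub>\<le>\<^sub>0 \<Longrightarrow> regular_part (bessel_K_zeros ?\<nu>) g z = 0" using half_integer_factorization by blast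
  have "((\<lambda>T. contour_integral (linepath (Complex \<gamma> (- T)) (Complex \<gamma> T))
        (\<lambda>z. regular_part (bessel_K_zeros ?\<nu>) g z * exp (of_real (c * t / b) * z))) \<longlongrightarrow> 0) at_top" if "\<gamma> > 0" for \<gamma>
  proof -
    have "contour_integral (linepath (Complex \<gamma> (- T)) (Complex \<gamma> T))
        (\<lambda>z. regular_part (bessel_K_zeros ?\<nu>) g z * exp (of_real (c * t / b) * z)) =
        contour_integral (linepath (Complex \<gamma> (- T)) (Complex \<gamma> T)) (\<lambda>z. 0)" for T
    proof (rule contour_integral_cong[OF refl])
      fix z assume "z \<in> path_image (linepath (Complex \<gamma> (- T)) (Complex \<gamma> T))"
      then have "z \<in> closed_segment (Complex \<gamma> (- T)) (Complex \<gamma> T)" by simp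
      from segment_re_im_bounds(2)[OF this] have "z \<notin> \<real>\<^sub>\<le>\<^sub>0" using that by (auto simp: complex_nonpos_Reals_iff)
      then show "regular_part (bessel_K_zeros ?\<nu>) g z * exp (of_real (c * t / b) * z) = 0" by (simp add: reg)
    qed
    then show ?thesis by simp
  qed
  from sigma_has_inverse_laplace[OF assms(1,2) F assms(3) half_integer_not_holomorphic_at_0[OF assms(1,2)] this]
  show ?thesis by simp
qed

section \<open>The transform at integer order\<close>

lemma bessel_K_zeros_of_nat: "bessel_K_zeros (of_nat n) = {z. z \<noteq> 0 \<and> integer_K n z = 0}"
  by (simp add: bessel_K_zeros_def integer_K_def)

lemma integer_zeros_off_cut:
  assumes "a \<in> bessel_K_zeros (of_nat n)"
  shows "a \<notin> \<real>\<^sub>\<le>\<^sub>0" "Im a \<noteq> 0"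
proof -
  have a: "a \<noteq> 0" "integer_K n a = 0" using assms by (auto simp: bessel_K_zeros_of_nat)
  show "Im a \<noteq> 0"
  proof
    assume "Im a = 0"
    then have "a = of_real (Re a)" by (simp add: complex_eq_iff)
    moreover have "Re a \<noteq> 0" using a(1) \<open>Im a = 0\<close> by (auto simp: complex_eq_iff)
    ultimately show False using a(2) integer_K_nonzero_real[of "Re a" n] by metis
  qed
  then show "a \<notin> \<real>\<^sub>\<le>\<^sub>0" by (simp add: complex_nonpos_Reals_iff)
qed

lemma Ln_half_at_infinity: "filterlim (\<lambda>z. Ln (z / 2)) at_infinity (at 0)"
proof -
  have "filterlim (\<lambda>x::real. - ln x) at_top (at_right 0)" using ln_at_0 by (simp add: filterlim_uminus_at_top)
  moreover have "filterlim (\<lambda>z::complex. norm (z/2)) (at_right 0) (at 0)"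
    unfolding filterlim_at by (auto intro!: tendsto_eq_intros simp: eventually_at_filter)
  ultimately have "filterlim (\<lambda>z::complex. - ln (norm (z/2))) at_top (at 0)" by (rule filterlim_compose)
  then have "filterlim (\<lambda>z. norm (Ln (z/2))) at_top (at 0)"
  proof (rule filterlim_at_top_mono)
    have "- ln (norm (z/2)) \<le> norm (Ln (z/2))" if "z \<noteq> 0" for z :: complex
      using abs_Re_le_cmod[of "Ln (z/2)"] that by simp
    then show "eventually (\<lambda>z::complex. - ln (norm (z/2)) \<le> norm (Ln (z/2))) (at 0)" by (auto simp: eventually_at_filter)
  qed
  then show ?thesis by (rule filterlim_norm_at_top_imp_at_infinity)
qed

text \<open>
  This keeps the zeros away from the branch point, and it provides the value there of the regular part.
\<close>
lemma integer_K_ratio_at_0: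
  shows "eventually (\<lambda>z. integer_K n z \<noteq> 0) (at 0)"
    and "((\<lambda>z. z * integer_K (n + 1) z / integer_K n z) \<longlongrightarrow> 2 * of_nat n) (at 0)"
proof -
  have "eventually (\<lambda>z. integer_K n z \<noteq> 0) (at 0) \<and> ((\<lambda>z. z * integer_K (n + 1) z / integer_K n z) \<longlongrightarrow> 2 * of_nat n) (at 0)"
  proof (cases n)
    case 0
    have "filterlim (\<lambda>z. - Ln (z / 2)) at_infinity (at 0)"
      using Ln_half_at_infinity by (simp add: filterlim_at_infinity_conv_norm_at_top)
    from tendsto_add_filterlim_at_infinity[OF integer_K_0_tendsto this]
    have inf: "filterlim (integer_K 0) at_infinity (at 0)" by simp
    have "((\<lambda>z. 2 * ((z/2) ^ Suc 0 * integer_K (Suc 0) z) * inverse (integer_K 0 z)) \<longlongrightarrow> 2 * (fact 0 / 2) * 0) (at 0)"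
      by (rule tendsto_mult[OF tendsto_mult[OF tendsto_const integer_K_Suc_tendsto] filterlim_compose[OF tendsto_inverse_0 inf]])
    moreover have "2 * ((z/2) ^ Suc 0 * integer_K (Suc 0) z) * inverse (integer_K 0 z) = z * integer_K (0 + 1) z / integer_K 0 z" for z
      by (simp add: divide_inverse[of _ "integer_K 0 z"])
    ultimately have "((\<lambda>z. z * integer_K (0 + 1) z / integer_K 0 z) \<longlongrightarrow> 0) (at 0)" by (simp only: mult_zero_right)
    moreover have "eventually (\<lambda>z. integer_K 0 z \<noteq> 0) (at 0)"
      by (rule filterlim_at_infinity_imp_eventually_ne[OF inf])
    ultimately show ?thesis using 0 by simp
  next
    case (Suc m)
    note lim = integer_K_Suc_tendsto[of m]
    have "eventually (\<lambda>z. (z/2) ^ Suc m * integer_K (Suc m) z \<noteq> 0) (at 0)"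
      by (rule tendsto_imp_eventually_ne[OF lim]) simp
    then have ne: "eventually (\<lambda>z. integer_K n z \<noteq> 0) (at 0)" unfolding Suc by (rule eventually_mono) simp
    have "((\<lambda>z. 2 * ((z/2) ^ Suc n * integer_K (Suc n) z) / ((z/2) ^ Suc m * integer_K (Suc m) z)) \<longlongrightarrow> 2 * (fact n / 2) / (fact m / 2)) (at 0)"
      by (rule tendsto_divide[OF tendsto_mult[OF tendsto_const integer_K_Suc_tendsto] lim]) simp
    also have "2 * (fact n / 2) / (fact m / 2) = (2 * of_nat n :: complex)" by (simp add: Suc)
    finally have "((\<lambda>z. z * integer_K (n + 1) z / integer_K n z) \<longlongrightarrow> 2 * of_nat n) (at 0)"
    proof (rule Lim_transform_eventually)
      have "2 * ((z/2) ^ Suc n * integer_K (Suc n) z) / ((z/2) ^ Suc m * integer_K (Suc m) z) = z * integer_K (n + 1) z / integer_K n z" if "z \<noteq> 0" for z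
      proof -
        have "2 * (w * p * x) / (p * y) = 2 * w * x / y" if "p \<noteq> 0" for w p x y :: complex using that by simp
        from this[of "(z/2) ^ n" "z/2"] show ?thesis using that by (simp add: Suc)
      qed
      then show "eventually (\<lambda>z. 2 * ((z/2) ^ Suc n * integer_K (Suc n) z) / ((z/2) ^ Suc m * integer_K (Suc m) z) = z * integer_K (n + 1) z / integer_K n z) (at 0)"
        unfolding eventually_at_filter by (intro always_eventually allI impI)
    qed
    then show ?thesis using ne by simp
  qed
  then show "eventually (\<lambda>z. integer_K n z \<noteq> 0) (at 0)" "((\<lambda>z. z * integer_K (n + 1) z / integer_K n z) \<longlongrightarrow> 2 * of_nat n) (at 0)" by auto
qed

lemma integer_zeros_cnj: "a \<in> bessel_K_zeros (of_nat n) \<Longrightarrow> cnj a \<in> bessel_K_zeros (of_nat n)"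
  using integer_zeros_off_cut[of a n] integer_K_cnj[of a n] by (auto simp: bessel_K_zeros_of_nat)

text \<open>
  The zeros in the upper half-plane stay away from the origin, from infinity and from the real axis, so
  they form a compact subset of the open half-plane.
\<close>
lemma integer_zeros_finite: "finite (bessel_K_zeros (of_nat n))"
proof -
  let ?Z = "bessel_K_zeros (of_nat n)"
  obtain R C where RC: "\<And>z. z \<notin> \<real>\<^sub>\<le>\<^sub>0 \<Longrightarrow> R \<le> norm z \<Longrightarrow> integer_K n z \<noteq> 0"
    using dirichlet_to_neumann_decay_slit[of n] by blast
  obtain e where e: "e > 0" "\<And>z. z \<noteq> 0 \<Longrightarrow> norm z < e \<Longrightarrow> integer_K n z \<noteq> 0"
    using integer_K_ratio_at_0(1)[of n] by (auto simp: eventually_at)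
  define A where "A = {z. Im z \<ge> 0} \<inter> (- ball 0 e) \<inter> cball 0 R"
  define B where "B = {z\<in>A. integer_K n z = 0}"
  have "closed A" unfolding A_def by (intro closed_Int closed_halfspace_Im_ge closed_Compl) auto
  moreover have "continuous_on A (integer_K n)"
    by (rule continuous_on_subset[OF integer_K_continuous_upper]) (use e(1) in \<open>auto simp: A_def\<close>)
  ultimately have "closed B" unfolding B_def using continuous_closed_preimage_constant by blast
  moreover have "bounded B" by (rule bounded_subset[of "cball 0 R"]) (auto simp: A_def B_def)
  ultimately have cB: "compact B" by (simp add: compact_eq_bounded_closed)
  have BZ: "B \<subseteq> ?Z" using e(1) by (auto simp: B_def A_def bessel_K_zeros_of_nat)
  then have Bup: "B \<subseteq> {z. Im z > 0}" using integer_zeros_off_cut(2) by (fastforce simp: B_def A_def)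
  have up: "{z. Im z > 0} \<subseteq> (- \<real>\<^sub>\<le>\<^sub>0 :: complex set)" by (auto simp: complex_nonpos_Reals_iff)
  have "finite B"
  proof (cases "B = {}")
    case False
    have "\<not> integer_K n constant_on {z. Im z > 0}"
    proof
      assume "integer_K n constant_on {z. Im z > 0}"
      then obtain k where k: "\<And>z. Im z > 0 \<Longrightarrow> integer_K n z = k" by (auto simp: constant_on_def)
      then have "k = 0" using False Bup by (auto simp: B_def)
      then have "integer_K n (Complex 0 (max 1 R)) = 0" using k by simp
      moreover have "Complex 0 (max 1 R) \<notin> \<real>\<^sub>\<le>\<^sub>0" "R \<le> norm (Complex 0 (max 1 R))" by (auto simp: complex_nonpos_Reals_iff cmod_def)
      ultimately show False using RC by blast
    qed
    then have "finite {z\<in>B. integer_K n z = 0}"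
      by (intro holomorphic_compact_finite_zeros[OF holomorphic_on_subset[OF integer_K_holomorphic up] open_halfspace_Im_gt _ cB Bup])
         (auto simp: convex_connected convex_halfspace_Im_gt)
    then show ?thesis by (simp add: B_def)
  qed simp
  have upper: "z \<in> B" if "z \<in> ?Z" "Im z \<ge> 0" for z
  proof -
    have z: "z \<noteq> 0" "integer_K n z = 0" using that by (auto simp: bessel_K_zeros_of_nat)
    have "norm z \<ge> e" using e(2)[OF z(1)] z(2) by force
    moreover have "norm z \<le> R" using RC[OF integer_zeros_off_cut(1)[OF that(1)]] z(2) by force
    ultimately show ?thesis using z that by (simp add: B_def A_def)
  qed
  have "?Z \<subseteq> B \<union> cnj ` B"
  proof
    fix z assume z: "z \<in> ?Z"
    show "z \<in> B \<union> cnj ` B"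
    proof (cases "Im z \<ge> 0")
      case False
      then have "cnj z \<in> B" using upper[OF integer_zeros_cnj[OF z]] by simp
      then have "cnj (cnj z) \<in> cnj ` B" by (rule imageI)
      then show ?thesis by simp
    qed (use upper z in simp)
  qed
  then show ?thesis using \<open>finite B\<close> finite_subset by blast
qed

lemma integer_K_deriv: "z \<notin> \<real>\<^sub>\<le>\<^sub>0 \<Longrightarrow> deriv (integer_K n) z = of_nat n / z * integer_K n z - integer_K (n + 1) z"
  by (rule DERIV_imp_deriv[OF integer_K_has_derivative])

text \<open>
  At a multiple zero the next order would vanish too, contradicting the cross product of consecutive orders.
\<close>
lemma integer_factorization:
  obtains g where "zero_factorization (integer_K n) (bessel_K_zeros (of_nat n)) g"
proof -
  let ?Z = "bessel_K_zeros (of_nat n)"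
  have ZS: "?Z \<subseteq> - \<real>\<^sub>\<le>\<^sub>0" using integer_zeros_off_cut(1) by blast
  have "\<exists>g. g holomorphic_on (- \<real>\<^sub>\<le>\<^sub>0) \<and> (\<forall>z\<in>- \<real>\<^sub>\<le>\<^sub>0. integer_K n z = (\<Prod>a\<in>?Z. z - a) * g z)"
    by (rule holomorphic_factor_finite_zeros[OF integer_zeros_finite slit_plane_facts(1) ZS integer_K_holomorphic])
       (simp add: bessel_K_zeros_of_nat)
  then obtain g where g: "g holomorphic_on (- \<real>\<^sub>\<le>\<^sub>0)" "\<And>z. z \<in> - \<real>\<^sub>\<le>\<^sub>0 \<Longrightarrow> integer_K n z = (\<Prod>a\<in>?Z. z - a) * g z"
    by blast
  have "g z \<noteq> 0" if z: "z \<notin> \<real>\<^sub>\<le>\<^sub>0" for z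
  proof
    assume g0: "g z = 0"
    have z0: "z \<noteq> 0" using z by auto
    have K0: "integer_K n z = 0" using g(2)[of z] z g0 by simp
    then have zZ: "z \<in> ?Z" using z0 by (simp add: bessel_K_zeros_of_nat)
    have "((\<lambda>w. \<Prod>a\<in>?Z. w - a) has_field_derivative deriv (\<lambda>w. \<Prod>a\<in>?Z. w - a) z) (at z)"
      by (rule holomorphic_derivI[of _ UNIV]) (auto intro!: holomorphic_intros)
    moreover have "(g has_field_derivative deriv g z) (at z)" using z by (intro holomorphic_derivI[OF g(1) slit_plane_facts(1)]) simp
    ultimately have "((\<lambda>w. (\<Prod>a\<in>?Z. w - a) * g w) has_field_derivative
        deriv (\<lambda>w. \<Prod>a\<in>?Z. w - a) z * g z + deriv g z * (\<Prod>a\<in>?Z. z - a)) (at z)" by (rule DERIV_mult)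
    moreover have "(\<Prod>a\<in>?Z. z - a) = 0" using zZ integer_zeros_finite by auto
    ultimately have "((\<lambda>w. (\<Prod>a\<in>?Z. w - a) * g w) has_field_derivative 0) (at z)" using g0 by simp
    then have "(integer_K n has_field_derivative 0) (at z)"
      by (rule has_field_derivative_transform_within_open[OF _ slit_plane_facts(1)]) (use z g(2) in auto)
    then have "deriv (integer_K n) z = 0" by (rule DERIV_imp_deriv)
    then have "integer_K (n + 1) z = 0" using integer_K_deriv[OF z, of n] K0 by simp
    then show False using integer_I_K_cross_product[OF z, of n] K0 by simp
  qed
  then have "zero_factorization (integer_K n) ?Z g"
    using g integer_zeros_finite by (auto simp: zero_factorization_def)
  then show ?thesis by (rule that)
qed

lemma dirichlet_to_neumann_log_deriv:
  assumes "z \<notin> \<real>\<^sub>\<le>\<^sub>0" "integer_K n z \<noteq> 0"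
  shows "dirichlet_to_neumann n z = z + 1 / 2 + z * (deriv (integer_K n) z / integer_K n z)"
proof -
  have "z \<noteq> 0" using assms by auto
  then show ?thesis unfolding dirichlet_to_neumann_def integer_K_deriv[OF assms(1)] using assms(2) by (simp add: field_simps)
qed

lemma dirichlet_to_neumann_continuous:
  "continuous_on ({z. Im z \<ge> 0} - {0} - bessel_K_zeros (of_nat n)) (dirichlet_to_neumann n)"
  unfolding dirichlet_to_neumann_def[abs_def]
  by (intro continuous_intros continuous_on_subset[OF integer_K_continuous_upper]) (auto simp: bessel_K_zeros_of_nat)

lemma dirichlet_to_neumann_cnj:
  assumes "z \<notin> \<real>\<^sub>\<le>\<^sub>0"
  shows "dirichlet_to_neumann n (cnj z) = cnj (dirichlet_to_neumann n z)"
  using integer_K_cnj[OF assms] by (simp add: dirichlet_to_neumann_def)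

text \<open>The bound in the slit plane passes to the upper edge of the cut by continuity from above.\<close>
lemma dirichlet_to_neumann_decay:
  "\<exists>R C. R > 0 \<and> C \<ge> 0 \<and> (\<forall>z. Im z \<ge> 0 \<longrightarrow> R \<le> norm z \<longrightarrow> norm (dirichlet_to_neumann n z) \<le> C / norm z)"
proof -
  obtain R C where RC: "\<And>z. z \<notin> \<real>\<^sub>\<le>\<^sub>0 \<Longrightarrow> R \<le> norm z \<Longrightarrow> norm (dirichlet_to_neumann n z) \<le> C / norm z"
    using dirichlet_to_neumann_decay_slit[of n] by blast
  have RC': "norm (dirichlet_to_neumann n z) \<le> max C 0 / norm z" if "z \<notin> \<real>\<^sub>\<le>\<^sub>0" "R \<le> norm z" for z
    by (rule order.trans[OF RC[OF that] divide_right_mono]) auto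
  have "norm (dirichlet_to_neumann n z) \<le> max C 0 / norm z" if z: "Im z \<ge> 0" "max R 1 \<le> norm z" for z
  proof (cases "z \<in> \<real>\<^sub>\<le>\<^sub>0")
    case False
    then show ?thesis using RC' z by simp
  next
    case True
    then have zr: "Im z = 0" "Re z \<le> 0" by (auto simp: complex_nonpos_Reals_iff)
    have z0: "z \<noteq> 0" using z by auto
    have zZ: "z \<notin> bessel_K_zeros (of_nat n)" using integer_zeros_off_cut(2) zr(1) by blast
    define w where "w = (\<lambda>m::nat. Complex (Re z) (inverse (real (Suc m))))"
    have wim: "Im (w m) > 0" for m by (simp add: w_def)
    have wn: "norm z \<le> norm (w m)" for m
    proof -
      have "norm z = \<bar>Re z\<bar>" using zr by (simp add: cmod_def)
      then show ?thesis using abs_Re_le_cmod[of "w m"] by (simp add: w_def)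
    qed
    have wz: "w \<longlonglongrightarrow> z"
      unfolding tendsto_complex_iff w_def using zr LIMSEQ_inverse_real_of_nat by simp
    let ?S = "{z. Im z \<ge> 0} - {0}"
    let ?D = "\<lambda>m. dirichlet_to_neumann n (w m)"
    have K: "(\<lambda>m. integer_K j (w m)) \<longlonglongrightarrow> integer_K j z" for j
      by (rule continuous_on_tendsto_compose[OF integer_K_continuous_upper wz]) (use z z0 wim in \<open>auto simp: less_imp_le intro!: always_eventually, metis less_irrefl zero_complex.sel(2)\<close>)
    have "?D \<longlonglongrightarrow> dirichlet_to_neumann n z"
      unfolding dirichlet_to_neumann_def using zZ z0 by (intro tendsto_intros K wz) (auto simp: bessel_K_zeros_of_nat)
    then have l: "(\<lambda>m. norm (?D m)) \<longlonglongrightarrow> norm (dirichlet_to_neumann n z)" by (rule tendsto_norm)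
    have r: "(\<lambda>m. max C 0 / norm (w m)) \<longlonglongrightarrow> max C 0 / norm z" using z0 by (intro tendsto_intros wz) simp
    have "norm (?D m) \<le> max C 0 / norm (w m)" for m
    proof (rule RC')
      show "w m \<notin> \<real>\<^sub>\<le>\<^sub>0" using wim[of m] by (auto simp: complex_nonpos_Reals_iff)
      show "R \<le> norm (w m)" using wn[of m] z by simp
    qed
    then show ?thesis by (intro LIMSEQ_le[OF l r]) auto
  qed
  then show ?thesis by (intro exI[of _ "max R 1"] exI[of _ "max C 0"]) auto
qed

text \<open>
  The continuation formula gives real and imaginary parts of both orders on the cut, and the cross product reduces
  the numerator of the imaginary part to a constant.
\<close>
lemma dirichlet_to_neumann_edge:
  assumes r: "r > 0" and k: "integer_K n (of_real r) = of_real k" and i: "integer_I n (of_real r) = of_real i"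
  shows "Im (dirichlet_to_neumann n (- of_real r)) = - ((-1) ^ n * pi / (k\<^sup>2 + pi\<^sup>2 * i\<^sup>2))"
proof -
  obtain k' where k': "integer_K (n + 1) (of_real r) = of_real k'" using integer_K_pos_real[OF r, of "n + 1"] by auto
  obtain i' where i': "integer_I (n + 1) (of_real r) = of_real i'" using integer_I_pos_real[OF r, of "n + 1"] by auto
  have "complex_of_real r \<notin> \<real>\<^sub>\<le>\<^sub>0" using r by (simp add: complex_nonpos_Reals_iff)
  from integer_I_K_cross_product[OF this, of n] have "complex_of_real (r * (i * k' + i' * k)) = of_real 1"
    unfolding k i k' i' by simp
  then have W: "r * (i * k' + i' * k) = 1" by (simp only: of_real_eq_iff)
  define s :: real where "s = (-1) ^ n"
  have s2: "s\<^sup>2 = 1" by (simp add: s_def flip: power_mult)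
  have A: "integer_K n (- of_real r) = Complex (s * k) (- pi * i)"
    using integer_K_neg(1)[OF r, of n] k i by (simp add: complex_eq_iff s_def)
  have B: "integer_K (n + 1) (- of_real r) = Complex (- s * k') (- pi * i')"
    using integer_K_neg(1)[OF r, of "n + 1"] k' i' by (simp add: complex_eq_iff s_def)
  have "Im (dirichlet_to_neumann n (- of_real r)) = r * Im (Complex (- s * k') (- pi * i') / Complex (s * k) (- pi * i))"
  proof -
    have "Im (of_real r * u / v) = r * Im (u / v)" for u v
      by (subst times_divide_eq_right[symmetric], subst times_complex.sel(2)) simp
    then show ?thesis unfolding dirichlet_to_neumann_def A B by simp
  qed
  also have "Im (Complex (- s * k') (- pi * i') / Complex (s * k) (- pi * i)) = - (s * pi * (i * k' + i' * k)) / (k\<^sup>2 + pi\<^sup>2 * i\<^sup>2)"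
    using s2 by (simp add: Im_divide power_mult_distrib algebra_simps)
  also have "r * (- (s * pi * (i * k' + i' * k)) / (k\<^sup>2 + pi\<^sup>2 * i\<^sup>2)) = - (s * pi * (r * (i * k' + i' * k)) / (k\<^sup>2 + pi\<^sup>2 * i\<^sup>2))" by simp
  finally show ?thesis unfolding W by (simp add: s_def)
qed

lemma integer_zeros_sum_cnj:
  "(\<Sum>a\<in>bessel_K_zeros (of_nat n). a / (cnj z - a)) = cnj (\<Sum>a\<in>bessel_K_zeros (of_nat n). a / (z - a))"
proof -
  let ?Z = "bessel_K_zeros (of_nat n)"
  have "bij_betw cnj ?Z ?Z"
    by (rule bij_betwI[of _ _ _ cnj]) (use integer_zeros_cnj in auto)
  from sum.reindex_bij_betw[OF this, of "\<lambda>a. a / (cnj z - a)"]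
  have "(\<Sum>a\<in>?Z. a / (cnj z - a)) = (\<Sum>a\<in>?Z. cnj a / (cnj z - cnj a))" by simp
  then show ?thesis by simp
qed

lemma finite_pole_sum_decay:
  assumes "finite Z"
  shows "\<exists>R>0. \<forall>z. R \<le> norm z \<longrightarrow> z \<notin> Z \<and> norm (\<Sum>a\<in>Z. a / (z - a) :: complex) \<le> 2 * (\<Sum>a\<in>Z. norm a) / norm z"
proof -
  define R where "R = 1 + 2 * (\<Sum>a\<in>Z. norm a)"
  have S0: "0 \<le> (\<Sum>a\<in>Z. norm a)" by (intro sum_nonneg) auto
  have "z \<notin> Z \<and> norm (\<Sum>a\<in>Z. a / (z - a)) \<le> 2 * (\<Sum>a\<in>Z. norm a) / norm z" if z: "R \<le> norm z" for z
  proof -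
    have zp: "norm z > 0" using z S0 unfolding R_def by linarith
    have far: "norm z / 2 \<le> norm (z - a)" "z \<noteq> a" if a: "a \<in> Z" for a
    proof -
      have "norm a \<le> (\<Sum>a\<in>Z. norm a)" using a assms by (intro member_le_sum) auto
      then have 1: "2 * norm a \<le> norm z" using z by (simp add: R_def)
      then show "norm z / 2 \<le> norm (z - a)" using norm_triangle_ineq2[of z a] by linarith
      then show "z \<noteq> a" using zp by auto
    qed
    have "norm (a / (z - a)) \<le> norm a * (2 / norm z)" if a: "a \<in> Z" for a
    proof -
      have "norm (a / (z - a)) = norm a / norm (z - a)" by (simp add: norm_divide)
      also have "\<dots> \<le> norm a / (norm z / 2)" using far(1)[OF a] zp by (intro divide_left_mono mult_pos_pos norm_ge_zero) linarith+
      finally show ?thesis by simp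
    qed
    then have "norm (\<Sum>a\<in>Z. a / (z - a)) \<le> (\<Sum>a\<in>Z. norm a * (2 / norm z))" by (intro sum_norm_le)
    also have "\<dots> = 2 * (\<Sum>a\<in>Z. norm a) / norm z" unfolding sum_distrib_right[symmetric] by simp
    finally show ?thesis using far(2) by blast
  qed
  moreover have "R > 0" using S0 by (simp add: R_def)
  ultimately show ?thesis by blast
qed

text \<open>
  Subtracting the principal parts leaves a function that extends continuously to the closed upper half-plane, the
  origin included. Its imaginary part on the upper edge of the cut is the density of the integral.
\<close>
lemma integer_bromwich:
  fixes n :: nat and \<tau> :: real
  assumes \<tau>: "\<tau> > 0" and F: "zero_factorization (integer_K n) (bessel_K_zeros (of_nat n)) g"
  defines "w \<equiv> \<lambda>r::real. exp (- of_real (\<tau> * r)) / ((integer_K n (of_real r))\<^sup>2 + (of_real pi)\<^sup>2 * (integer_I n (of_real r))\<^sup>2)"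
  shows "set_integrable lborel {0<..} w"
    and "\<gamma> > 0 \<Longrightarrow> ((\<lambda>T. contour_integral (linepath (Complex \<gamma> (- T)) (Complex \<gamma> T))
        (\<lambda>z. regular_part (bessel_K_zeros (of_nat n)) g z * exp (of_real \<tau> * z))) \<longlongrightarrow>
        2 * of_real pi * \<i> * ((-1) ^ n * (LBINT r:{0<..}. w r))) at_top"
proof -
  let ?Z = "bessel_K_zeros (of_nat n)"
  let ?S = "\<lambda>z. \<Sum>a\<in>?Z. a / (z - a)"
  let ?U = "{z::complex. Im z \<ge> 0}"
  have fin: "finite ?Z" by (rule integer_zeros_finite)
  have Z0: "0 \<notin> ?Z" by (simp add: bessel_K_zeros_def)
  define D where "D = (\<lambda>z. dirichlet_to_neumann n z - ?S z)"
  \<comment> \<open>The regular part, continued to the cut by its limit from above. The zeros lie off the cut, so D is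
    defined on it; at the origin the limit is that of D, each zero adding one.\<close>
  define q where "q = (\<lambda>z. if z = 0 then 1 / 2 - of_nat n + of_nat (card ?Z) else
      if z \<in> \<real>\<^sub>\<le>\<^sub>0 then D z else regular_part ?Z g z)"
  have qreg: "q z = regular_part ?Z g z" if "z \<notin> \<real>\<^sub>\<le>\<^sub>0" for z using that by (auto simp: q_def)
  have regD: "regular_part ?Z g z = D z" if "z \<notin> \<real>\<^sub>\<le>\<^sub>0" "z \<notin> ?Z" for z
  proof -
    have "integer_K n z \<noteq> 0" using that zero_factorization_zero_iff[OF F that(1)] by simp
    then show ?thesis
      using zero_factorization_log_deriv[OF F that] dirichlet_to_neumann_log_deriv[OF that(1)] by (simp add: D_def)
  qed
  have qD: "q z = D z" if "z \<noteq> 0" "z \<notin> ?Z" for z using that regD by (auto simp: q_def)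
  have hol: "q holomorphic_on (- \<real>\<^sub>\<le>\<^sub>0)"
    by (rule holomorphic_transform[OF regular_part_holomorphic[OF F]]) (simp add: qreg)
  have contD: "continuous_on (?U - {0} - ?Z) D"
    unfolding D_def by (intro continuous_intros dirichlet_to_neumann_continuous) auto
  have cont: "continuous_on ?U q"
    unfolding continuous_on_eq_continuous_within
  proof
    fix z assume z: "z \<in> ?U"
    consider "z = 0" | "z \<in> ?Z" | "z \<noteq> 0" "z \<notin> ?Z" by blast
    then show "continuous (at z within ?U) q"
    proof cases
      case 1
      have "((\<lambda>z. z + 1 / 2 + of_nat n - z * integer_K (n + 1) z / integer_K n z - ?S z) \<longlongrightarrow>
          0 + 1 / 2 + of_nat n - 2 * of_nat n - (\<Sum>a\<in>?Z. a / (0 - a))) (at 0)"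
        by (intro tendsto_intros integer_K_ratio_at_0(2)) (use Z0 in auto)
      moreover have "(\<Sum>a\<in>?Z. a / (0 - a)) = (\<Sum>a\<in>?Z. - 1)" by (rule sum.cong) (use Z0 in auto)
      ultimately have "(D \<longlongrightarrow> q 0) (at 0)" by (simp add: D_def dirichlet_to_neumann_def q_def)
      moreover have "eventually (\<lambda>z. D z = q z) (at 0)"
      proof -
        have "open (- ?Z)" "0 \<in> - ?Z" using fin Z0 by (auto simp: finite_imp_closed)
        then have "eventually (\<lambda>z. z \<in> - ?Z) (nhds 0)" by (rule eventually_nhds_in_open)
        then show ?thesis unfolding eventually_at_filter by (rule eventually_mono) (use qD in auto)
      qed
      ultimately have "(q \<longlongrightarrow> q 0) (at 0)" by (rule Lim_transform_eventually)
      then show ?thesis unfolding 1 by (auto simp: continuous_within intro: tendsto_within_subset)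
    next
      case 2
      then have "z \<in> - \<real>\<^sub>\<le>\<^sub>0" using integer_zeros_off_cut(1) by blast
      then have "isCont q z"
        using holomorphic_on_imp_continuous_on[OF hol] unfolding continuous_on_eq_continuous_at[OF slit_plane_facts(1)] by blast
      then show ?thesis by (rule continuous_at_imp_continuous_at_within)
    next
      case 3
      let ?V = "- ({0} \<union> ?Z)"
      have V: "open ?V" "z \<in> ?V" using fin 3 by (auto simp: finite_imp_closed intro!: open_Compl closed_Un)
      have "continuous_on (?U - {0} - ?Z) q"
        using contD by (rule continuous_on_eq) (use qD in auto)
      then have "continuous (at z within (?U - {0} - ?Z)) q" using z 3 by (simp add: continuous_on_eq_continuous_within)
      moreover have "at z within (?U - {0} - ?Z) = at z within ?U"
        by (rule at_within_nhd[OF V(2,1)]) auto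
      ultimately show ?thesis by simp
    qed
  qed
  obtain R1 C1 where 1: "R1 > 0" "C1 \<ge> 0" "\<And>z. Im z \<ge> 0 \<Longrightarrow> R1 \<le> norm z \<Longrightarrow> norm (dirichlet_to_neumann n z) \<le> C1 / norm z"
    using dirichlet_to_neumann_decay[of n] by blast
  obtain R2 where 2: "R2 > 0" "\<And>z. R2 \<le> norm z \<Longrightarrow> z \<notin> ?Z \<and> norm (?S z) \<le> 2 * (\<Sum>a\<in>?Z. norm a) / norm z"
    using finite_pole_sum_decay[OF fin] by blast
  let ?C = "C1 + 2 * (\<Sum>a\<in>?Z. norm a)"
  have C: "?C \<ge> 0" using 1(2) by (intro add_nonneg_nonneg mult_nonneg_nonneg sum_nonneg) auto
  have bd: "norm (q z) \<le> ?C / norm z" if z: "Im z \<ge> 0" "max R1 R2 \<le> norm z" for z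
  proof -
    have z0: "z \<noteq> 0" using z 1(1) by auto
    have R2z: "R2 \<le> norm z" and R1z: "R1 \<le> norm z" using z(2) by auto
    have "q z = D z" using qD z0 2(2)[OF R2z] by blast
    then have "norm (q z) \<le> norm (dirichlet_to_neumann n z) + norm (?S z)" unfolding D_def by (simp only: norm_triangle_ineq4)
    also have "\<dots> \<le> C1 / norm z + 2 * (\<Sum>a\<in>?Z. norm a) / norm z" using 1(3)[OF z(1) R1z] 2(2)[OF R2z] by (intro add_mono) auto
    finally show ?thesis by (simp only: add_divide_distrib)
  qed
  have sym: "q (cnj z) = cnj (q z)" if z: "z \<notin> \<real>\<^sub>\<le>\<^sub>0" for z
  proof -
    have cs: "cnj ` (- \<real>\<^sub>\<le>\<^sub>0) = - \<real>\<^sub>\<le>\<^sub>0"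
      by (auto simp: complex_nonpos_Reals_iff image_iff intro!: bexI[of _ "cnj _"])
    have "(cnj \<circ> q \<circ> cnj) holomorphic_on (- \<real>\<^sub>\<le>\<^sub>0)"
      by (rule holomorphic_on_compose_cnj_cnj) (use hol slit_plane_facts cs in auto)
    then have holc: "(\<lambda>z. cnj (q (cnj z)) - q z) holomorphic_on (- \<real>\<^sub>\<le>\<^sub>0)"
      using hol by (auto intro!: holomorphic_intros simp: o_def)
    have "cnj (q (cnj z)) - q z = 0"
    proof (rule analytic_continuation[OF holc slit_plane_facts, of "of_real ` {0<..}" 1])
      show "1 islimpt complex_of_real ` {0<..}" by (rule positive_reals_islimpt_1)
      fix v assume "v \<in> complex_of_real ` {0<..}"
      then obtain x where x: "v = of_real x" "x \<in> {0<..}" by (rule imageE)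
      have "v \<notin> \<real>\<^sub>\<le>\<^sub>0" using x by (simp add: complex_nonpos_Reals_iff)
      moreover have "v \<notin> ?Z" using integer_zeros_off_cut(2)[of v n] x by auto
      moreover have "cnj v = v" using x by simp
      ultimately show "cnj (q (cnj v)) - q v = 0"
        using integer_zeros_sum_cnj[of v n] dirichlet_to_neumann_cnj[of v n] qreg[of v] regD[of v] by (simp add: D_def)
    qed (use z in \<open>auto simp: complex_nonpos_Reals_iff\<close>)
    then show ?thesis by (metis complex_cnj_cnj eq_iff_diff_eq_0)
  qed
  let ?\<rho> = "\<lambda>r. Im (q (- of_real r)) * exp (- \<tau> * r)"
  note cut = bromwich_cut[where R="max R1 R2", OF \<tau> _ hol cont bd C sym]
  have int0: "set_integrable lborel {0..} ?\<rho>" by (rule cut(1)[of 1]) auto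
  have w\<rho>: "complex_of_real (?\<rho> r) = - (of_real pi * (-1) ^ n) * w r" if r: "r > 0" for r
  proof -
    obtain k where k: "integer_K n (of_real r) = of_real k" using integer_K_pos_real[OF r, of n] by auto
    obtain i where i: "integer_I n (of_real r) = of_real i" using integer_I_pos_real[OF r, of n] by auto
    have nz: "- complex_of_real r \<noteq> 0" using r by simp
    have "- complex_of_real r \<in> \<real>\<^sub>\<le>\<^sub>0" using r by (simp add: complex_nonpos_Reals_iff)
    then have nZ: "- complex_of_real r \<notin> ?Z" using integer_zeros_off_cut(1) by blast
    have "cnj (?S (- of_real r)) = ?S (- of_real r)" using integer_zeros_sum_cnj[of "- of_real r" n] by simp
    moreover have "Im x = 0" if "cnj x = x" for x using that by (simp add: complex_eq_iff)
    ultimately have "Im (?S (- of_real r)) = 0" by blast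
    then have "Im (q (- of_real r)) = - ((-1) ^ n * pi / (k\<^sup>2 + pi\<^sup>2 * i\<^sup>2))"
      unfolding qD[OF nz nZ] D_def using dirichlet_to_neumann_edge[OF r k i] by simp
    then show ?thesis unfolding w_def k i by (simp flip: exp_of_real)
  qed
  have s: "(-1) ^ n * (-1) ^ n = (1::complex)" by (simp flip: power_mult_distrib)
  have w\<rho>': "w r = - (1 / of_real pi * (-1) ^ n) * of_real (?\<rho> r)" if "r > 0" for r
  proof -
    have "- (1 / of_real pi * (-1) ^ n) * (- (of_real pi * (-1) ^ n) * w r) = ((-1) ^ n * (-1) ^ n) * w r" by simp
    then show ?thesis unfolding w\<rho>[OF that] s by simp
  qed
  have intc: "set_integrable lborel {0<..} (\<lambda>r. complex_of_real (?\<rho> r))"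
  proof -
    have "set_integrable lborel {0<..} ?\<rho>" by (rule set_integrable_subset[OF int0]) auto
    then have "integrable lborel (\<lambda>r. complex_of_real (indicator {0<..} r *\<^sub>R ?\<rho> r))" unfolding set_integrable_def by (rule integrable_of_real)
    then show ?thesis by (simp add: set_integrable_def scaleR_conv_of_real)
  qed
  have "set_integrable lborel {0<..} (\<lambda>r. - (1 / of_real pi * (-1) ^ n) * complex_of_real (?\<rho> r))"
    by (rule set_integrable_mult_right) (rule intc)
  then show "set_integrable lborel {0<..} w"
    by (rule set_integrable_cong[THEN iffD1, rotated -1]) (use w\<rho>' in auto)
  show "((\<lambda>T. contour_integral (linepath (Complex \<gamma> (- T)) (Complex \<gamma> T))
        (\<lambda>z. regular_part ?Z g z * exp (of_real \<tau> * z))) \<longlongrightarrow>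
        2 * of_real pi * \<i> * ((-1) ^ n * (LBINT r:{0<..}. w r))) at_top" if \<gamma>: "\<gamma> > 0"
  proof -
    have "(LBINT r:{0..}. ?\<rho> r) = (LBINT r:{0<..}. ?\<rho> r)"
      by (rule set_integral_discrete_difference[of "{0}"]) auto
    then have "complex_of_real (LBINT r:{0..}. ?\<rho> r) = (LBINT r:{0<..}. complex_of_real (?\<rho> r))"
      by (simp only: set_integral_complex_of_real)
    also have "\<dots> = (LBINT r:{0<..}. - (of_real pi * (-1) ^ n) * w r)"
      by (rule set_lebesgue_integral_cong) (use w\<rho> in auto)
    also have "\<dots> = - (of_real pi * (-1) ^ n) * (LBINT r:{0<..}. w r)" by (rule set_integral_mult_right)
    finally have J: "complex_of_real (LBINT r:{0..}. ?\<rho> r) = - (of_real pi * (-1) ^ n) * (LBINT r:{0<..}. w r)" .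
    have "contour_integral (linepath (Complex \<gamma> (- T)) (Complex \<gamma> T)) (\<lambda>z. q z * exp (of_real \<tau> * z)) =
       contour_integral (linepath (Complex \<gamma> (- T)) (Complex \<gamma> T)) (\<lambda>z. regular_part ?Z g z * exp (of_real \<tau> * z))" for T
    proof (rule contour_integral_cong[OF refl])
      fix z assume "z \<in> path_image (linepath (Complex \<gamma> (- T)) (Complex \<gamma> T))"
      then have "z \<in> closed_segment (Complex \<gamma> (- T)) (Complex \<gamma> T)" by simp
      from segment_re_im_bounds(2)[OF this] have "z \<notin> \<real>\<^sub>\<le>\<^sub>0" using \<gamma> by (auto simp: complex_nonpos_Reals_iff)
      then show "q z * exp (of_real \<tau> * z) = regular_part ?Z g z * exp (of_real \<tau> * z)" by (simp add: qreg)
    qed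
    moreover have "((\<lambda>T. contour_integral (linepath (Complex \<gamma> (- T)) (Complex \<gamma> T)) (\<lambda>z. q z * exp (of_real \<tau> * z)))
      \<longlongrightarrow> - (2 * \<i> * of_real (LBINT r:{0..}. ?\<rho> r))) at_top"
      by (rule cut(2)[OF \<gamma>]) auto
    moreover have "- (2 * \<i> * (- (of_real pi * (-1) ^ n) * W)) = 2 * of_real pi * \<i> * ((-1) ^ n * W)" for W by simp
    ultimately show ?thesis unfolding J by (simp only:)
  qed
qed

text \<open>
  A transform holomorphic across the cut would have the same limit from both sides of a point of the cut,
  but the limits are complex conjugates with non-zero imaginary part.
\<close>
lemma integer_not_holomorphic_across_cut:
  assumes b: "b > 0" and c: "c > 0" and neg: "\<gamma>\<^sub>0 < 0"
  shows "\<not> sigma_transform b c (of_nat n) holomorphic_on {s. Re s > \<gamma>\<^sub>0}"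
proof
  let ?H = "sigma_transform b c (of_nat n)" and ?Z = "bessel_K_zeros (of_nat n)"
  let ?\<beta> = "complex_of_real (b / c)"
  assume hol: "?H holomorphic_on {s. Re s > \<gamma>\<^sub>0}"
  obtain g where F: "zero_factorization (integer_K n) ?Z g" using integer_factorization by blast
  have F': "zero_factorization (bessel_K (of_nat n)) ?Z g" using F by (simp add: integer_K_def)
  have \<beta>: "b / c > 0" using b c by simp
  define \<rho> where "\<rho> = - \<gamma>\<^sub>0 / 2"
  have \<rho>: "\<rho> > 0" "- \<rho> > \<gamma>\<^sub>0" using neg by (auto simp: \<rho>_def)
  define r where "r = b / c * \<rho>"
  have r: "r > 0" unfolding r_def using \<beta> \<rho>(1) by (rule mult_pos_pos)
  have H: "?H s = 1 / of_real b * dirichlet_to_neumann n (?\<beta> * s)" if "?\<beta> * s \<notin> \<real>\<^sub>\<le>\<^sub>0" "?\<beta> * s \<notin> ?Z" for s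
  proof -
    have "integer_K n (?\<beta> * s) \<noteq> 0" using that zero_factorization_zero_iff[OF F that(1)] by simp
    then show ?thesis
      using sigma_transform_eq[OF b c F' that] zero_factorization_log_deriv[OF F that] dirichlet_to_neumann_log_deriv[OF that(1)] by simp
  qed
  have isC: "isCont ?H (- of_real \<rho>)"
    using holomorphic_on_imp_continuous_on[OF hol] \<rho>(2) unfolding continuous_on_eq_continuous_at[OF open_halfspace_Re_gt[of \<gamma>\<^sub>0]] by simp
  define u where "u = (\<lambda>m::nat. Complex (- \<rho>) (inverse (real (Suc m))))"
  have uim: "Im (u m) > 0" for m by (simp add: u_def)
  have ulim: "u \<longlonglongrightarrow> - of_real \<rho>" unfolding tendsto_complex_iff u_def using LIMSEQ_inverse_real_of_nat by simp
  have cul: "(\<lambda>m. cnj (u m)) \<longlonglongrightarrow> - of_real \<rho>" using tendsto_cnj[OF ulim] by simp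
  have up: "(\<lambda>m. ?H (u m)) \<longlonglongrightarrow> ?H (- of_real \<rho>)" and down: "(\<lambda>m. ?H (cnj (u m))) \<longlonglongrightarrow> ?H (- of_real \<rho>)"
    using isCont_tendsto_compose[OF isC ulim] isCont_tendsto_compose[OF isC cul] by auto
  have \<beta>u: "(\<lambda>m. ?\<beta> * u m) \<longlonglongrightarrow> - of_real r"
    using tendsto_mult[OF tendsto_const ulim, of ?\<beta>] by (simp add: r_def)
  have \<beta>uim: "Im (?\<beta> * u m) > 0" for m
  proof -
    have "Im (?\<beta> * u m) = b / c * Im (u m)" by simp
    also have "\<dots> > 0" using \<beta> uim[of m] by (rule mult_pos_pos)
    finally show ?thesis .
  qed
  have rcut: "- complex_of_real r \<in> \<real>\<^sub>\<le>\<^sub>0" using r by (simp add: complex_nonpos_Reals_iff)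
  then have rZ: "- complex_of_real r \<notin> ?Z" using integer_zeros_off_cut(1) by blast
  let ?A = "{z. Im z \<ge> 0} - {0} - ?Z"
  have rA: "- complex_of_real r \<in> ?A" using rZ r by simp
  have "eventually (\<lambda>m. ?\<beta> * u m \<in> - ?Z) sequentially"
    by (rule topological_tendstoD[OF \<beta>u]) (use integer_zeros_finite rZ in \<open>auto simp: finite_imp_closed\<close>)
  then have evA: "eventually (\<lambda>m. ?\<beta> * u m \<in> ?A) sequentially"
  proof (rule eventually_mono)
    fix m assume "?\<beta> * u m \<in> - ?Z"
    moreover have "?\<beta> * u m \<in> {z. Im z \<ge> 0}" using less_imp_le[OF \<beta>uim[of m]] by blast
    moreover have "?\<beta> * u m \<noteq> 0" using \<beta>uim[of m] by (metis less_irrefl zero_complex.sel(2))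
    ultimately show "?\<beta> * u m \<in> ?A" by blast
  qed
  have "(\<lambda>m. 1 / of_real b * dirichlet_to_neumann n (?\<beta> * u m)) \<longlonglongrightarrow> 1 / of_real b * dirichlet_to_neumann n (- of_real r)"
    by (intro tendsto_mult tendsto_const continuous_on_tendsto_compose[OF dirichlet_to_neumann_continuous \<beta>u rA evA])
  moreover have evH: "eventually (\<lambda>m. 1 / of_real b * dirichlet_to_neumann n (?\<beta> * u m) = ?H (u m)) sequentially"
    using evA
  proof eventually_elim
    case (elim m)
    have "?\<beta> * u m \<notin> \<real>\<^sub>\<le>\<^sub>0" using \<beta>uim[of m] unfolding complex_nonpos_Reals_iff by linarith
    then show ?case using H[of "u m"] elim by simp
  qed
  ultimately have "(\<lambda>m. ?H (u m)) \<longlonglongrightarrow> 1 / of_real b * dirichlet_to_neumann n (- of_real r)" by (rule Lim_transform_eventually)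
  then have E1: "?H (- of_real \<rho>) = 1 / of_real b * dirichlet_to_neumann n (- of_real r)" using up LIMSEQ_unique by blast
  have "(\<lambda>m. cnj (?H (u m))) \<longlonglongrightarrow> cnj (?H (- of_real \<rho>))" by (rule tendsto_cnj[OF up])
  moreover have "eventually (\<lambda>m. cnj (?H (u m)) = ?H (cnj (u m))) sequentially"
    using evA evH
  proof eventually_elim
    case (elim m)
    have 1: "?\<beta> * u m \<notin> \<real>\<^sub>\<le>\<^sub>0" using \<beta>uim[of m] unfolding complex_nonpos_Reals_iff by linarith
    have e: "?\<beta> * cnj (u m) = cnj (?\<beta> * u m)" by simp
    have "cnj x \<notin> \<real>\<^sub>\<le>\<^sub>0" if "Im x > 0" for x using that by (auto simp: complex_nonpos_Reals_iff)
    then have 2: "?\<beta> * cnj (u m) \<notin> \<real>\<^sub>\<le>\<^sub>0" unfolding e using \<beta>uim[of m] by blast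
    have 3: "?\<beta> * cnj (u m) \<notin> ?Z"
    proof
      assume "?\<beta> * cnj (u m) \<in> ?Z"
      then have "cnj (cnj (?\<beta> * u m)) \<in> ?Z" unfolding e by (rule integer_zeros_cnj)
      then show False using elim by simp
    qed
    have "cnj (?H (u m)) = 1 / of_real b * cnj (dirichlet_to_neumann n (?\<beta> * u m))"
      unfolding elim(2)[symmetric] by simp
    also have "\<dots> = 1 / of_real b * dirichlet_to_neumann n (?\<beta> * cnj (u m))"
      unfolding e dirichlet_to_neumann_cnj[OF 1] ..
    also have "\<dots> = ?H (cnj (u m))" by (rule H[OF 2 3, symmetric])
    finally show ?case .
  qed
  ultimately have "(\<lambda>m. ?H (cnj (u m))) \<longlonglongrightarrow> cnj (?H (- of_real \<rho>))" by (rule Lim_transform_eventually)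
  then have "cnj (?H (- of_real \<rho>)) = ?H (- of_real \<rho>)" using down LIMSEQ_unique by blast
  then have "Im (?H (- of_real \<rho>)) = 0" by (metis cnj.sel(2) neg_equal_zero)
  moreover have "Im (1 / of_real b * d) = Im d / b" for d by simp
  ultimately have "Im (dirichlet_to_neumann n (- of_real r)) = 0" unfolding E1 using b by simp
  moreover obtain k where k: "k > 0" "integer_K n (of_real r) = of_real k" using integer_K_pos_real[OF r, of n] by auto
  moreover obtain i where i: "integer_I n (of_real r) = of_real i" using integer_I_pos_real[OF r, of n] by auto
  ultimately have "(-1) ^ n * pi / (k\<^sup>2 + pi\<^sup>2 * i\<^sup>2) = 0" using dirichlet_to_neumann_edge[OF r k(2) i] by simp
  moreover have "k\<^sup>2 + pi\<^sup>2 * i\<^sup>2 > 0" using k(1) by (intro add_pos_nonneg) auto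
  ultimately show False by simp
qed

section \<open>The inverse transforms\<close>

theorem theorem2p1:
  fixes b c t :: real and n :: nat
  assumes "b > 0" and "c > 0" and "t > 0"
  shows
    "(finite (bessel_K_zeros (of_nat n)) \<and>
      has_inverse_laplace (sigma_transform b c (of_nat n)) t (sigma_nu b c (of_nat n) t) \<and>
      set_integrable lborel {0<..}
        (\<lambda>r::real. exp (- of_real (c * t * r / b)) /
             ((bessel_K (of_nat n) (of_real r))\<^sup>2 + (of_real pi)\<^sup>2 * (bessel_I (of_nat n) (of_real r))\<^sup>2)) \<and>
      sigma_nu b c (of_nat n) t =
        of_real (c / b\<^sup>2) *
          ((\<Sum>z\<in>bessel_K_zeros (of_nat n). z * exp (of_real (c * t) * z / of_real b)) +
           (- 1) ^ n *
             (LBINT r:{0<..}. exp (- of_real (c * t * r / b)) /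
               ((bessel_K (of_nat n) (of_real r))\<^sup>2 + (of_real pi)\<^sup>2 * (bessel_I (of_nat n) (of_real r))\<^sup>2))))
     \<and>
     (finite (bessel_K_zeros (of_nat n + 1 / 2)) \<and>
      has_inverse_laplace (sigma_transform b c (of_nat n + 1 / 2)) t (sigma_nu b c (of_nat n + 1 / 2) t) \<and>
      sigma_nu b c (of_nat n + 1 / 2) t =
        of_real (c / b\<^sup>2) *
          (\<Sum>z\<in>bessel_K_zeros (of_nat n + 1 / 2). z * exp (of_real (c * t) * z / of_real b)))"
proof -
  have e: "of_real (c * t) * z / of_real b = of_real (c * t / b) * z" for z :: complex by simp
  have r: "c * t * r / b = c * t / b * r" for r by simp
  have \<tau>: "c * t / b > 0" using assms by simp
  obtain g where F: "zero_factorization (integer_K n) (bessel_K_zeros (of_nat n)) g" using integer_factorization by blast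
  then have F': "zero_factorization (bessel_K (of_nat n)) (bessel_K_zeros (of_nat n)) g" by (simp add: integer_K_def)
  let ?w = "\<lambda>r::real. exp (- of_real (c * t / b * r)) /
               ((bessel_K (of_nat n) (of_real r))\<^sup>2 + (of_real pi)\<^sup>2 * (bessel_I (of_nat n) (of_real r))\<^sup>2) :: complex"
  note ib = integer_bromwich[OF \<tau> F, unfolded integer_K_def integer_I_def]
  have int: "has_inverse_laplace (sigma_transform b c (of_nat n)) t
     (of_real (c / b\<^sup>2) * ((\<Sum>z\<in>bessel_K_zeros (of_nat n). z * exp (of_real (c * t / b) * z)) + (- 1) ^ n * (LBINT r:{0<..}. ?w r)))"
    using sigma_has_inverse_laplace[OF assms(1,2) F' assms(3) integer_not_holomorphic_across_cut[OF assms(1,2)] ib(2)] by simp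
  note half = half_integer_inverse_laplace[OF assms, of n]
  have s1: "sigma_nu b c (of_nat n) t =
      of_real (c / b\<^sup>2) * ((\<Sum>z\<in>bessel_K_zeros (of_nat n). z * exp (of_real (c * t / b) * z)) + (- 1) ^ n * (LBINT r:{0<..}. ?w r))"
    unfolding sigma_nu_def by (rule inverse_laplace_eqI[OF int])
  have s2: "sigma_nu b c (of_nat n + 1 / 2) t =
      of_real (c / b\<^sup>2) * (\<Sum>z\<in>bessel_K_zeros (of_nat n + 1 / 2). z * exp (of_real (c * t / b) * z))"
    unfolding sigma_nu_def by (rule inverse_laplace_eqI[OF half])
  show ?thesis
    unfolding e r
    by (intro conjI integer_zeros_finite bessel_K_zeros_half_integer_finite s1 s2 ib(1) int[folded s1] half[folded s2])
qed

end
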